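(* Let $A$ and $B$ be central simple algebras with centre $K$, equipped with arbitrary involutions $\sigma$ and $\tau$, respectively. Assume that $(A,\sigma)$ and $(B,\tau)$ have the same fixed field $F$, and that $F$ is formally real. If the PS Conjecture holds for $(A,\sigma)$ and for $(B,\tau)$, then it also holds for the tensor product $(A\otimes_K B,\sigma\otimes\tau)$.
   Context: Let $(A,\sigma)$ be a (finite-dimensional) central simple algebra with centre $K$ and involution $\sigma$ (a ring anti-automorphism with $\sigma^2=\mathrm{id}$). Its fixed field is $F=\{x\in K:\sigma(x)=x\}$. The involution is of the first kind if $K=F$ and of the second kind (unitary) otherwise; in the latter case $[K:F]=2$ and $\sigma|_K$ is the non-trivial element of $\mathrm{Gal}(K/F)$. Let $\mathrm{Trd}:A\to F$ denote the reduced trace $\mathrm{Trd}_{A/F}$ if $\sigma$ is of the first kind, and the composition $\mathrm{Trd}_{K/F}\circ\mathrm{Trd}_{A/K}$ of the reduced trace with the trace of $K/F$ if $\sigma$ is of the second kind. Put $\mathrm{Sym}(A,\sigma)=\{a\in A:\sigma(a)=a\}$. An ordering $\leq_P$ of $F$ is a $\sigma$-ordering if $0\leq_P\mathrm{Trd}(\sigma(x)x)$ for all $x\in A$. An element $a\in\mathrm{Sym}(A,\sigma)$ is $\sigma$-positive with respect to a $\sigma$-ordering $\leq_P$ if $0\leq_P\mathrm{Trd}(\sigma(x)ax)$ for all $x\in A$; it is totally $\sigma$-positive if it is $\sigma$-positive with respect to all $\sigma$-orderings of $F$ (a vacuous condition if there are none). Hermitian squares in $(A,\sigma)$ are elements $\sigma(x)x$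 with $x\in A$; sums are finite. "The PS Conjecture holds for $(A,\sigma)$" means: every totally $\sigma$-positive element of $A$ is a sum of hermitian squares in $(A,\sigma)$. *)

theory Defs
  imports
    "HOL-Algebra.QuotRing"
    "HOL-Algebra.Embedded_Algebras"
    "HOL-Algebra.Algebraic_Closure_Type"
    "HOL-Library.Poly_Mapping"
    "Jordan_Normal_Form.Matrix"
begin

section \<open>Central simple algebras\<close>

text \<open>
  The base field is a type \<open>'k\<close> of class \<^class>\<open>field\<close>. A \<open>'k\<close>-algebra is a record of type
  \<^typ>\<open>('k, 'a) module\<close>, whose carrier is an arbitrary set. (The locale \<^locale>\<open>algebra\<close> of
  HOL-Algebra is restricted to commutative algebras.)
\<close>

locale assoc_algebra =
  ring A + module "ring_of_type_algebra :: 'k ring" A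
  for A :: "('k::field, 'a) module" +
  assumes smult_mult_left: "\<lbrakk>x \<in> carrier A; y \<in> carrier A\<rbrakk> \<Longrightarrow>
      (c \<odot>\<^bsub>A\<^esub> x) \<otimes>\<^bsub>A\<^esub> y = c \<odot>\<^bsub>A\<^esub> (x \<otimes>\<^bsub>A\<^esub> y)"
    and smult_mult_right: "\<lbrakk>x \<in> carrier A; y \<in> carrier A\<rbrakk> \<Longrightarrow>
      x \<otimes>\<^bsub>A\<^esub> (c \<odot>\<^bsub>A\<^esub> y) = c \<odot>\<^bsub>A\<^esub> (x \<otimes>\<^bsub>A\<^esub> y)"

definition scalars :: "('k::field, 'a) module \<Rightarrow> 'a set"
  where "scalars A = range (\<lambda>c. c \<odot>\<^bsub>A\<^esub> \<one>\<^bsub>A\<^esub>)"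

definition center :: "('k::field, 'a) module \<Rightarrow> 'a set"
  where "center A = {z \<in> carrier A. \<forall>x \<in> carrier A. z \<otimes>\<^bsub>A\<^esub> x = x \<otimes>\<^bsub>A\<^esub> z}"

text \<open>
  The centre of \<open>A\<close> is \<open>'k\<close>, embedded by \<open>c \<mapsto> c \<cdot> 1\<close>; this embedding is injective because
  \<open>A\<close> is nonzero.
\<close>

locale central_simple_algebra = assoc_algebra A for A :: "('k::field, 'a) module" +
  assumes one_neq_zero: "\<one>\<^bsub>A\<^esub> \<noteq> \<zero>\<^bsub>A\<^esub>"
    and simple: "ideal I A \<Longrightarrow> I = {\<zero>\<^bsub>A\<^esub>} \<or> I = carrier A"
    and central: "center A = scalars A"
    and finite_dim: "ring.finite_dimension A (scalars A) (carrier A)"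


section \<open>Tensor products of algebras\<close>

text \<open>
  The free \<open>'k\<close>-vector space on \<open>A \<times> B\<close>, with the multiplication that extends
  \<open>(a, b) (a', b') = (a a', b b')\<close> bilinearly.
\<close>

definition free_algebra ::
    "('k::field, 'a) module \<Rightarrow> ('k, 'b) module \<Rightarrow> ('a \<times> 'b \<Rightarrow>\<^sub>0 'k) ring"
  where "free_algebra A B = \<lparr>
    carrier = {f. Poly_Mapping.keys f \<subseteq> carrier A \<times> carrier B},
    monoid.mult = (\<lambda>f g. \<Sum>u \<in> Poly_Mapping.keys f. \<Sum>v \<in> Poly_Mapping.keys g.
      Poly_Mapping.single (fst u \<otimes>\<^bsub>A\<^esub> fst v, snd u \<otimes>\<^bsub>B\<^esub> snd v)
        (Poly_Mapping.lookup f u * Poly_Mapping.lookup g v)),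
    one = Poly_Mapping.single (\<one>\<^bsub>A\<^esub>, \<one>\<^bsub>B\<^esub>) 1,
    ring.zero = 0,
    add = (+)\<rparr>"

definition scale :: "'k::field \<Rightarrow> ('c \<Rightarrow>\<^sub>0 'k) \<Rightarrow> ('c \<Rightarrow>\<^sub>0 'k)"
  where "scale c f = Poly_Mapping.map ((*) c) f"

definition bilinear_relations ::
    "('k::field, 'a) module \<Rightarrow> ('k, 'b) module \<Rightarrow> ('a \<times> 'b \<Rightarrow>\<^sub>0 'k) set"
  where "bilinear_relations A B =
    (let e = (\<lambda>a b. Poly_Mapping.single (a, b) 1) in
      {e (a \<oplus>\<^bsub>A\<^esub> a') b - e a b - e a' b | a a' b.
        a \<in> carrier A \<and> a' \<in> carrier A \<and> b \<in> carrier B}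
    \<union> {e a (b \<oplus>\<^bsub>B\<^esub> b') - e a b - e a b' | a b b'.
        a \<in> carrier A \<and> b \<in> carrier B \<and> b' \<in> carrier B}
    \<union> {e (c \<odot>\<^bsub>A\<^esub> a) b - scale c (e a b) | c a b. a \<in> carrier A \<and> b \<in> carrier B}
    \<union> {e a (c \<odot>\<^bsub>B\<^esub> b) - scale c (e a b) | c a b. a \<in> carrier A \<and> b \<in> carrier B})"

definition tensor_kernel ::
    "('k::field, 'a) module \<Rightarrow> ('k, 'b) module \<Rightarrow> ('a \<times> 'b \<Rightarrow>\<^sub>0 'k) set"
  where "tensor_kernel A B = Modules.module.span scale (bilinear_relations A B)"

definition tensor_class ::
    "('k::field, 'a) module \<Rightarrow> ('k, 'b) module \<Rightarrow> ('a \<times> 'b \<Rightarrow>\<^sub>0 'k) \<Rightarrow> ('a \<times> 'b \<Rightarrow>\<^sub>0 'k) set"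
  where "tensor_class A B f = tensor_kernel A B +>\<^bsub>free_algebra A B\<^esub> f"

definition tensor_algebra ::
    "('k::field, 'a) module \<Rightarrow> ('k, 'b) module \<Rightarrow> ('k, ('a \<times> 'b \<Rightarrow>\<^sub>0 'k) set) module"
  where "tensor_algebra A B =
    (let Q = free_algebra A B Quot tensor_kernel A B in \<lparr>
      carrier = carrier Q,
      monoid.mult = monoid.mult Q,
      one = one Q,
      ring.zero = ring.zero Q,
      add = add Q,
      module.smult = (\<lambda>c T. \<Union>f \<in> T. tensor_class A B (scale c f))\<rparr>)"

definition pure_tensor ::
    "('k::field, 'a) module \<Rightarrow> ('k, 'b) module \<Rightarrow> 'a \<Rightarrow> 'b \<Rightarrow> ('a \<times> 'b \<Rightarrow>\<^sub>0 'k) set"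
  where "pure_tensor A B a b = tensor_class A B (Poly_Mapping.single (a, b) 1)"

text \<open>
  \<open>\<sigma> \<otimes> \<tau>\<close> sends the sum of the \<open>(c a) \<otimes> b\<close> to the sum of the \<open>\<sigma>(c a) \<otimes> \<tau>(b)\<close>. The scalar
  \<open>c\<close> has to stay inside the argument of \<open>\<sigma>\<close>, since an involution of the second kind is not
  \<open>'k\<close>-linear. The union does not depend on representatives when \<open>\<sigma>\<close> and \<open>\<tau>\<close> agree on \<open>'k\<close>.
\<close>

definition tensor_involution ::
    "('k::field, 'a) module \<Rightarrow> ('k, 'b) module \<Rightarrow> ('a \<Rightarrow> 'a) \<Rightarrow> ('b \<Rightarrow> 'b)
      \<Rightarrow> ('a \<times> 'b \<Rightarrow>\<^sub>0 'k) set \<Rightarrow> ('a \<times> 'b \<Rightarrow>\<^sub>0 'k) set"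
  where "tensor_involution A B \<sigma> \<tau> T =
    (\<Union>f \<in> T. tensor_class A B (\<Sum>u \<in> Poly_Mapping.keys f.
      Poly_Mapping.single (\<sigma> (Poly_Mapping.lookup f u \<odot>\<^bsub>A\<^esub> fst u), \<tau> (snd u)) 1))"


section \<open>The reduced trace\<close>

definition closure_algebra :: "('k::field, 'k alg_closure) module"
  where "closure_algebra = \<lparr>
    carrier = UNIV,
    monoid.mult = (*),
    one = 1,
    ring.zero = 0,
    add = (+),
    module.smult = (\<lambda>c l. to_ac c * l)\<rparr>"

definition mat_trace :: "'l::comm_monoid_add mat \<Rightarrow> 'l"
  where "mat_trace M = (\<Sum>i < dim_row M. M $$ (i, i))"

text \<open>Isomorphisms of \<open>L\<close>-algebras from \<open>A \<otimes> L\<close> to \<open>M\<^sub>n(L)\<close>, for an algebraic closure \<open>L\<close> of \<open>'k\<close>.\<close>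

definition splitting ::
    "('k::field, 'a) module \<Rightarrow> nat
      \<Rightarrow> (('a \<times> 'k alg_closure \<Rightarrow>\<^sub>0 'k) set \<Rightarrow> 'k alg_closure mat) \<Rightarrow> bool"
  where "splitting A n h \<longleftrightarrow>
    h \<in> ring_iso (tensor_algebra A closure_algebra) (ring_mat TYPE('k alg_closure) n ()) \<and>
    (\<forall>l. h (pure_tensor A closure_algebra \<one>\<^bsub>A\<^esub> l) = l \<cdot>\<^sub>m 1\<^sub>m n)"

definition reduced_trace :: "('k::field, 'a) module \<Rightarrow> 'a \<Rightarrow> 'k"
  where "reduced_trace A a = (THE t. \<exists>n h. splitting A n h \<and>
    to_ac t = mat_trace (h (pure_tensor A closure_algebra a 1)))"


section \<open>Involutions\<close>

definition involution :: "('k::field, 'a) module \<Rightarrow> ('a \<Rightarrow> 'a) \<Rightarrow> bool"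
  where "involution A \<sigma> \<longleftrightarrow>
    (\<forall>x \<in> carrier A. \<sigma> x \<in> carrier A \<and> \<sigma> (\<sigma> x) = x) \<and>
    (\<forall>x \<in> carrier A. \<forall>y \<in> carrier A.
      \<sigma> (x \<oplus>\<^bsub>A\<^esub> y) = \<sigma> x \<oplus>\<^bsub>A\<^esub> \<sigma> y \<and> \<sigma> (x \<otimes>\<^bsub>A\<^esub> y) = \<sigma> y \<otimes>\<^bsub>A\<^esub> \<sigma> x)"

definition Sym :: "('k::field, 'a) module \<Rightarrow> ('a \<Rightarrow> 'a) \<Rightarrow> 'a set"
  where "Sym A \<sigma> = {a \<in> carrier A. \<sigma> a = a}"

text \<open>The restriction of \<open>\<sigma>\<close> to the centre, as a map on \<open>'k\<close>.\<close>

definition center_conj :: "('k::field, 'a) module \<Rightarrow> ('a \<Rightarrow> 'a) \<Rightarrow> 'k \<Rightarrow> 'k"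
  where "center_conj A \<sigma> c = (THE d. \<sigma> (c \<odot>\<^bsub>A\<^esub> \<one>\<^bsub>A\<^esub>) = d \<odot>\<^bsub>A\<^esub> \<one>\<^bsub>A\<^esub>)"

definition fixed_field :: "('k::field, 'a) module \<Rightarrow> ('a \<Rightarrow> 'a) \<Rightarrow> 'k set"
  where "fixed_field A \<sigma> = {c. \<sigma> (c \<odot>\<^bsub>A\<^esub> \<one>\<^bsub>A\<^esub>) = c \<odot>\<^bsub>A\<^esub> \<one>\<^bsub>A\<^esub>}"

text \<open>
  For an involution of the second kind, \<open>'k\<close> is a quadratic Galois extension of the fixed field
  whose non-trivial automorphism is \<^const>\<open>center_conj\<close>, so the field trace of \<open>t\<close> is
  \<open>t + center_conj A \<sigma> t\<close>.
\<close>

definition Trd :: "('k::field, 'a) module \<Rightarrow> ('a \<Rightarrow> 'a) \<Rightarrow> 'a \<Rightarrow> 'k"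
  where "Trd A \<sigma> a =
    (if fixed_field A \<sigma> = UNIV then reduced_trace A a
     else reduced_trace A a + center_conj A \<sigma> (reduced_trace A a))"


section \<open>Orderings and positivity\<close>

text \<open>
  \<open>F\<close> is a subfield of the type \<open>'k\<close>. An ordering of \<open>F\<close> is a relation \<open>P\<close>, where
  \<open>(x, y) \<in> P\<close> stands for \<open>x \<le>\<^sub>P y\<close>.
\<close>

definition formally_real :: "'k::field set \<Rightarrow> bool"
  where "formally_real F \<longleftrightarrow> \<not> (\<exists>xs. set xs \<subseteq> F \<and> (\<Sum>x\<leftarrow>xs. x\<^sup>2) = -1)"

definition field_ordering :: "'k::field set \<Rightarrow> 'k rel \<Rightarrow> bool"
  where "field_ordering F P \<longleftrightarrow>
    linear_order_on F P \<and>
    (\<forall>x \<in> F. \<forall>y \<in> F. \<forall>z \<in> F. (x, y) \<in> P \<longrightarrow> (x + z, y + z) \<in> P) \<and>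
    (\<forall>x \<in> F. \<forall>y \<in> F. (0, x) \<in> P \<and> (0, y) \<in> P \<longrightarrow> (0, x * y) \<in> P)"

definition sigma_ordering :: "('k::field, 'a) module \<Rightarrow> ('a \<Rightarrow> 'a) \<Rightarrow> 'k rel \<Rightarrow> bool"
  where "sigma_ordering A \<sigma> P \<longleftrightarrow>
    field_ordering (fixed_field A \<sigma>) P \<and>
    (\<forall>x \<in> carrier A. (0, Trd A \<sigma> (\<sigma> x \<otimes>\<^bsub>A\<^esub> x)) \<in> P)"

definition sigma_positive :: "('k::field, 'a) module \<Rightarrow> ('a \<Rightarrow> 'a) \<Rightarrow> 'k rel \<Rightarrow> 'a \<Rightarrow> bool"
  where "sigma_positive A \<sigma> P a \<longleftrightarrow>
    (\<forall>x \<in> carrier A. (0, Trd A \<sigma> (\<sigma> x \<otimes>\<^bsub>A\<^esub> a \<otimes>\<^bsub>A\<^esub> x)) \<in> P)"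

definition totally_sigma_positive :: "('k::field, 'a) module \<Rightarrow> ('a \<Rightarrow> 'a) \<Rightarrow> 'a \<Rightarrow> bool"
  where "totally_sigma_positive A \<sigma> a \<longleftrightarrow>
    a \<in> Sym A \<sigma> \<and> (\<forall>P. sigma_ordering A \<sigma> P \<longrightarrow> sigma_positive A \<sigma> P a)"

definition sum_of_hermitian_squares :: "('k::field, 'a) module \<Rightarrow> ('a \<Rightarrow> 'a) \<Rightarrow> 'a \<Rightarrow> bool"
  where "sum_of_hermitian_squares A \<sigma> a \<longleftrightarrow>
    (\<exists>(m::nat) x. (\<forall>i < m. x i \<in> carrier A) \<and>
      a = (\<Oplus>\<^bsub>A\<^esub>i \<in> {..<m}. \<sigma> (x i) \<otimes>\<^bsub>A\<^esub> x i))"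

definition PS_Conjecture :: "('k::field, 'a) module \<Rightarrow> ('a \<Rightarrow> 'a) \<Rightarrow> bool"
  where "PS_Conjecture A \<sigma> \<longleftrightarrow>
    (\<forall>a \<in> carrier A. totally_sigma_positive A \<sigma> a \<longrightarrow> sum_of_hermitian_squares A \<sigma> a)"

end

theory Submission
  imports Defs "Jordan_Normal_Form.Char_Poly"
begin

text \<open>
  Let \<open>tr\<close> be the trace of the left regular representation over \<open>K\<close>; it is a positive multiple of the
  reduced trace, since a central simple algebra becomes a matrix algebra over the algebraic closure. Put
  \<open>H x y = tr (\<sigma> x \<cdot> y)\<close>, a nondegenerate hermitian form, and let \<open>M\<close> be the preordering of those elements
  of \<open>F\<close> that are sums of hermitian squares in \<open>A\<close>.

  The PS Conjecture for \<open>(A, \<sigma>)\<close> is equivalent to \<open>H x x \<in> M\<close> for all \<open>x\<close>. If this condition holds and \<open>a\<close> is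
  totally \<open>\<sigma>\<close>-positive, then all values of the form \<open>(x, y) \<mapsto> H x (a y)\<close> lie in \<open>M\<close> by the Artin--Schreier
  theorem. Diagonalise it as \<open>H x (a y) = \<Sum>\<^sub>k H x g\<^sub>k \<cdot> H g\<^sub>k y / d\<^sub>k\<close>, where the \<open>d\<^sub>k\<close> are values of the form. The operator
  \<open>y \<mapsto> x a y\<close> is then a sum of operators of rank one, and its trace is \<open>tr (x a) = \<Sum>\<^sub>k tr (x g\<^sub>k \<sigma>(g\<^sub>k)) / d\<^sub>k\<close>.
  As \<open>x\<close> is arbitrary, \<open>a = \<Sum>\<^sub>k g\<^sub>k \<sigma>(g\<^sub>k) / d\<^sub>k\<close>, a sum of hermitian squares.

  On \<open>A \<otimes> B\<close> the form \<open>H\<close> is the tensor product of the two given ones. Diagonalising both shows that \<open>H x x\<close> is a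
  sum of terms \<open>c\<^sup>\<sigma> c / (d\<^sub>k d'\<^sub>l)\<close>, which are sums of hermitian squares if the \<open>d\<^sub>k\<close> and the \<open>d'\<^sub>l\<close> are.
\<close>

section \<open>Orderings and preorderings of a subfield\<close>

text \<open>A totally positive element of \<open>A \<otimes> B\<close> need not be built from
  positive elements of the factors, so the hypotheses cannot be applied to it directly. The
  criterion on \<open>H x x\<close> removes this obstacle: it mentions neither an element
  \<open>a\<close> nor an ordering, and it concerns a form that is multiplicative on pure tensors.
  One half of the equivalence comes from applying the conjecture to the scalar \<open>H x x\<close>,
  which is totally positive because orderings respect products. The regular trace takes the place of
  the reduced trace because it is computed in coordinates over \<open>K\<close>: it is visibly
  multiplicative on tensor products, and a change of basis shows how it behaves under the
  involution. Splittings enter only to compare the two traces. That comparison takes place in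
  characteristic 0, which formal reality of \<open>F\<close> supplies. The preordering may be
  improper: \<open>-1\<close> can be a sum of hermitian squares, and then there are no orderings of
  the required kind. The Artin-Schreier step is set up to include this case.\<close>

definition is_subfield :: "'k::field set \<Rightarrow> bool"
  where "is_subfield F \<longleftrightarrow> 1 \<in> F \<and> (\<forall>x\<in>F. \<forall>y\<in>F. x - y \<in> F \<and> x * y \<in> F) \<and> (\<forall>x\<in>F. inverse x \<in> F)"

lemma is_subfieldD:
  assumes "is_subfield F"
  shows "1 \<in> F" and "0 \<in> F"
    and "\<And>x y. x \<in> F \<Longrightarrow> y \<in> F \<Longrightarrow> x - y \<in> F"
    and "\<And>x y. x \<in> F \<Longrightarrow> y \<in> F \<Longrightarrow> x * y \<in> F"
    and "\<And>x. x \<in> F \<Longrightarrow> inverse x \<in> F"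
    and "\<And>x. x \<in> F \<Longrightarrow> - x \<in> F"
    and "\<And>x y. x \<in> F \<Longrightarrow> y \<in> F \<Longrightarrow> x + y \<in> F"
proof -
  show 1: "1 \<in> F" and d: "\<And>x y. x \<in> F \<Longrightarrow> y \<in> F \<Longrightarrow> x - y \<in> F"
    and "\<And>x y. x \<in> F \<Longrightarrow> y \<in> F \<Longrightarrow> x * y \<in> F" and "\<And>x. x \<in> F \<Longrightarrow> inverse x \<in> F"
    using assms by (auto simp: is_subfield_def)
  show 0: "0 \<in> F" using d[OF 1 1] by simp
  show m: "- x \<in> F" if "x \<in> F" for x using d[OF 0 that] by simp
  show "x + y \<in> F" if "x \<in> F" "y \<in> F" for x y using d[OF that(1) m[OF that(2)]] by simp
qed

text \<open>Properness, \<open>- 1 \<notin> M\<close>, is left out on purpose: the preordering used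
  later consists of the scalars that are sums of hermitian squares, and \<open>- 1\<close> may be
  one of them.\<close>

definition preordering :: "'k::field set \<Rightarrow> 'k set \<Rightarrow> bool"
  where "preordering F M \<longleftrightarrow> M \<subseteq> F \<and>
    (\<forall>x\<in>M. \<forall>y\<in>M. x + y \<in> M \<and> x * y \<in> M) \<and> (\<forall>x\<in>F. x\<^sup>2 \<in> M)"

lemma preorderingD:
  assumes "preordering F M"
  shows "\<And>x. x \<in> M \<Longrightarrow> x \<in> F"
    and "\<And>x y. x \<in> M \<Longrightarrow> y \<in> M \<Longrightarrow> x + y \<in> M"
    and "\<And>x y. x \<in> M \<Longrightarrow> y \<in> M \<Longrightarrow> x * y \<in> M"
    and "\<And>x. x \<in> F \<Longrightarrow> x\<^sup>2 \<in> M"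
  using assms by (auto simp: preordering_def)

text \<open>For nonzero \<open>x\<close>, \<open>inverse x = x * (inverse x)\<^sup>2\<close> is an
  element of \<open>M\<close> times a square; for \<open>x = 0\<close> the convention
  \<open>inverse 0 = 0\<close> applies.\<close>

lemma preordering_inverse:
  assumes "is_subfield F" "preordering F M" "x \<in> M"
  shows "inverse x \<in> M"
proof -
  have "x * (inverse x)\<^sup>2 \<in> M"
    using assms preorderingD[OF assms(2)] is_subfieldD(5)[OF assms(1)] by blast
  then show ?thesis by (cases "x = 0") (use assms(3) in \<open>auto simp: power2_eq_square mult.assoc[symmetric]\<close>)
qed

text \<open>The extension is \<open>M - c M\<close>. If it contained \<open>- 1 = x - c y\<close>,
  then \<open>c y = 1 + x\<close>; division by \<open>y\<close> would put \<open>c\<close> into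
  \<open>M\<close>, while \<open>y = 0\<close> would put \<open>- 1 = x\<close> into
  \<open>M\<close>.\<close>

lemma preordering_extend:
  assumes F: "is_subfield F" and M: "preordering F M" and "- 1 \<notin> M" and c: "c \<in> F" "c \<notin> M"
  shows "\<exists>M'. preordering F M' \<and> M \<subseteq> M' \<and> - c \<in> M' \<and> - 1 \<notin> M'"
proof -
  note f = is_subfieldD[OF F] and m = preorderingD[OF M]
  define M' where "M' = {x - c * y | x y. x \<in> M \<and> y \<in> M}"
  have m01: "0 \<in> M" "1 \<in> M" using m(4)[OF f(2)] m(4)[OF f(1)] by auto
  have "preordering F M'"
    unfolding preordering_def
  proof (intro conjI ballI)
    show "M' \<subseteq> F" using f m c by (auto simp: M'_def)
    show "x\<^sup>2 \<in> M'" if "x \<in> F" for x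
      unfolding M'_def using m(4)[OF that] m01 by (intro CollectI exI[of _ "x\<^sup>2"] exI[of _ 0]) auto
    fix x y assume "x \<in> M'" "y \<in> M'"
    then obtain p q r s where e: "x = p - c * q" "y = r - c * s" "p \<in> M" "q \<in> M" "r \<in> M" "s \<in> M"
      by (auto simp: M'_def)
    have "x + y = (p + r) - c * (q + s)" by (simp add: e algebra_simps)
    moreover have "p + r \<in> M" "q + s \<in> M" using e m by auto
    ultimately show "x + y \<in> M'" unfolding M'_def by blast
    have "x * y = (p * r + c\<^sup>2 * (q * s)) - c * (p * s + q * r)"
      by (simp add: e algebra_simps power2_eq_square)
    moreover have "p * r + c\<^sup>2 * (q * s) \<in> M" "p * s + q * r \<in> M"
      using e m(2,3) m(4)[OF c(1)] by auto
    ultimately show "x * y \<in> M'" unfolding M'_def by blast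
  qed
  moreover have "M \<subseteq> M'" using m01 by (force simp: M'_def)
  moreover have "- c \<in> M'" using m01 by (force simp: M'_def)
  moreover have "- 1 \<notin> M'"
  proof
    assume "- 1 \<in> M'"
    then obtain x y where e: "- 1 = x - c * y" "x \<in> M" "y \<in> M" by (auto simp: M'_def)
    then have cy: "c * y = 1 + x" by (simp add: eq_diff_eq algebra_simps)
    show False
    proof (cases "y = 0")
      case True
      then show False using e assms(3) by auto
    next
      case False
      then have "c = (1 + x) * inverse y" by (simp add: cy[symmetric])
      then show False using c(2) m(2,3) m01(2) e preordering_inverse[OF F M] by auto
    qed
  qed
  ultimately show ?thesis by blast
qed

text \<open>Any two elements of the union lie in a common member of the chain, so the closure
  properties pass to the union. \<open>Q\<close> stands for the further conditions on the family in
  Zorn's lemma.\<close>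

lemma preordering_Union_chain:
  assumes "subset.chain {M. preordering F M \<and> Q M} C" "C \<noteq> {}"
  shows "preordering F (\<Union>C)"
proof -
  have p: "\<And>M. M \<in> C \<Longrightarrow> preordering F M" using assms by (auto simp: subset.chain_def)
  have ch: "\<And>M N. M \<in> C \<Longrightarrow> N \<in> C \<Longrightarrow> M \<subseteq> N \<or> N \<subseteq> M" using assms by (auto simp: subset.chain_def)
  show ?thesis
    unfolding preordering_def
  proof (intro conjI ballI)
    show "\<Union>C \<subseteq> F" using preorderingD(1)[OF p] by blast
    show "x\<^sup>2 \<in> \<Union>C" if "x \<in> F" for x using p that assms(2) by (force simp: preordering_def)
    fix x y assume "x \<in> \<Union>C" "y \<in> \<Union>C"
    then obtain M N where "x \<in> M" "M \<in> C" "y \<in> N" "N \<in> C" by auto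
    then obtain N where "N \<in> C" "x \<in> N" "y \<in> N" using ch by blast
    then show "x + y \<in> \<Union>C" "x * y \<in> \<Union>C" using preorderingD[OF p] by blast+
  qed
qed

text \<open>If neither \<open>x\<close> nor \<open>- x\<close> were in a maximal \<open>T\<close>,
  adjoining \<open>- x\<close> by \<open>preordering_extend\<close> would give a larger preordering
  that still omits \<open>- 1\<close>.\<close>

lemma preordering_maximal:
  assumes F: "is_subfield F" and M: "preordering F M" and "- 1 \<notin> M"
  obtains T where "preordering F T" "M \<subseteq> T" "- 1 \<notin> T" "\<And>x. x \<in> F \<Longrightarrow> x \<in> T \<or> - x \<in> T"
proof -
  let ?A = "{T. preordering F T \<and> (M \<subseteq> T \<and> - 1 \<notin> T)}"
  have "\<exists>T\<in>?A. \<forall>Y\<in>?A. T \<subseteq> Y \<longrightarrow> Y = T"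
  proof (rule subset_Zorn_nonempty)
    show "?A \<noteq> {}" using assms by auto
    show "\<Union>C \<in> ?A" if "C \<noteq> {}" "subset.chain ?A C" for C
      using preordering_Union_chain[OF that(2,1)] that by (auto simp: subset.chain_def)
  qed
  then obtain T where "T \<in> ?A" and "\<forall>Y\<in>?A. T \<subseteq> Y \<longrightarrow> Y = T" by (elim bexE)
  then have T: "preordering F T" "M \<subseteq> T" "- 1 \<notin> T"
    and max: "\<And>Y. preordering F Y \<Longrightarrow> M \<subseteq> Y \<Longrightarrow> - 1 \<notin> Y \<Longrightarrow> T \<subseteq> Y \<Longrightarrow> Y = T"
    by simp_all
  have "x \<in> T \<or> - x \<in> T" if x: "x \<in> F" for x
  proof (rule ccontr)
    assume "\<not> (x \<in> T \<or> - x \<in> T)"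
    then have "x \<notin> T" "- x \<notin> T" by auto
    from preordering_extend[OF F T(1,3) x \<open>x \<notin> T\<close>] obtain Y
      where Y: "preordering F Y" "T \<subseteq> Y" "- x \<in> Y" "- 1 \<notin> Y" by blast
    have "Y = T" by (rule max[OF Y(1) _ Y(4,2)]) (use T Y in auto)
    then show False using Y \<open>- x \<notin> T\<close> by simp
  qed
  then show thesis by (rule that[OF T])
qed

text \<open>A maximal preordering that contains \<open>M\<close> and \<open>- c\<close> but not
  \<open>- 1\<close> is the positive cone of the ordering sought. It exists because
  \<open>- 1 \<in> M\<close> would force \<open>M = F\<close> when 2 is invertible, contrary to
  \<open>c \<notin> M\<close>.\<close>

theorem artin_schreier_preordering:
  fixes F :: "'k::field set"
  assumes F: "is_subfield F" and M: "preordering F M" and two: "(2::'k::field) \<noteq> 0"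
    and c: "c \<in> F" "c \<notin> M"
  obtains P where "field_ordering F P" "\<And>m. m \<in> M \<Longrightarrow> (0, m) \<in> P" "(0, c) \<notin> P"
proof -
  note f = is_subfieldD[OF F] and m = preorderingD[OF M]
  have "- 1 \<notin> M"
  proof
    assume "- 1 \<in> M"
    have half: "inverse 2 \<in> F" using f(5)[OF f(7)[OF f(1) f(1)]] by simp
    \<comment> \<open>Every \<open>c\<close> is the difference of the squares of
      \<open>(c + 1) / 2\<close> and \<open>(c - 1) / 2\<close>; with \<open>- 1 \<in> M\<close>
      such a difference lies in \<open>M\<close>.\<close>
    have "((c + 1) * inverse 2)\<^sup>2 + (- 1) * ((c - 1) * inverse 2)\<^sup>2 \<in> M"
      by (intro m(2) m(3) m(4) \<open>- 1 \<in> M\<close> f(4) f(7) f(3) half c(1) f(1))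
    also have "((c + 1) * inverse 2)\<^sup>2 + (- 1) * ((c - 1) * inverse 2)\<^sup>2
        = c * (2 * inverse 2) * (2 * inverse 2)"
    proof -
      have "((c + 1) * h)\<^sup>2 + (- 1) * ((c - 1) * h)\<^sup>2 = c * (2 * h) * (2 * h)" for h
        by (simp add: algebra_simps power2_eq_square)
      then show ?thesis .
    qed
    also have "\<dots> = c" using two by simp
    finally show False using c by simp
  qed
  from preordering_extend[OF F M this c] obtain M' where
    "preordering F M'" and M': "M \<subseteq> M'" "- c \<in> M'" "- 1 \<notin> M'" by auto
  then obtain T where T: "preordering F T" "M' \<subseteq> T" "- 1 \<notin> T"
    and tot: "\<And>x. x \<in> F \<Longrightarrow> x \<in> T \<or> - x \<in> T"
    using preordering_maximal[OF F] by blast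
  note t = preorderingD[OF T(1)]
  \<comment> \<open>Antisymmetry comes from \<open>- 1 \<notin> T\<close>: for nonzero
    \<open>x\<close>, \<open>- 1 = x * (- x) * (inverse x)\<^sup>2\<close>.\<close>
  have anti: "x = 0" if "x \<in> T" "- x \<in> T" for x
  proof (rule ccontr)
    assume "x \<noteq> 0"
    have "x * (- x) * (inverse x)\<^sup>2 \<in> T" by (intro t(3,4) f(5) that t(1)[OF that(1)])
    also have "x * (- x) * (inverse x)\<^sup>2 = - ((x * inverse x)\<^sup>2)"
      by (simp only: power2_eq_square mult_minus_left mult_minus_right mult.assoc mult.commute mult.left_commute)
    also have "\<dots> = - 1" using \<open>x \<noteq> 0\<close> by simp
    finally show False using T by simp
  qed
  define P where "P = {(x, y). x \<in> F \<and> y \<in> F \<and> y - x \<in> T}"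
  have "0 \<in> T" using t(4)[OF f(2)] by simp
  have "linear_order_on F P"
    unfolding linear_order_on_def partial_order_on_def preorder_on_def
  proof (intro conjI)
    show "P \<subseteq> F \<times> F" by (auto simp: P_def)
    show "refl_on F P" using \<open>0 \<in> T\<close> by (auto simp: refl_on_def P_def)
    show "trans P"
    proof (rule transI)
      fix x y z assume "(x, y) \<in> P" "(y, z) \<in> P"
      then show "(x, z) \<in> P" using t(2)[of "y - x" "z - y"] by (auto simp: P_def)
    qed
    show "antisym P"
    proof (rule antisymI)
      fix x y assume "(x, y) \<in> P" "(y, x) \<in> P"
      then show "x = y" using anti[of "y - x"] by (auto simp: P_def)
    qed
    show "total_on F P"
    proof (rule total_onI)
      fix x y assume "x \<in> F" "y \<in> F"
      then show "(x, y) \<in> P \<or> (y, x) \<in> P" using tot[OF f(3)[of y x]] by (auto simp: P_def)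
    qed
  qed
  then have "field_ordering F P"
    unfolding field_ordering_def
  proof (intro conjI ballI impI)
    fix x y z assume "x \<in> F" "y \<in> F" "z \<in> F" "(x, y) \<in> P"
    then show "(x + z, y + z) \<in> P" using f(7)[of x z] f(7)[of y z] by (simp add: P_def)
  next
    fix x y assume "x \<in> F" "y \<in> F" "(0, x) \<in> P \<and> (0, y) \<in> P"
    then show "(0, x * y) \<in> P" using t(3)[of x y] f(2,4) by (simp add: P_def)
  qed
  moreover have "(0, m) \<in> P" if "m \<in> M" for m
    using that m(1)[OF that] f(2) M'(1) T(2) by (auto simp: P_def)
  moreover have "(0, c) \<notin> P"
  proof
    assume "(0, c) \<in> P"
    \<comment> \<open>Both \<open>c\<close> and \<open>- c\<close> are then in \<open>T\<close>, so
      \<open>c\<close> is zero, a square, and hence in \<open>M\<close>.\<close>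
    then have "c = 0" using anti[of c] M' T by (auto simp: P_def)
    then show False using c m(4)[OF f(2)] by simp
  qed
  ultimately show thesis using that by blast
qed

section \<open>Rules of calculation for an ordering of a subfield\<close>

context
  fixes F :: "'k::field set" and P
  assumes F: "is_subfield F" and P: "field_ordering F P"
begin

lemma field_ordering_mem: "(x, y) \<in> P \<Longrightarrow> x \<in> F \<and> y \<in> F"
  using P by (auto simp: field_ordering_def linear_order_on_def partial_order_on_def
      preorder_on_def refl_on_def)

lemma field_ordering_trans: "(x, y) \<in> P \<Longrightarrow> (y, z) \<in> P \<Longrightarrow> (x, z) \<in> P"
  using P by (auto simp: field_ordering_def linear_order_on_def partial_order_on_def
      preorder_on_def dest: transD)

lemma field_ordering_antisym: "(x, y) \<in> P \<Longrightarrow> (y, x) \<in> P \<Longrightarrow> x = y"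
  using P by (auto simp: field_ordering_def linear_order_on_def partial_order_on_def
      preorder_on_def dest: antisymD)

lemma field_ordering_refl: "x \<in> F \<Longrightarrow> (x, x) \<in> P"
  using P by (auto simp: field_ordering_def linear_order_on_def partial_order_on_def
      preorder_on_def refl_on_def)

lemma field_ordering_total: "x \<in> F \<Longrightarrow> y \<in> F \<Longrightarrow> (x, y) \<in> P \<or> (y, x) \<in> P"
  using P field_ordering_refl[of x]
  by (cases "x = y") (auto simp: field_ordering_def linear_order_on_def total_on_def)

lemma field_ordering_add_nonneg:
  assumes "(0, x) \<in> P" "(0, y) \<in> P"
  shows "(0, x + y) \<in> P"
proof -
  have "(0 + y, x + y) \<in> P"
    using P assms(1) field_ordering_mem[OF assms(1)] field_ordering_mem[OF assms(2)]
    by (auto simp: field_ordering_def)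
  then show ?thesis using field_ordering_trans[OF assms(2)] by simp
qed

lemma field_ordering_add_right:
  assumes "(x, y) \<in> P" "z \<in> F" shows "(x + z, y + z) \<in> P"
  using P assms field_ordering_mem[OF assms(1)] by (auto simp: field_ordering_def)

lemma field_ordering_mult_nonneg: "(0, x) \<in> P \<Longrightarrow> (0, y) \<in> P \<Longrightarrow> (0, x * y) \<in> P"
  using P field_ordering_mem[of 0 x] field_ordering_mem[of 0 y] by (auto simp: field_ordering_def)

lemma field_ordering_neg:
  assumes "x \<in> F" shows "(0, x) \<in> P \<or> (0, - x) \<in> P"
proof (cases "(0, x) \<in> P")
  case False
  then have "(x, 0) \<in> P" using field_ordering_total[OF assms is_subfieldD(2)[OF F]] by blast
  then have "(x + - x, 0 + - x) \<in> P"
    by (rule field_ordering_add_right) (rule is_subfieldD(6)[OF F assms])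
  then show ?thesis by simp
qed simp

lemma field_ordering_neg_antisym:
  assumes "(0, x) \<in> P" "(0, - x) \<in> P" shows "x = 0"
proof -
  have "(0 + x, - x + x) \<in> P"
    by (rule field_ordering_add_right[OF assms(2)]) (use field_ordering_mem[OF assms(1)] in auto)
  then show ?thesis using assms(1) field_ordering_antisym by simp
qed

text \<open>If \<open>x\<close> were negative, so would be its positive multiples. This serves to
  compare traces: the regular trace, the reduced trace and \<open>Trd\<close> of a symmetric element
  differ only by positive integer factors.\<close>

lemma field_ordering_of_nat_mult_iff:
  assumes "(of_nat n :: 'k) \<noteq> 0" "x \<in> F"
  shows "(0, of_nat n * x) \<in> P \<longleftrightarrow> (0, x) \<in> P"
proof -
  have pos: "(0, of_nat n * y) \<in> P" if "(0, y) \<in> P" for n and y :: 'k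
  proof (induction n)
    case 0
    show ?case using field_ordering_refl is_subfieldD(2)[OF F] by simp
  next
    case (Suc n)
    then show ?case using field_ordering_add_nonneg[OF that Suc] by (simp add: distrib_right)
  qed
  show ?thesis
  proof
    assume a: "(0, of_nat n * x) \<in> P"
    show "(0, x) \<in> P"
    proof (rule ccontr)
      assume n: "(0, x) \<notin> P"
      then have "(0, - x) \<in> P" using field_ordering_neg assms by blast
      from pos[OF this, of n] have "(0, - (of_nat n * x)) \<in> P" by simp
      from field_ordering_neg_antisym[OF a this] have "x = 0" using assms by simp
      then show False using n a by simp
    qed
  qed (rule pos)
qed

end

section \<open>Algebras, coordinates and traces\<close>

text \<open>The inherited facts of \<^locale>\<open>assoc_algebra\<close> about the ring \<open>A\<close> are shadowed by those
  about the scalars, hence this variant.\<close>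

locale algebra_over = ring A for A :: "('k::field, 'a) module" (structure) +
  assumes smult_closed [simp, intro]: "x \<in> carrier A \<Longrightarrow> c \<odot> x \<in> carrier A"
    and smult_l_distr: "x \<in> carrier A \<Longrightarrow> (c + d) \<odot> x = c \<odot> x \<oplus> d \<odot> x"
    and smult_r_distr: "x \<in> carrier A \<Longrightarrow> y \<in> carrier A \<Longrightarrow> c \<odot> (x \<oplus> y) = c \<odot> x \<oplus> c \<odot> y"
    and smult_assoc: "x \<in> carrier A \<Longrightarrow> (c * d) \<odot> x = c \<odot> (d \<odot> x)"
    and smult_one [simp]: "x \<in> carrier A \<Longrightarrow> 1 \<odot> x = x"
    and smult_mult_l: "x \<in> carrier A \<Longrightarrow> y \<in> carrier A \<Longrightarrow> (c \<odot> x) \<otimes> y = c \<odot> (x \<otimes> y)"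
    and smult_mult_r: "x \<in> carrier A \<Longrightarrow> y \<in> carrier A \<Longrightarrow> x \<otimes> (c \<odot> y) = c \<odot> (x \<otimes> y)"

lemma assoc_algebra_iff: "assoc_algebra A \<longleftrightarrow> algebra_over A"
proof
  assume "assoc_algebra A"
  then interpret assoc_algebra A .
  have r: "ring A" by (rule assoc_algebra.axioms(1)) fact
  show "algebra_over A"
    by (intro algebra_over.intro r algebra_over_axioms.intro)
      (use smult_closed smult_l_distr smult_r_distr smult_assoc1 smult_one smult_mult_left smult_mult_right
        in \<open>auto simp: ring_of_type_algebra_def\<close>)
next
  assume "algebra_over A"
  then interpret algebra_over A .
  show "assoc_algebra A"
    by (intro assoc_algebra.intro assoc_algebra_axioms.intro moduleI)
      (auto simp: smult_l_distr smult_r_distr smult_assoc smult_mult_l smult_mult_r ring_of_type_algebra_def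
        intro: cring_from_type_algebra[unfolded ring_of_type_algebra_def] is_abelian_group ring_axioms)
qed

lemma (in abelian_group) add_self_zero: "x \<in> carrier G \<Longrightarrow> x \<oplus> x = x \<Longrightarrow> x = \<zero>"
  by (metis add.l_cancel_one)

text \<open>Membership of the sum in \<open>V\<close> is proved together with additivity, because
  the induction step needs the partial sum inside the set on which \<open>h\<close> is additive. For
  infinite \<open>J\<close> both sums are zero by convention.\<close>

lemma additive_finsum:
  assumes "abelian_monoid R" "abelian_monoid S"
    and "\<And>x. x \<in> V \<Longrightarrow> x \<in> carrier R" "\<zero>\<^bsub>R\<^esub> \<in> V" "\<And>x y. x \<in> V \<Longrightarrow> y \<in> V \<Longrightarrow> x \<oplus>\<^bsub>R\<^esub> y \<in> V"
    and "\<And>x. x \<in> V \<Longrightarrow> h x \<in> carrier S" "h \<zero>\<^bsub>R\<^esub> = \<zero>\<^bsub>S\<^esub>"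
    and "\<And>x y. x \<in> V \<Longrightarrow> y \<in> V \<Longrightarrow> h (x \<oplus>\<^bsub>R\<^esub> y) = h x \<oplus>\<^bsub>S\<^esub> h y"
    and "\<And>j. j \<in> J \<Longrightarrow> f j \<in> V"
  shows "(\<Oplus>\<^bsub>R\<^esub>j\<in>J. f j) \<in> V \<and> h (\<Oplus>\<^bsub>R\<^esub>j\<in>J. f j) = (\<Oplus>\<^bsub>S\<^esub>j\<in>J. h (f j))"
proof -
  interpret R: abelian_monoid R by fact
  interpret S: abelian_monoid S by fact
  show ?thesis
    using assms(9)
  proof (induction J rule: infinite_finite_induct)
    case (infinite J)
    then show ?case by (simp add: R.finsum_infinite S.finsum_infinite assms)
  next
    case empty
    then show ?case by (simp add: assms)
  next
    case (insert j J)
    then have "f \<in> J \<rightarrow> carrier R" "f j \<in> carrier R" "(\<lambda>j. h (f j)) \<in> J \<rightarrow> carrier S" "h (f j) \<in> carrier S"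
      using assms by auto
    with insert show ?case by (simp add: assms)
  qed
qed

context algebra_over
begin

lemma smult_zero_l [simp]: "x \<in> carrier A \<Longrightarrow> 0 \<odot> x = \<zero>"
  using smult_l_distr[of x 0 0] by (intro add_self_zero) auto

lemma smult_zero_r [simp]: "c \<odot> \<zero> = \<zero>"
  using smult_r_distr[of \<zero> \<zero> c] by (intro add_self_zero) auto

lemma smult_minus_l: "x \<in> carrier A \<Longrightarrow> (- c) \<odot> x = \<ominus> (c \<odot> x)"
  using smult_l_distr[of x "- c" c] by (intro minus_equality[symmetric]) auto

lemma smult_inverse_cancel [simp]: "x \<in> carrier A \<Longrightarrow> c \<noteq> 0 \<Longrightarrow> inverse c \<odot> (c \<odot> x) = x"
  by (simp flip: smult_assoc)

lemma smult_eq_zero: "x \<in> carrier A \<Longrightarrow> c \<noteq> 0 \<Longrightarrow> c \<odot> x = \<zero> \<Longrightarrow> x = \<zero>"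
  using smult_inverse_cancel by fastforce

lemma smult_one_inj: "\<one> \<noteq> \<zero> \<Longrightarrow> c \<odot> \<one> = d \<odot> \<one> \<Longrightarrow> c = d"
proof (rule ccontr)
  assume a: "\<one> \<noteq> \<zero>" "c \<odot> \<one> = d \<odot> \<one>" "c \<noteq> d"
  have "(c + - d) \<odot> \<one> = \<zero>" using a by (simp add: smult_l_distr smult_minus_l r_neg del: add_uminus_conv_diff)
  with a smult_eq_zero[of \<one> "c - d"] show False by simp
qed

lemma smult_finsum:
  assumes "f \<in> J \<rightarrow> carrier A"
  shows "c \<odot> (\<Oplus>j\<in>J. f j) = (\<Oplus>j\<in>J. c \<odot> f j)"
  using additive_finsum[of A A "carrier A" "\<lambda>x. c \<odot> x" J f] assms
  by (auto simp: smult_r_distr abelian_monoid_axioms)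

end

text \<open>The coordinates are part of the data, so that traces become plain finite sums.
  \<open>V\<close> is a subspace rather than the whole algebra because matrices of endomorphisms of
  a minimal left ideal are needed as well.\<close>

locale based_space = algebra_over A for A :: "('k::field, 'a) module" (structure) +
  fixes V :: "'a set" and I :: "'i set" and b :: "'i \<Rightarrow> 'a" and coord :: "'i \<Rightarrow> 'a \<Rightarrow> 'k"
  assumes finite_I [simp]: "finite I"
    and V_carrier: "x \<in> V \<Longrightarrow> x \<in> carrier A"
    and V_zero [simp]: "\<zero> \<in> V"
    and V_add [simp]: "x \<in> V \<Longrightarrow> y \<in> V \<Longrightarrow> x \<oplus> y \<in> V"
    and V_smult [simp]: "x \<in> V \<Longrightarrow> c \<odot> x \<in> V"
    and b_in [simp]: "i \<in> I \<Longrightarrow> b i \<in> V"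
    and coord_add: "i \<in> I \<Longrightarrow> x \<in> V \<Longrightarrow> y \<in> V \<Longrightarrow> coord i (x \<oplus> y) = coord i x + coord i y"
    and coord_smult: "i \<in> I \<Longrightarrow> x \<in> V \<Longrightarrow> coord i (c \<odot> x) = c * coord i x"
    and coord_b: "i \<in> I \<Longrightarrow> j \<in> I \<Longrightarrow> coord i (b j) = (if i = j then 1 else 0)"
    and expand: "x \<in> V \<Longrightarrow> (\<Oplus>i\<in>I. coord i x \<odot> b i) = x"

definition linear_functional :: "('k::field, 'a) module \<Rightarrow> 'a set \<Rightarrow> ('a \<Rightarrow> 'k) \<Rightarrow> bool"
  where "linear_functional A V f \<longleftrightarrow>
    (\<forall>x\<in>V. \<forall>y\<in>V. f (x \<oplus>\<^bsub>A\<^esub> y) = f x + f y) \<and> (\<forall>c. \<forall>x\<in>V. f (c \<odot>\<^bsub>A\<^esub> x) = c * f x)"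

definition linear_endo :: "('k::field, 'a) module \<Rightarrow> 'a set \<Rightarrow> ('a \<Rightarrow> 'a) \<Rightarrow> bool"
  where "linear_endo A V f \<longleftrightarrow> f \<in> V \<rightarrow> V \<and>
    (\<forall>x\<in>V. \<forall>y\<in>V. f (x \<oplus>\<^bsub>A\<^esub> y) = f x \<oplus>\<^bsub>A\<^esub> f y) \<and> (\<forall>c. \<forall>x\<in>V. f (c \<odot>\<^bsub>A\<^esub> x) = c \<odot>\<^bsub>A\<^esub> f x)"

section \<open>Linear functionals and traces in coordinates\<close>

context based_space
begin

lemma b_carrier [simp]: "i \<in> I \<Longrightarrow> b i \<in> carrier A"
  using V_carrier b_in by blast

lemma V_finsum:
  assumes "\<And>j. j \<in> J \<Longrightarrow> f j \<in> V" shows "(\<Oplus>j\<in>J. f j) \<in> V"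
  using additive_finsum[of A A V "\<lambda>x. x" J f] assms V_carrier by (auto simp: abelian_monoid_axioms)

lemma functional_finsum:
  assumes f: "linear_functional A V f" and "\<And>j. j \<in> J \<Longrightarrow> g j \<in> V"
  shows "f (\<Oplus>j\<in>J. g j) = (\<Sum>j\<in>J. f (g j))"
  using assms(2)
proof (induction J rule: infinite_finite_induct)
  case (insert j J)
  then have "g \<in> J \<rightarrow> carrier A" "g j \<in> carrier A" using V_carrier by auto
  with insert show ?case using f V_finsum[of J g] by (auto simp: linear_functional_def)
next
  have "f (0 \<odot> \<zero>) = 0 * f \<zero>" using f V_zero unfolding linear_functional_def by blast
  then have "f \<zero> = 0" by simp
  then show "f (\<Oplus>j\<in>{}. g j) = (\<Sum>j\<in>{}. f (g j))"
    and "\<And>J. infinite J \<Longrightarrow> f (\<Oplus>j\<in>J. g j) = (\<Sum>j\<in>J. f (g j))" by (simp_all add: finsum_infinite)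
qed

lemma linear_functional_coord: "i \<in> I \<Longrightarrow> linear_functional A V (coord i)"
  by (simp add: linear_functional_def coord_add coord_smult)

lemmas coord_finsum = functional_finsum[OF linear_functional_coord]

lemma functional_expand:
  assumes f: "linear_functional A V f" and x: "x \<in> V"
  shows "f x = (\<Sum>i\<in>I. coord i x * f (b i))"
proof -
  have "f x = f (\<Oplus>i\<in>I. coord i x \<odot> b i)" using x by (simp add: expand)
  also have "\<dots> = (\<Sum>i\<in>I. f (coord i x \<odot> b i))" by (rule functional_finsum[OF f]) simp
  also have "\<dots> = (\<Sum>i\<in>I. coord i x * f (b i))" using f by (intro sum.cong) (auto simp: linear_functional_def)
  finally show ?thesis .
qed

lemma coord_eqI:
  assumes "x \<in> V" "y \<in> V" "\<And>i. i \<in> I \<Longrightarrow> coord i x = coord i y"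
  shows "x = y"
proof -
  have "(\<Oplus>i\<in>I. coord i x \<odot> b i) = (\<Oplus>i\<in>I. coord i y \<odot> b i)"
    using assms(3) by (intro finsum_cong') auto
  then show ?thesis using assms expand by simp
qed

lemma coord_zero: "i \<in> I \<Longrightarrow> coord i \<zero> = 0"
  using coord_smult[of i \<zero> 0] by simp

definition trace :: "('a \<Rightarrow> 'a) \<Rightarrow> 'k"
  where "trace f = (\<Sum>i\<in>I. coord i (f (b i)))"

lemma functional_comp_endo:
  "linear_endo A V f \<Longrightarrow> linear_functional A V g \<Longrightarrow> linear_functional A V (\<lambda>x. g (f x))"
  unfolding linear_endo_def linear_functional_def by (auto simp: Pi_iff)

text \<open>Expand each \<open>b i\<close> in the second basis, swap the sums, and collect the
  coordinates of \<open>f (b' j)\<close> in the first basis. The index types differ so that a basis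
  of an algebra can be compared with the matrix units.\<close>

lemma trace_basis_independent:
  fixes J :: "'j set"
  assumes B: "based_space A V J b' coord'" and f: "linear_endo A V f"
  shows "based_space.trace J b' coord' f = trace f"
proof -
  interpret B: based_space A V J b' coord' by fact
  have fV: "f x \<in> V" if "x \<in> V" for x using f that by (auto simp: linear_endo_def)
  have "trace f = (\<Sum>i\<in>I. \<Sum>j\<in>J. coord' j (b i) * coord i (f (b' j)))"
    unfolding trace_def
    by (intro sum.cong refl B.functional_expand functional_comp_endo[OF f] linear_functional_coord) auto
  also have "\<dots> = (\<Sum>j\<in>J. \<Sum>i\<in>I. coord i (f (b' j)) * coord' j (b i))"
    by (subst sum.swap) (simp add: mult.commute)
  also have "\<dots> = (\<Sum>j\<in>J. coord' j (f (b' j)))"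
    by (intro sum.cong refl functional_expand[symmetric] B.linear_functional_coord) (auto simp: fV)
  finally show ?thesis by (simp add: B.trace_def)
qed

lemma trace_id: "trace (\<lambda>x. x) = of_nat (card I)"
  by (simp add: trace_def coord_b)

lemma trace_comp_commute:
  assumes f: "linear_endo A V f" and g: "linear_endo A V g"
  shows "trace (\<lambda>x. f (g x)) = trace (\<lambda>x. g (f x))"
proof -
  have V: "f x \<in> V" "g x \<in> V" if "x \<in> V" for x using f g that by (auto simp: linear_endo_def)
  have "trace (\<lambda>x. f (g x)) = (\<Sum>i\<in>I. \<Sum>j\<in>I. coord j (g (b i)) * coord i (f (b j)))"
    unfolding trace_def
    by (intro sum.cong refl functional_expand functional_comp_endo[OF f] linear_functional_coord) (auto simp: V)
  also have "\<dots> = (\<Sum>j\<in>I. \<Sum>i\<in>I. coord i (f (b j)) * coord j (g (b i)))"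
    by (subst sum.swap) (simp add: mult.commute)
  also have "\<dots> = trace (\<lambda>x. g (f x))"
    unfolding trace_def
    by (intro sum.cong refl functional_expand[symmetric] functional_comp_endo[OF g] linear_functional_coord)
      (auto simp: V)
  finally show ?thesis .
qed

end

text \<open>The field isomorphism \<open>s\<close> is there for involutions, which are only
  semilinear over the centre; transport along a splitting takes \<open>s\<close> to be the
  identity.\<close>

lemma based_space_transport:
  assumes "based_space A V I b coord" and B: "algebra_over B"
    and W: "\<And>x. x \<in> W \<Longrightarrow> x \<in> carrier B" "\<zero>\<^bsub>B\<^esub> \<in> W" "\<And>x y. x \<in> W \<Longrightarrow> y \<in> W \<Longrightarrow> x \<oplus>\<^bsub>B\<^esub> y \<in> W"
      "\<And>c x. x \<in> W \<Longrightarrow> c \<odot>\<^bsub>B\<^esub> x \<in> W"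
    and h: "\<And>x. x \<in> V \<Longrightarrow> h x \<in> W" "\<And>x. x \<in> V \<Longrightarrow> g (h x) = x"
    and g: "\<And>x. x \<in> W \<Longrightarrow> g x \<in> V" "\<And>x. x \<in> W \<Longrightarrow> h (g x) = x"
    and h_add: "\<And>x y. x \<in> V \<Longrightarrow> y \<in> V \<Longrightarrow> h (x \<oplus>\<^bsub>A\<^esub> y) = h x \<oplus>\<^bsub>B\<^esub> h y"
    and h_smult: "\<And>c x. x \<in> V \<Longrightarrow> h (c \<odot>\<^bsub>A\<^esub> x) = s c \<odot>\<^bsub>B\<^esub> h x"
    and s: "\<And>c. s (s' c) = c" "\<And>c. s' (s c) = c" "\<And>c d. s (c + d) = s c + s d" "\<And>c d. s (c * d) = s c * s d"
  shows "based_space B W I (\<lambda>i. h (b i)) (\<lambda>i x. s (coord i (g x)))"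
proof -
  interpret A: based_space A V I b coord by fact
  interpret B: algebra_over B by fact
  have g_add: "g (x \<oplus>\<^bsub>B\<^esub> y) = g x \<oplus>\<^bsub>A\<^esub> g y" if "x \<in> W" "y \<in> W" for x y
    by (metis A.V_add that g h h_add)
  have g_smult: "g (c \<odot>\<^bsub>B\<^esub> x) = s' c \<odot>\<^bsub>A\<^esub> g x" if "x \<in> W" for c x
    by (metis A.V_smult that g h h_smult s)
  have s0: "s 0 = 0" using s(3)[of 0 0] by (metis add_0 add_right_cancel)
  have s1: "s 1 = 1" using s(4)[of 1 "s' 1"] s(1)[of 1] by simp
  have h0: "h \<zero>\<^bsub>A\<^esub> = \<zero>\<^bsub>B\<^esub>"
    using h_add[of "\<zero>\<^bsub>A\<^esub>" "\<zero>\<^bsub>A\<^esub>"] h(1) W(1) by (intro B.add_self_zero) auto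
  show ?thesis
  proof unfold_locales
    show "(\<Oplus>\<^bsub>B\<^esub>i\<in>I. s (coord i (g x)) \<odot>\<^bsub>B\<^esub> h (b i)) = x" if x: "x \<in> W" for x
    proof -
      have "h (\<Oplus>\<^bsub>A\<^esub>i\<in>I. coord i (g x) \<odot>\<^bsub>A\<^esub> b i) = (\<Oplus>\<^bsub>B\<^esub>i\<in>I. h (coord i (g x) \<odot>\<^bsub>A\<^esub> b i))"
        using additive_finsum[of A B V h I "\<lambda>i. coord i (g x) \<odot>\<^bsub>A\<^esub> b i"] h0 h_add h(1) W(1) A.V_carrier
        by (simp add: A.abelian_monoid_axioms B.abelian_monoid_axioms)
      also have "\<dots> = (\<Oplus>\<^bsub>B\<^esub>i\<in>I. s (coord i (g x)) \<odot>\<^bsub>B\<^esub> h (b i))"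
        using h(1) W(1) by (intro B.finsum_cong') (auto simp: h_smult)
      finally show ?thesis using x by (simp add: A.expand g)
    qed
  qed (use assms(3-6) in \<open>auto simp: g_add g_smult A.coord_add A.coord_smult A.coord_b s0 s1 s h g\<close>)
qed

section \<open>Bases and dimension over the subfield of scalars\<close>

context algebra_over
begin

lemma scalars_subfield:
  assumes "\<one> \<noteq> \<zero>"
  shows "subfield (scalars A) A"
proof (rule subfieldI)
  have e: "(c \<odot> \<one>) \<otimes> (d \<odot> \<one>) = (c * d) \<odot> \<one>" for c d by (simp add: smult_mult_l smult_assoc)
  have sr: "subring (scalars A) A"
  proof (rule subringI)
    show "scalars A \<subseteq> carrier A" by (auto simp: scalars_def)
    show "\<one> \<in> scalars A" unfolding scalars_def using smult_one[of \<one>] by (metis one_closed rangeI)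
    show "\<ominus> h \<in> scalars A" if "h \<in> scalars A" for h
      using that by (auto simp: scalars_def simp flip: smult_minus_l)
    show "h1 \<otimes> h2 \<in> scalars A" if "h1 \<in> scalars A" "h2 \<in> scalars A" for h1 h2
      using that by (auto simp: scalars_def e)
    show "h1 \<oplus> h2 \<in> scalars A" if "h1 \<in> scalars A" "h2 \<in> scalars A" for h1 h2
      using that by (auto simp: scalars_def simp flip: smult_l_distr)
  qed
  show "subcring (scalars A) A"
    by (rule subcringI[OF sr]) (auto simp: scalars_def e mult.commute)
  show "Units (A\<lparr>carrier := scalars A\<rparr>) = scalars A - {\<zero>}"
  proof (intro equalityI subsetI)
    fix k assume "k \<in> Units (A\<lparr>carrier := scalars A\<rparr>)"
    then show "k \<in> scalars A - {\<zero>}" using assms by (auto simp: Units_def scalars_def)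
  next
    fix k assume "k \<in> scalars A - {\<zero>}"
    then obtain c where k: "k = c \<odot> \<one>" "k \<noteq> \<zero>" by (auto simp: scalars_def)
    have "c \<noteq> 0" using k by (intro notI) simp
    with k have c: "k = c \<odot> \<one>" "c \<noteq> 0" by auto
    show "k \<in> Units (A\<lparr>carrier := scalars A\<rparr>)"
      unfolding Units_def using c by (auto simp: scalars_def e intro!: exI[of _ "inverse c"])
  qed
qed

text \<open>Dimension is built up by line extensions, and the induction follows them. As the new
  vector \<open>v\<close> lies outside \<open>E\<close>, the decomposition
  \<open>c \<odot> v \<oplus> u\<close> is unique; it yields the coordinate \<open>k\<close> of
  \<open>v\<close>, and the old coordinates are composed with the projection \<open>r\<close> to
  \<open>E\<close>.\<close>

lemma based_space_of_dimension:
  assumes one: "\<one> \<noteq> \<zero>" and "dimension n (scalars A) E"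
  shows "\<exists>b coord. based_space A E {..<n} b coord"
  using assms(2)
proof (induction n "scalars A" E rule: dimension.induct)
  case zero_dim
  have "based_space A {\<zero>} {..<0::nat} (\<lambda>_. \<zero>) (\<lambda>_ _. 0)"
    by unfold_locales auto
  then show ?case by blast
next
  case (Suc_dim v E n)
  then obtain b coord where "based_space A E {..<n} b coord" by blast
  then interpret E: based_space A E "{..<n}" b coord .
  let ?W = "line_extension (scalars A) v E"
  have W: "x \<in> ?W \<longleftrightarrow> (\<exists>c. \<exists>u\<in>E. x = c \<odot> v \<oplus> u)" for x
    using Suc_dim(1) by (auto simp: line_extension_mem_iff scalars_def smult_mult_l)
  have uniq: "c = c' \<and> u = u'"
    if e: "c \<odot> v \<oplus> u = c' \<odot> v \<oplus> u'" and u: "u \<in> E" "u' \<in> E" for c c' u u'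
  proof -
    have uc: "u \<in> carrier A" "u' \<in> carrier A" using u E.V_carrier by auto
    have m: "\<ominus> u \<in> E" using E.V_smult[OF u(1), of "- 1"] uc by (simp add: smult_minus_l)
    have "(c - c') \<odot> v = c \<odot> v \<oplus> \<ominus> (c' \<odot> v)"
      using smult_l_distr[of v c "- c'"] Suc_dim(1) by (simp add: smult_minus_l)
    also have "\<dots> = (c \<odot> v \<oplus> u) \<oplus> \<ominus> u \<oplus> \<ominus> (c' \<odot> v)"
      using uc Suc_dim(1) by (simp add: a_assoc r_neg)
    also have "\<dots> = u' \<oplus> \<ominus> u"
      unfolding e using uc Suc_dim(1) by (simp add: a_ac r_neg2 r_neg)
    finally have d: "(c - c') \<odot> v = u' \<oplus> \<ominus> u" .
    have "c = c'"
    proof (rule ccontr)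
      assume "c \<noteq> c'"
      then have "v = inverse (c - c') \<odot> (u' \<oplus> \<ominus> u)" using Suc_dim(1) by (simp flip: d)
      then have "v \<in> E" using m u by simp
      then show False using Suc_dim(2) by simp
    qed
    moreover have "u = u'" using d calculation uc Suc_dim(1) by simp (metis a_inv_closed minus_equality minus_minus)
    ultimately show ?thesis by simp
  qed
  define k where "k x = (THE c. \<exists>u\<in>E. x = c \<odot> v \<oplus> u)" for x
  define r where "r x = (THE u. u \<in> E \<and> (\<exists>c. x = c \<odot> v \<oplus> u))" for x
  have k: "k (c \<odot> v \<oplus> u) = c" and r: "r (c \<odot> v \<oplus> u) = u" if "u \<in> E" for c u
    unfolding k_def r_def using that uniq by (blast intro: the_equality)+
  \<comment> \<open>The old basis has the indices below \<open>n\<close>, so \<open>v\<close>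
    receives the index \<open>n\<close>.\<close>
  let ?b = "\<lambda>i. if i < n then b i else v"
  let ?c = "\<lambda>i x. if i < n then coord i (r x) else k x"
  have vW: "v = 1 \<odot> v \<oplus> \<zero>" using Suc_dim(1) by simp
  have EW: "u = 0 \<odot> v \<oplus> u" if "u \<in> E" for u using Suc_dim(1) E.V_carrier[OF that] by simp
  have add: "(c \<odot> v \<oplus> u) \<oplus> (c' \<odot> v \<oplus> u') = (c + c') \<odot> v \<oplus> (u \<oplus> u')"
    and sm: "d \<odot> (c \<odot> v \<oplus> u) = (d * c) \<odot> v \<oplus> d \<odot> u"
    if "u \<in> E" "u' \<in> E" for c c' d u u'
    using Suc_dim(1) E.V_carrier that by (simp_all add: smult_l_distr smult_r_distr smult_assoc a_ac)
  have "based_space A ?W {..<Suc n} ?b ?c"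
  proof unfold_locales
    show "finite {..<Suc n}" by simp
    show "x \<in> carrier A" if "x \<in> ?W" for x using that Suc_dim(1) E.V_carrier by (auto simp: W)
    show "\<zero> \<in> ?W" unfolding W using EW E.V_zero by blast
    show "x \<oplus> y \<in> ?W" if "x \<in> ?W" "y \<in> ?W" for x y
      using that add E.V_add unfolding W by metis
    show "c \<odot> x \<in> ?W" if "x \<in> ?W" for c x
      using that sm E.V_smult unfolding W by metis
    show "?b i \<in> ?W" if "i \<in> {..<Suc n}" for i
    proof (cases "i < n")
      case True
      then have "b i \<in> E" by simp
      with EW[OF this] have "b i \<in> ?W" unfolding W by blast
      with True show ?thesis by simp
    next
      case False
      have "v \<in> ?W" unfolding W using vW E.V_zero by blast
      with False show ?thesis by simp
    qed
    show "?c i (x \<oplus> y) = ?c i x + ?c i y" if "i \<in> {..<Suc n}" "x \<in> ?W" "y \<in> ?W" for i x y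
      using that by (auto simp: W add k r E.coord_add)
    show "?c i (c \<odot> x) = c * ?c i x" if "i \<in> {..<Suc n}" "x \<in> ?W" for i c x
      using that by (auto simp: W sm k r E.coord_smult)
    show "?c i (?b j) = (if i = j then 1 else 0)" if "i \<in> {..<Suc n}" "j \<in> {..<Suc n}" for i j
    proof -
      have "k v = 1" "r v = \<zero>" using k[of \<zero> 1] r[of \<zero> 1] vW by auto
      moreover have "k (b j) = 0" "r (b j) = b j" if "j < n"
        using k[of "b j" 0] r[of "b j" 0] EW[of "b j"] that by auto
      ultimately show ?thesis using that by (auto simp: E.coord_b E.coord_zero)
    qed
    show "(\<Oplus>i\<in>{..<Suc n}. ?c i x \<odot> ?b i) = x" if xW: "x \<in> ?W" for x
    proof -
      obtain c u where x: "x = c \<odot> v \<oplus> u" "u \<in> E" using xW unfolding W by blast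
      have "(\<Oplus>i\<in>{..<n}. ?c i x \<odot> ?b i) = (\<Oplus>i\<in>{..<n}. coord i u \<odot> b i)"
        using x by (intro finsum_cong') (auto simp: r)
      also have "\<dots> = u" using x by (simp add: E.expand)
      finally show ?thesis
        using x Suc_dim(1) by (subst lessThan_Suc, subst finsum_insert) (auto simp: k r)
    qed
  qed
  then show ?case by blast
qed

text \<open>The passage back from coordinates to dimension: subspaces of a finite-dimensional space
  are known to be finite-dimensional in the latter sense, and this provides bases of left
  ideals.\<close>

lemma (in based_space) finite_dimension:
  assumes "\<one> \<noteq> \<zero>" "V = carrier A"
  shows "finite_dimension (scalars A) V"
proof -
  note K = scalars_subfield[OF assms(1)]
  obtain Us where Us: "set Us = b ` I" using finite_list[of "b ` I"] by auto
  have sub: "set Us \<subseteq> carrier A" using Us by auto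
  have "V \<subseteq> Span (scalars A) Us"
  proof
    fix x assume "x \<in> V"
    have "(\<Oplus>i\<in>J. coord i x \<odot> b i) \<in> Span (scalars A) Us" if "J \<subseteq> I" for J
      using finite_subset[OF that finite_I] that
    proof (induction J)
      case empty
      then show ?case using Span_subgroup_props(2)[OF K sub] by simp
    next
      case (insert j J)
      then have "b j \<in> Span (scalars A) Us" using Span_base_incl[OF K sub] Us by auto
      then have "(coord j x \<odot> \<one>) \<otimes> b j \<in> Span (scalars A) Us"
        using Span_smult_closed[OF K sub] by (auto simp: scalars_def)
      then have "coord j x \<odot> b j \<in> Span (scalars A) Us" using insert by (simp add: smult_mult_l)
      moreover have "(\<lambda>i. coord i x \<odot> b i) \<in> J \<rightarrow> carrier A" using insert by auto
      ultimately show ?case using insert Span_subgroup_props(3)[OF K sub] by simp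
    qed
    from this[of I] show "x \<in> Span (scalars A) Us" using \<open>x \<in> V\<close> by (simp add: expand)
  qed
  then have "Span (scalars A) Us = V"
    using Span_subgroup_props(1)[OF K sub] assms by auto
  then show ?thesis using Span_finite_dimension[OF K sub] by simp
qed

end

section \<open>Tensor products\<close>

lemma lookup_scale [simp]: "Poly_Mapping.lookup (scale c f) u = c * Poly_Mapping.lookup f u"
  by (simp add: scale_def map.rep_eq when_def)

text \<open>\<open>tensor_kernel\<close> is a span with respect to \<open>scale\<close>; the
  interpretation makes the theory of spans applicable to it.\<close>

global_interpretation poly_mapping_space: vector_space "scale :: 'k::field \<Rightarrow> ('c \<Rightarrow>\<^sub>0 'k) \<Rightarrow> ('c \<Rightarrow>\<^sub>0 'k)"
  by unfold_locales (auto intro!: poly_mapping_eqI simp: lookup_add algebra_simps)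

lemma scale_single [simp]: "scale c (Poly_Mapping.single u d) = Poly_Mapping.single u (c * d)"
  by (rule poly_mapping_eqI) (simp add: lookup_single when_def)

lemma keys_scale: "Poly_Mapping.keys (scale c f) \<subseteq> Poly_Mapping.keys f"
  by (auto simp: in_keys_iff)

lemma poly_mapping_span_induct [consumes 1, case_names zero single add]:
  fixes f :: "'c \<Rightarrow>\<^sub>0 'b::comm_monoid_add"
  assumes "Poly_Mapping.keys f \<subseteq> S" and zero: "P 0"
    and single: "\<And>u c. u \<in> S \<Longrightarrow> P (Poly_Mapping.single u c)"
    and add: "\<And>f g. Poly_Mapping.keys f \<subseteq> S \<Longrightarrow> Poly_Mapping.keys g \<subseteq> S \<Longrightarrow> P f \<Longrightarrow> P g \<Longrightarrow> P (f + g)"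
  shows "P f"
proof -
  have "Poly_Mapping.keys (\<Sum>u\<in>U. Poly_Mapping.single u (Poly_Mapping.lookup f u)) \<subseteq> S \<and>
      P (\<Sum>u\<in>U. Poly_Mapping.single u (Poly_Mapping.lookup f u))"
    if "U \<subseteq> S" "finite U" for U
    using that(2,1)
  proof (induction U)
    case (insert u U)
    let ?s = "Poly_Mapping.single u (Poly_Mapping.lookup f u)"
    let ?f = "\<Sum>u\<in>U. Poly_Mapping.single u (Poly_Mapping.lookup f u)"
    have 1: "Poly_Mapping.keys ?s \<subseteq> S" using insert by simp
    have 2: "Poly_Mapping.keys ?f \<subseteq> S" "P ?f" using insert by auto
    have "P (?s + ?f)" using 1 2 single insert by (intro add) auto
    moreover have "Poly_Mapping.keys (?s + ?f) \<subseteq> S" using keys_add[of ?s ?f] 1 2 by blast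
    ultimately show ?case using insert by simp
  qed (simp add: zero)
  moreover have "(\<Sum>u\<in>Poly_Mapping.keys f. Poly_Mapping.single u (Poly_Mapping.lookup f u)) = f"
    by (rule poly_mapping_eqI)
      (auto simp: lookup_sum lookup_single when_def in_keys_iff if_distrib cong: if_cong)
  ultimately show ?thesis using assms(1) by (metis finite_keys)
qed

section \<open>The free algebra, its bilinear relations and their quotient\<close>

locale tensor_product = A: algebra_over A + B: algebra_over B
  for A :: "('k::field, 'a) module" and B :: "('k, 'b) module"
begin

abbreviation "Fr \<equiv> free_algebra A B"
abbreviation "N \<equiv> tensor_kernel A B"
abbreviation "T \<equiv> tensor_algebra A B"
abbreviation "cls \<equiv> tensor_class A B"
abbreviation "pt \<equiv> pure_tensor A B"
abbreviation pmul :: "'a \<times> 'b \<Rightarrow> 'a \<times> 'b \<Rightarrow> 'a \<times> 'b"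
  where "pmul u v \<equiv> (fst u \<otimes>\<^bsub>A\<^esub> fst v, snd u \<otimes>\<^bsub>B\<^esub> snd v)"

lemma Fr_simps [simp]:
  "f \<oplus>\<^bsub>Fr\<^esub> g = f + g" "\<zero>\<^bsub>Fr\<^esub> = 0" "\<one>\<^bsub>Fr\<^esub> = Poly_Mapping.single (\<one>\<^bsub>A\<^esub>, \<one>\<^bsub>B\<^esub>) 1"
  by (simp_all add: free_algebra_def)

lemma Fr_carrier: "f \<in> carrier Fr \<longleftrightarrow> Poly_Mapping.keys f \<subseteq> carrier A \<times> carrier B"
  by (simp add: free_algebra_def)

text \<open>The product is a sum over supports, and supports shrink under cancellation. Over common
  larger finite sets, bilinearity becomes a termwise computation.\<close>

lemma Fr_mult_eq:
  assumes "finite S" "finite S'" "Poly_Mapping.keys f \<subseteq> S" "Poly_Mapping.keys g \<subseteq> S'"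
  shows "f \<otimes>\<^bsub>Fr\<^esub> g = (\<Sum>u\<in>S. \<Sum>v\<in>S'. Poly_Mapping.single (pmul u v)
    (Poly_Mapping.lookup f u * Poly_Mapping.lookup g v))"
proof -
  have "f \<otimes>\<^bsub>Fr\<^esub> g = (\<Sum>u\<in>Poly_Mapping.keys f. \<Sum>v\<in>S'. Poly_Mapping.single (pmul u v)
    (Poly_Mapping.lookup f u * Poly_Mapping.lookup g v))"
    using assms by (simp add: free_algebra_def)
      (rule sum.cong[OF refl], rule sum.mono_neutral_left, auto simp: in_keys_iff)
  also have "\<dots> = (\<Sum>u\<in>S. \<Sum>v\<in>S'. Poly_Mapping.single (pmul u v)
    (Poly_Mapping.lookup f u * Poly_Mapping.lookup g v))"
    using assms by (auto simp: in_keys_iff intro!: sum.mono_neutral_left)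
  finally show ?thesis .
qed

lemma Fr_mult_add_l: "(f + f') \<otimes>\<^bsub>Fr\<^esub> g = f \<otimes>\<^bsub>Fr\<^esub> g + f' \<otimes>\<^bsub>Fr\<^esub> g"
  using keys_add[of f f']
  by (subst (1 2 3) Fr_mult_eq[of "Poly_Mapping.keys f \<union> Poly_Mapping.keys f'" "Poly_Mapping.keys g"])
    (auto simp: lookup_add distrib_right single_add sum.distrib)

lemma Fr_mult_add_r: "f \<otimes>\<^bsub>Fr\<^esub> (g + g') = f \<otimes>\<^bsub>Fr\<^esub> g + f \<otimes>\<^bsub>Fr\<^esub> g'"
  using keys_add[of g g']
  by (subst (1 2 3) Fr_mult_eq[of "Poly_Mapping.keys f" "Poly_Mapping.keys g \<union> Poly_Mapping.keys g'"])
    (auto simp: lookup_add distrib_left single_add sum.distrib)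

lemma Fr_mult_scale_l: "scale c f \<otimes>\<^bsub>Fr\<^esub> g = scale c (f \<otimes>\<^bsub>Fr\<^esub> g)"
  using keys_scale[of c f]
  by (subst (1 2) Fr_mult_eq[of "Poly_Mapping.keys f" "Poly_Mapping.keys g"])
    (auto simp: poly_mapping_space.scale_sum_right mult.assoc)

lemma Fr_mult_scale_r: "f \<otimes>\<^bsub>Fr\<^esub> scale c g = scale c (f \<otimes>\<^bsub>Fr\<^esub> g)"
  using keys_scale[of c g]
  by (subst (1 2) Fr_mult_eq[of "Poly_Mapping.keys f" "Poly_Mapping.keys g"])
    (auto simp: poly_mapping_space.scale_sum_right mult.left_commute)

lemma Fr_mult_single [simp]:
  "Poly_Mapping.single u c \<otimes>\<^bsub>Fr\<^esub> Poly_Mapping.single v d = Poly_Mapping.single (pmul u v) (c * d)"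
  by (subst Fr_mult_eq[of "{u}" "{v}"]) auto

lemma Fr_mult_zero [simp]: "0 \<otimes>\<^bsub>Fr\<^esub> g = 0" "f \<otimes>\<^bsub>Fr\<^esub> 0 = 0"
  by (simp_all add: free_algebra_def)

lemma Fr_add_closed: "f \<in> carrier Fr \<Longrightarrow> g \<in> carrier Fr \<Longrightarrow> f + g \<in> carrier Fr"
  using keys_add[of f g] by (auto simp: Fr_carrier)

lemma Fr_single_closed [simp]:
  "a \<in> carrier A \<Longrightarrow> b \<in> carrier B \<Longrightarrow> Poly_Mapping.single (a, b) c \<in> carrier Fr"
  by (simp add: Fr_carrier)

lemma Fr_scale_closed: "f \<in> carrier Fr \<Longrightarrow> scale c f \<in> carrier Fr"
  using keys_scale[of c f] by (auto simp: Fr_carrier)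

lemma Fr_zero_closed [simp]: "0 \<in> carrier Fr"
  by (simp add: Fr_carrier)

lemma Fr_uminus_closed: "f \<in> carrier Fr \<Longrightarrow> - f \<in> carrier Fr"
  by (auto simp: Fr_carrier in_keys_iff subset_iff)

lemma Fr_induct [consumes 1, case_names zero single add]:
  assumes "f \<in> carrier Fr" "P 0"
    and "\<And>a b c. a \<in> carrier A \<Longrightarrow> b \<in> carrier B \<Longrightarrow> P (Poly_Mapping.single (a, b) c)"
    and "\<And>f g. f \<in> carrier Fr \<Longrightarrow> g \<in> carrier Fr \<Longrightarrow> P f \<Longrightarrow> P g \<Longrightarrow> P (f + g)"
  shows "P f"
  using assms(1)[unfolded Fr_carrier]
proof (induction f rule: poly_mapping_span_induct)
  case (single u c)
  then show ?case using assms(3)[of "fst u" "snd u"] by auto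
qed (use assms Fr_carrier in auto)

lemma Fr_mult_closed:
  assumes "f \<in> carrier Fr" "g \<in> carrier Fr" shows "f \<otimes>\<^bsub>Fr\<^esub> g \<in> carrier Fr"
  using assms(1)
proof (induction f rule: Fr_induct)
  case (single a b c)
  show ?case using assms(2)
  proof (induction g rule: Fr_induct)
    case (single a' b' c')
    then show ?case using \<open>a \<in> carrier A\<close> \<open>b \<in> carrier B\<close> by simp
  qed (simp_all add: Fr_mult_add_r Fr_add_closed)
qed (simp_all add: Fr_mult_add_l Fr_add_closed)

lemma Fr_mult_assoc:
  assumes "f \<in> carrier Fr" "g \<in> carrier Fr" "h \<in> carrier Fr"
  shows "(f \<otimes>\<^bsub>Fr\<^esub> g) \<otimes>\<^bsub>Fr\<^esub> h = f \<otimes>\<^bsub>Fr\<^esub> (g \<otimes>\<^bsub>Fr\<^esub> h)"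
  using assms(1)
proof (induction f rule: Fr_induct)
  case f: (single a b c)
  show ?case using assms(2)
  proof (induction g rule: Fr_induct)
    case g: (single a' b' c')
    show ?case using assms(3)
    proof (induction h rule: Fr_induct)
      case (single a'' b'' c'')
      then show ?case using f g by (simp add: A.m_assoc B.m_assoc mult.assoc)
    qed (simp_all add: Fr_mult_add_r)
  qed (simp_all add: Fr_mult_add_r Fr_mult_add_l)
qed (simp_all add: Fr_mult_add_l)

lemma Fr_ring: "ring Fr"
proof (rule ringI)
  show "abelian_group Fr"
  proof (rule abelian_groupI)
    show "\<exists>g\<in>carrier Fr. g \<oplus>\<^bsub>Fr\<^esub> f = \<zero>\<^bsub>Fr\<^esub>" if "f \<in> carrier Fr" for f
      using Fr_scale_closed[OF that, of "- 1"]
      by (intro bexI[of _ "scale (- 1) f"]) (auto intro!: poly_mapping_eqI simp: lookup_add)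
  qed (auto simp: Fr_add_closed add.assoc add.commute)
  show "monoid Fr"
  proof (rule monoidI)
    show "\<one>\<^bsub>Fr\<^esub> \<otimes>\<^bsub>Fr\<^esub> f = f" if "f \<in> carrier Fr" for f
      using that by (induction f rule: Fr_induct) (simp_all add: Fr_mult_add_r)
    show "f \<otimes>\<^bsub>Fr\<^esub> \<one>\<^bsub>Fr\<^esub> = f" if "f \<in> carrier Fr" for f
      using that by (induction f rule: Fr_induct) (simp_all add: Fr_mult_add_l)
  qed (auto simp: Fr_mult_closed Fr_mult_assoc)
qed (auto simp: Fr_mult_add_l Fr_mult_add_r)

lemmas N_span_simps = tensor_kernel_def poly_mapping_space.span_add poly_mapping_space.span_scale
  poly_mapping_space.span_zero poly_mapping_space.span_diff

lemma N_add: "f \<in> N \<Longrightarrow> g \<in> N \<Longrightarrow> f + g \<in> N"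
  and N_diff: "f \<in> N \<Longrightarrow> g \<in> N \<Longrightarrow> f - g \<in> N"
  and N_scale: "f \<in> N \<Longrightarrow> scale c f \<in> N"
  and N_zero: "0 \<in> N"
  by (simp_all add: N_span_simps)

lemma relation_cases:
  assumes "r \<in> bilinear_relations A B"
  obtains (add_l) a a' b where
      "r = Poly_Mapping.single (a \<oplus>\<^bsub>A\<^esub> a', b) 1 - Poly_Mapping.single (a, b) 1 - Poly_Mapping.single (a', b) 1"
      "a \<in> carrier A" "a' \<in> carrier A" "b \<in> carrier B"
  | (add_r) a b b' where
      "r = Poly_Mapping.single (a, b \<oplus>\<^bsub>B\<^esub> b') 1 - Poly_Mapping.single (a, b) 1 - Poly_Mapping.single (a, b') 1"
      "a \<in> carrier A" "b \<in> carrier B" "b' \<in> carrier B"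
  | (smult_l) c a b where
      "r = Poly_Mapping.single (c \<odot>\<^bsub>A\<^esub> a, b) 1 - scale c (Poly_Mapping.single (a, b) 1)"
      "a \<in> carrier A" "b \<in> carrier B"
  | (smult_r) c a b where
      "r = Poly_Mapping.single (a, c \<odot>\<^bsub>B\<^esub> b) 1 - scale c (Poly_Mapping.single (a, b) 1)"
      "a \<in> carrier A" "b \<in> carrier B"
proof -
  from assms show thesis
    unfolding bilinear_relations_def Let_def Un_iff mem_Collect_eq
    by (elim disjE exE conjE)
      (rule add_l, assumption+, rule add_r, assumption+, rule smult_l, assumption+, rule smult_r, assumption+)
qed

lemma relation_in_N: "r \<in> bilinear_relations A B \<Longrightarrow> r \<in> N"
  unfolding tensor_kernel_def by (rule poly_mapping_space.span_base)

lemma relations: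
  assumes "a \<in> carrier A" "b \<in> carrier B"
  shows "a' \<in> carrier A \<Longrightarrow> Poly_Mapping.single (a \<oplus>\<^bsub>A\<^esub> a', b) 1 - Poly_Mapping.single (a, b) 1 - Poly_Mapping.single (a', b) 1 \<in> N"
    and "b' \<in> carrier B \<Longrightarrow> Poly_Mapping.single (a, b \<oplus>\<^bsub>B\<^esub> b') 1 - Poly_Mapping.single (a, b) 1 - Poly_Mapping.single (a, b') 1 \<in> N"
    and "Poly_Mapping.single (c \<odot>\<^bsub>A\<^esub> a, b) 1 - Poly_Mapping.single (a, b) c \<in> N"
    and "Poly_Mapping.single (a, c \<odot>\<^bsub>B\<^esub> b) 1 - Poly_Mapping.single (a, b) c \<in> N"
proof -
  have s: "Poly_Mapping.single u c = scale c (Poly_Mapping.single u 1)" for u :: "'a \<times> 'b" by simp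
  show "a' \<in> carrier A \<Longrightarrow> Poly_Mapping.single (a \<oplus>\<^bsub>A\<^esub> a', b) 1 - Poly_Mapping.single (a, b) 1 - Poly_Mapping.single (a', b) 1 \<in> N"
    using assms by (intro relation_in_N, unfold bilinear_relations_def Let_def) blast
  show "b' \<in> carrier B \<Longrightarrow> Poly_Mapping.single (a, b \<oplus>\<^bsub>B\<^esub> b') 1 - Poly_Mapping.single (a, b) 1 - Poly_Mapping.single (a, b') 1 \<in> N"
    using assms by (intro relation_in_N, unfold bilinear_relations_def Let_def) blast
  show "Poly_Mapping.single (c \<odot>\<^bsub>A\<^esub> a, b) 1 - Poly_Mapping.single (a, b) c \<in> N"
    unfolding s using assms by (intro relation_in_N, unfold bilinear_relations_def Let_def) blast
  show "Poly_Mapping.single (a, c \<odot>\<^bsub>B\<^esub> b) 1 - Poly_Mapping.single (a, b) c \<in> N"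
    unfolding s using assms by (intro relation_in_N, unfold bilinear_relations_def Let_def) blast
qed

lemma Fr_diff_closed: "f \<in> carrier Fr \<Longrightarrow> g \<in> carrier Fr \<Longrightarrow> f - g \<in> carrier Fr"
  using keys_diff[of f g] by (auto simp: Fr_carrier)

lemma N_sub_Fr: "f \<in> N \<Longrightarrow> f \<in> carrier Fr"
  unfolding tensor_kernel_def
proof (induction f rule: poly_mapping_space.span_induct_alt)
  case base
  then show ?case by (simp add: Fr_carrier)
next
  case (step c r f)
  have "r \<in> carrier Fr" using step(1)
    by (cases r rule: relation_cases) (auto simp: Fr_diff_closed)
  then show ?case using step by (simp add: Fr_add_closed Fr_scale_closed)
qed

lemma Fr_mult_diff_r: "f \<otimes>\<^bsub>Fr\<^esub> (g - g') = f \<otimes>\<^bsub>Fr\<^esub> g - f \<otimes>\<^bsub>Fr\<^esub> g'"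
  using Fr_mult_add_r[of f "g - g'" g'] by simp

lemma Fr_mult_diff_l: "(f - f') \<otimes>\<^bsub>Fr\<^esub> g = f \<otimes>\<^bsub>Fr\<^esub> g - f' \<otimes>\<^bsub>Fr\<^esub> g"
  using Fr_mult_add_l[of "f - f'" f' g] by simp

text \<open>Since multiplication in \<open>A\<close> and \<open>B\<close> is bilinear, multiplying a
  defining relation by a basis element gives a relation of the same shape.\<close>

lemma single_relation:
  assumes "a \<in> carrier A" "b \<in> carrier B" "r \<in> bilinear_relations A B"
  shows "Poly_Mapping.single (a, b) 1 \<otimes>\<^bsub>Fr\<^esub> r \<in> N" "r \<otimes>\<^bsub>Fr\<^esub> Poly_Mapping.single (a, b) 1 \<in> N"
  using assms(3,1,2)
  by (cases r rule: relation_cases,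
      simp_all add: Fr_mult_diff_r Fr_mult_diff_l A.r_distr A.l_distr B.r_distr B.l_distr relations
        A.smult_mult_l A.smult_mult_r B.smult_mult_l B.smult_mult_r)+

text \<open>By linearity in both factors it suffices to multiply defining relations by basis
  elements, which is \<open>single_relation\<close>.\<close>

lemma N_ideal: "ideal N Fr"
proof (rule idealI[OF Fr_ring])
  interpret Fr: ring Fr by (rule Fr_ring)
  show "subgroup N (add_monoid Fr)"
  proof (rule Fr.add.subgroupI)
    show "\<ominus>\<^bsub>Fr\<^esub> f \<in> N" if "f \<in> N" for f
    proof -
      have "\<ominus>\<^bsub>Fr\<^esub> f = scale (- 1) f"
        using N_sub_Fr[OF that]
        by (intro Fr.minus_equality) (auto simp: Fr_uminus_closed)
      then show ?thesis using N_scale[OF that, of "- 1"] by simp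
    qed
  qed (use N_sub_Fr N_zero N_add in auto)
  have s: "Poly_Mapping.single (a, b) c \<otimes>\<^bsub>Fr\<^esub> n \<in> N \<and> n \<otimes>\<^bsub>Fr\<^esub> Poly_Mapping.single (a, b) c \<in> N"
    if "n \<in> N" "a \<in> carrier A" "b \<in> carrier B" for a b c n
    using that(1)[unfolded tensor_kernel_def]
  proof (induction n rule: poly_mapping_space.span_induct_alt)
    case (step d r n)
    have "scale (c * d) (Poly_Mapping.single (a, b) 1 \<otimes>\<^bsub>Fr\<^esub> r) \<in> N"
      "scale (c * d) (r \<otimes>\<^bsub>Fr\<^esub> Poly_Mapping.single (a, b) 1) \<in> N"
      using single_relation[OF that(2,3) step(1)] by (auto intro: N_scale)
    then have "Poly_Mapping.single (a, b) c \<otimes>\<^bsub>Fr\<^esub> scale d r \<in> N"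
      "scale d r \<otimes>\<^bsub>Fr\<^esub> Poly_Mapping.single (a, b) c \<in> N"
      using Fr_mult_scale_l[of c "Poly_Mapping.single (a, b) 1" r] Fr_mult_scale_r[of r c "Poly_Mapping.single (a, b) 1"]
      by (simp_all add: Fr_mult_scale_l Fr_mult_scale_r mult.commute)
    with step show ?case by (simp add: Fr_mult_add_l Fr_mult_add_r N_add)
  qed (simp add: N_zero)
  fix n f assume "n \<in> N" "f \<in> carrier Fr"
  from this(2) have "f \<otimes>\<^bsub>Fr\<^esub> n \<in> N \<and> n \<otimes>\<^bsub>Fr\<^esub> f \<in> N"
    by (induction f rule: Fr_induct) (use \<open>n \<in> N\<close> s in \<open>simp_all add: Fr_mult_add_l Fr_mult_add_r N_add N_zero\<close>)
  then show "f \<otimes>\<^bsub>Fr\<^esub> n \<in> N" "n \<otimes>\<^bsub>Fr\<^esub> f \<in> N" by auto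
qed

lemma mem_cls: "g \<in> cls f \<longleftrightarrow> g - f \<in> N"
proof -
  have "g \<in> cls f \<longleftrightarrow> (\<exists>n\<in>N. g = n + f)"
    by (auto simp: tensor_class_def a_r_coset_def')
  also have "\<dots> \<longleftrightarrow> g - f \<in> N" by (auto intro!: bexI[of _ "g - f"])
  finally show ?thesis .
qed

lemma cls_eq_iff: "cls f = cls g \<longleftrightarrow> f - g \<in> N"
proof
  assume "cls f = cls g"
  then have "f \<in> cls g" using mem_cls[of f f] N_zero by simp
  then show "f - g \<in> N" by (simp add: mem_cls)
next
  assume a: "f - g \<in> N"
  show "cls f = cls g"
  proof (rule Set.set_eqI)
    fix h
    show "h \<in> cls f \<longleftrightarrow> h \<in> cls g"
      using N_add[of "h - f" "f - g"] N_diff[of "h - g" "f - g"] a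
      unfolding mem_cls by auto
  qed
qed

lemma cls_self: "f \<in> cls f"
  by (simp add: mem_cls N_zero)

lemma T_carrier: "carrier T = cls ` carrier Fr"
  by (auto simp: tensor_algebra_def FactRing_def A_RCOSETS_def' tensor_class_def)

lemma cls_closed [simp]: "f \<in> carrier Fr \<Longrightarrow> cls f \<in> carrier T"
  by (simp add: T_carrier)

lemma T_add_cls:
  assumes "f \<in> carrier Fr" "g \<in> carrier Fr" shows "cls f \<oplus>\<^bsub>T\<^esub> cls g = cls (f + g)"
proof -
  interpret ideal N Fr by (rule N_ideal)
  show ?thesis
    using a_rcos_sum[OF assms] by (simp add: tensor_algebra_def FactRing_def tensor_class_def)
qed

lemma T_mult_cls:
  assumes "f \<in> carrier Fr" "g \<in> carrier Fr" shows "cls f \<otimes>\<^bsub>T\<^esub> cls g = cls (f \<otimes>\<^bsub>Fr\<^esub> g)"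
proof -
  interpret ideal N Fr by (rule N_ideal)
  show ?thesis
    using rcoset_mult_add[OF assms] by (simp add: tensor_algebra_def FactRing_def tensor_class_def)
qed

lemma T_smult_cls:
  assumes "f \<in> carrier Fr" shows "c \<odot>\<^bsub>T\<^esub> cls f = cls (scale c f)"
proof -
  \<comment> \<open>The union in the definition of the scalar action runs over equal classes and
    therefore collapses to a single one.\<close>
  have "cls (scale c g) = cls (scale c f)" if "g \<in> cls f" for g
    using that N_scale[of "g - f" c] by (simp add: mem_cls cls_eq_iff poly_mapping_space.scale_right_diff_distrib)
  then have "(\<Union>g\<in>cls f. cls (scale c g)) = (\<Union>g\<in>cls f. cls (scale c f))" by (rule SUP_cong[OF refl])
  also have "\<dots> = cls (scale c f)" using cls_self[of f] by blast
  finally show ?thesis by (simp add: tensor_algebra_def Let_def)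
qed

lemma T_zero: "\<zero>\<^bsub>T\<^esub> = cls 0" and T_one: "\<one>\<^bsub>T\<^esub> = cls (Poly_Mapping.single (\<one>\<^bsub>A\<^esub>, \<one>\<^bsub>B\<^esub>) 1)"
  by (auto simp: tensor_algebra_def Let_def FactRing_def tensor_class_def a_r_coset_def')

lemma T_ring: "ring T"
proof -
  interpret Q: ring "Fr Quot N" by (rule ideal.quotient_is_ring[OF N_ideal])
  have s: "carrier T = carrier (Fr Quot N)" "monoid.mult T = monoid.mult (Fr Quot N)" "one T = one (Fr Quot N)"
    "ring.zero T = ring.zero (Fr Quot N)" "add T = add (Fr Quot N)"
    by (simp_all add: tensor_algebra_def Let_def)
  show ?thesis
  proof (rule ringI)
    show "abelian_group T"
    proof (rule abelian_groupI)
      show "\<exists>y\<in>carrier T. y \<oplus>\<^bsub>T\<^esub> x = \<zero>\<^bsub>T\<^esub>" if "x \<in> carrier T" for x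
        using that Q.l_neg[of x] Q.a_inv_closed[of x] unfolding s by blast
    qed (simp_all add: s Q.a_ac)
    show "monoid T" by (rule monoidI) (simp_all add: s Q.m_assoc)
  qed (simp_all add: s Q.l_distr Q.r_distr)
qed

sublocale T: algebra_over T
proof (intro algebra_over.intro T_ring algebra_over_axioms.intro)
  note [simp] = T_smult_cls T_add_cls T_mult_cls Fr_scale_closed Fr_add_closed Fr_mult_closed
    Fr_mult_scale_l Fr_mult_scale_r
  fix x y c d assume "x \<in> carrier T" "y \<in> carrier T"
  then obtain f g where [simp]: "x = cls f" "f \<in> carrier Fr" "y = cls g" "g \<in> carrier Fr"
    by (auto simp: T_carrier)
  show "c \<odot>\<^bsub>T\<^esub> (x \<oplus>\<^bsub>T\<^esub> y) = c \<odot>\<^bsub>T\<^esub> x \<oplus>\<^bsub>T\<^esub> c \<odot>\<^bsub>T\<^esub> y"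
    by (simp add: poly_mapping_space.scale_right_distrib)
  show "(c \<odot>\<^bsub>T\<^esub> x) \<otimes>\<^bsub>T\<^esub> y = c \<odot>\<^bsub>T\<^esub> (x \<otimes>\<^bsub>T\<^esub> y)" "x \<otimes>\<^bsub>T\<^esub> (c \<odot>\<^bsub>T\<^esub> y) = c \<odot>\<^bsub>T\<^esub> (x \<otimes>\<^bsub>T\<^esub> y)"
    by simp_all
next
  note [simp] = T_smult_cls T_add_cls Fr_scale_closed
  fix x c d assume "x \<in> carrier T"
  then obtain f where [simp]: "x = cls f" "f \<in> carrier Fr"
    by (auto simp: T_carrier)
  show "c \<odot>\<^bsub>T\<^esub> x \<in> carrier T" "(c + d) \<odot>\<^bsub>T\<^esub> x = c \<odot>\<^bsub>T\<^esub> x \<oplus>\<^bsub>T\<^esub> d \<odot>\<^bsub>T\<^esub> x"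
    "(c * d) \<odot>\<^bsub>T\<^esub> x = c \<odot>\<^bsub>T\<^esub> (d \<odot>\<^bsub>T\<^esub> x)" "1 \<odot>\<^bsub>T\<^esub> x = x"
    by (simp_all add: poly_mapping_space.scale_left_distrib)
qed

lemma pt_closed [simp, intro]: "a \<in> carrier A \<Longrightarrow> b \<in> carrier B \<Longrightarrow> pt a b \<in> carrier T"
  by (simp add: pure_tensor_def)

lemma cls_single: "a \<in> carrier A \<Longrightarrow> b \<in> carrier B \<Longrightarrow> cls (Poly_Mapping.single (a, b) c) = c \<odot>\<^bsub>T\<^esub> pt a b"
  by (simp add: pure_tensor_def T_smult_cls)

lemma pt_smult_l: "a \<in> carrier A \<Longrightarrow> b \<in> carrier B \<Longrightarrow> pt (c \<odot>\<^bsub>A\<^esub> a) b = c \<odot>\<^bsub>T\<^esub> pt a b"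
  by (simp add: pure_tensor_def T_smult_cls cls_eq_iff relations)

lemma pt_smult_r: "a \<in> carrier A \<Longrightarrow> b \<in> carrier B \<Longrightarrow> pt a (c \<odot>\<^bsub>B\<^esub> b) = c \<odot>\<^bsub>T\<^esub> pt a b"
  by (simp add: pure_tensor_def T_smult_cls cls_eq_iff relations)

lemma pt_add_l: "a \<in> carrier A \<Longrightarrow> a' \<in> carrier A \<Longrightarrow> b \<in> carrier B \<Longrightarrow> pt (a \<oplus>\<^bsub>A\<^esub> a') b = pt a b \<oplus>\<^bsub>T\<^esub> pt a' b"
  using relations(1)[of a b a'] by (simp add: pure_tensor_def T_add_cls cls_eq_iff diff_diff_eq)

lemma pt_add_r: "a \<in> carrier A \<Longrightarrow> b \<in> carrier B \<Longrightarrow> b' \<in> carrier B \<Longrightarrow> pt a (b \<oplus>\<^bsub>B\<^esub> b') = pt a b \<oplus>\<^bsub>T\<^esub> pt a b'"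
  using relations(2)[of a b b'] by (simp add: pure_tensor_def T_add_cls cls_eq_iff diff_diff_eq)

lemma pt_mult: "a \<in> carrier A \<Longrightarrow> b \<in> carrier B \<Longrightarrow> a' \<in> carrier A \<Longrightarrow> b' \<in> carrier B \<Longrightarrow>
    pt a b \<otimes>\<^bsub>T\<^esub> pt a' b' = pt (a \<otimes>\<^bsub>A\<^esub> a') (b \<otimes>\<^bsub>B\<^esub> b')"
  by (simp add: pure_tensor_def T_mult_cls)

lemma pt_one: "\<one>\<^bsub>T\<^esub> = pt \<one>\<^bsub>A\<^esub> \<one>\<^bsub>B\<^esub>"
  by (simp add: T_one pure_tensor_def)

lemma pt_zero_r: "a \<in> carrier A \<Longrightarrow> pt a \<zero>\<^bsub>B\<^esub> = \<zero>\<^bsub>T\<^esub>"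
  using pt_smult_r[of a "\<zero>\<^bsub>B\<^esub>" 0] by simp

lemma pt_zero_l: "b \<in> carrier B \<Longrightarrow> pt \<zero>\<^bsub>A\<^esub> b = \<zero>\<^bsub>T\<^esub>"
  using pt_smult_l[of "\<zero>\<^bsub>A\<^esub>" b 0] by simp

lemma T_induct [consumes 1, case_names pure add]:
  assumes "x \<in> carrier T"
    and pure: "\<And>a b. a \<in> carrier A \<Longrightarrow> b \<in> carrier B \<Longrightarrow> P (pt a b)"
    and add: "\<And>x y. x \<in> carrier T \<Longrightarrow> y \<in> carrier T \<Longrightarrow> P x \<Longrightarrow> P y \<Longrightarrow> P (x \<oplus>\<^bsub>T\<^esub> y)"
  shows "P x"
proof -
  obtain f where f: "x = cls f" "f \<in> carrier Fr" using assms(1) by (auto simp: T_carrier)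
  from f(2) have "P (cls f)"
  proof (induction f rule: Fr_induct)
    case zero
    have "cls 0 = pt \<zero>\<^bsub>A\<^esub> \<zero>\<^bsub>B\<^esub>" by (simp add: pt_zero_l T_zero)
    then show ?case using pure by simp
  next
    case (single a b c)
    have "cls (Poly_Mapping.single (a, b) c) = pt (c \<odot>\<^bsub>A\<^esub> a) b"
      using single by (simp add: cls_single pt_smult_l)
    then show ?case using pure[of "c \<odot>\<^bsub>A\<^esub> a" b] single by simp
  next
    case (add f g)
    then show ?case using assms(3)[of "cls f" "cls g"] by (simp add: T_add_cls)
  qed
  then show ?thesis by (simp add: f)
qed

text \<open>Here \<open>t c a b\<close> is the value on \<open>(c a) \<otimes> b\<close>; the scalar is a separate argument because the map need
  not be linear over the scalars.\<close>

lemma tensor_lift: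
  assumes M: "abelian_group M"
    and t: "\<And>c a b. a \<in> carrier A \<Longrightarrow> b \<in> carrier B \<Longrightarrow> t c a b \<in> carrier M"
      "\<And>c d a b. a \<in> carrier A \<Longrightarrow> b \<in> carrier B \<Longrightarrow> t (c + d) a b = t c a b \<oplus>\<^bsub>M\<^esub> t d a b"
      "\<And>c a a' b. a \<in> carrier A \<Longrightarrow> a' \<in> carrier A \<Longrightarrow> b \<in> carrier B \<Longrightarrow> t c (a \<oplus>\<^bsub>A\<^esub> a') b = t c a b \<oplus>\<^bsub>M\<^esub> t c a' b"
      "\<And>c a b b'. a \<in> carrier A \<Longrightarrow> b \<in> carrier B \<Longrightarrow> b' \<in> carrier B \<Longrightarrow> t c a (b \<oplus>\<^bsub>B\<^esub> b') = t c a b \<oplus>\<^bsub>M\<^esub> t c a b'"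
      "\<And>c d a b. a \<in> carrier A \<Longrightarrow> b \<in> carrier B \<Longrightarrow> t c (d \<odot>\<^bsub>A\<^esub> a) b = t (c * d) a b"
      "\<And>c d a b. a \<in> carrier A \<Longrightarrow> b \<in> carrier B \<Longrightarrow> t c a (d \<odot>\<^bsub>B\<^esub> b) = t (c * d) a b"
  defines "L \<equiv> \<lambda>f. \<Oplus>\<^bsub>M\<^esub>u\<in>Poly_Mapping.keys f. t (Poly_Mapping.lookup f u) (fst u) (snd u)"
  shows "f \<in> carrier Fr \<Longrightarrow> L f \<in> carrier M"
    and "f \<in> carrier Fr \<Longrightarrow> g \<in> carrier Fr \<Longrightarrow> L (f + g) = L f \<oplus>\<^bsub>M\<^esub> L g"
    and "a \<in> carrier A \<Longrightarrow> b \<in> carrier B \<Longrightarrow> L (Poly_Mapping.single (a, b) c) = t c a b"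
    and "f \<in> carrier Fr \<Longrightarrow> g \<in> carrier Fr \<Longrightarrow> cls f = cls g \<Longrightarrow> L f = L g"
proof -
  interpret M: abelian_group M by (rule M)
  have t0: "t 0 a b = \<zero>\<^bsub>M\<^esub>" if "a \<in> carrier A" "b \<in> carrier B" for a b
    using t(2)[OF that, of 0 0] t(1)[OF that] by (intro M.add_self_zero) auto
  \<comment> \<open>As \<open>t\<close> vanishes at the scalar 0, the sum may run over any finite
    set of pairs that contains the support; this makes sums with different supports
    comparable.\<close>
  have L_eq: "L f = (\<Oplus>\<^bsub>M\<^esub>u\<in>S. t (Poly_Mapping.lookup f u) (fst u) (snd u))"
    if "finite S" "Poly_Mapping.keys f \<subseteq> S" "S \<subseteq> carrier A \<times> carrier B" for S f
    unfolding L_def using that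
    by (intro M.add.finprod_mono_neutral_cong_left) (auto simp: in_keys_iff t t0 subset_iff)
  show closed: "L f \<in> carrier M" if "f \<in> carrier Fr" for f
    unfolding L_def using that by (intro M.finsum_closed) (auto simp: Fr_carrier t)
  show add: "L (f + g) = L f \<oplus>\<^bsub>M\<^esub> L g" if "f \<in> carrier Fr" "g \<in> carrier Fr" for f g
  proof -
    let ?S = "Poly_Mapping.keys f \<union> Poly_Mapping.keys g"
    have S: "?S \<subseteq> carrier A \<times> carrier B" using that by (auto simp: Fr_carrier)
    have tS: "t c (fst u) (snd u) \<in> carrier M" if "u \<in> ?S" for c u using that S t(1) by auto
    have "L (f + g) = (\<Oplus>\<^bsub>M\<^esub>u\<in>?S. t (Poly_Mapping.lookup (f + g) u) (fst u) (snd u))"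
      by (rule L_eq) (use keys_add[of f g] S in auto)
    also have "\<dots> = (\<Oplus>\<^bsub>M\<^esub>u\<in>?S. t (Poly_Mapping.lookup f u) (fst u) (snd u) \<oplus>\<^bsub>M\<^esub> t (Poly_Mapping.lookup g u) (fst u) (snd u))"
      using S tS by (intro M.finsum_cong') (auto simp: lookup_add t)
    also have "\<dots> = (\<Oplus>\<^bsub>M\<^esub>u\<in>?S. t (Poly_Mapping.lookup f u) (fst u) (snd u)) \<oplus>\<^bsub>M\<^esub> (\<Oplus>\<^bsub>M\<^esub>u\<in>?S. t (Poly_Mapping.lookup g u) (fst u) (snd u))"
      using tS by (intro M.finsum_addf) auto
    also have "\<dots> = L f \<oplus>\<^bsub>M\<^esub> L g"
      by (subst (1 2) L_eq[of ?S]) (use S in auto)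
    finally show ?thesis .
  qed
  show single: "L (Poly_Mapping.single (a, b) c) = t c a b" if "a \<in> carrier A" "b \<in> carrier B" for a b c
    using that by (subst L_eq[of "{(a, b)}"]) (auto simp: t)
  have diff: "L (f - g) = L f \<ominus>\<^bsub>M\<^esub> L g" if "f \<in> carrier Fr" "g \<in> carrier Fr" for f g
  proof -
    have "L f = L (f - g) \<oplus>\<^bsub>M\<^esub> L g" using add[of "f - g" g] that by (simp add: Fr_diff_closed)
    then show ?thesis using closed that Fr_diff_closed[OF that]
      by (simp add: M.minus_eq M.a_assoc M.r_neg)
  qed
  have scale_single: "L (scale d (Poly_Mapping.single (a, b) c)) = t (d * c) a b"
    if "a \<in> carrier A" "b \<in> carrier B" for a b c d
    using single that by simp
  have rel: "L (scale c r) = \<zero>\<^bsub>M\<^esub>" if "r \<in> bilinear_relations A B" for c r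
    using that
  proof (cases r rule: relation_cases)
    case (add_l a a' b)
    then show ?thesis
      by (simp add: poly_mapping_space.scale_right_diff_distrib diff Fr_diff_closed single t M.minus_eq
        M.a_assoc M.r_neg M.a_comm[of "t c a b" "t c a' b"] M.r_neg2 del: Fr_simps,
        (simp add: M.a_assoc[symmetric] t M.r_neg)?)
  next
    case (add_r a b b')
    then show ?thesis
      by (simp add: poly_mapping_space.scale_right_diff_distrib diff Fr_diff_closed single t M.minus_eq
        M.a_assoc M.r_neg M.a_comm[of "t c a b" "t c a b'"] M.r_neg2 del: Fr_simps,
        (simp add: M.a_assoc[symmetric] t M.r_neg)?)
  qed (simp_all add: poly_mapping_space.scale_right_diff_distrib diff single t M.minus_eq M.r_neg)
  have N: "n \<in> carrier Fr \<and> L n = \<zero>\<^bsub>M\<^esub>" if "n \<in> N" for n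
    using that[unfolded tensor_kernel_def]
  proof (induction n rule: poly_mapping_space.span_induct_alt)
    case base
    then show ?case by (simp add: L_def)
  next
    case (step c r n)
    have "scale c r \<in> carrier Fr"
      using N_sub_Fr[OF relation_in_N[OF step(1)]] by (rule Fr_scale_closed)
    then show ?case using step by (simp add: add rel Fr_add_closed)
  qed
  show "L f = L g" if "f \<in> carrier Fr" "g \<in> carrier Fr" "cls f = cls g" for f g
  proof -
    have "L f = L (f - g) \<oplus>\<^bsub>M\<^esub> L g" using add[of "f - g" g] that by (simp add: Fr_diff_closed)
    then show ?thesis using N[of "f - g"] that closed by (simp add: cls_eq_iff)
  qed
qed

end

lemma (in abelian_monoid) finsum_Times:
  assumes "finite I" "finite J" "\<And>i j. i \<in> I \<Longrightarrow> j \<in> J \<Longrightarrow> f i j \<in> carrier G"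
  shows "(\<Oplus>p\<in>I \<times> J. f (fst p) (snd p)) = (\<Oplus>i\<in>I. \<Oplus>j\<in>J. f i j)"
  using assms(1,3)
proof (induction I)
  case (insert i I)
  have "(\<Oplus>p\<in>insert i I \<times> J. f (fst p) (snd p)) = (\<Oplus>p\<in>Pair i ` J \<union> I \<times> J. f (fst p) (snd p))"
    by (intro arg_cong[of _ _ "finsum G _"]) auto
  also have "\<dots> = (\<Oplus>p\<in>Pair i ` J. f (fst p) (snd p)) \<oplus> (\<Oplus>p\<in>I \<times> J. f (fst p) (snd p))"
    using insert assms(2) by (intro finsum_Un_disjoint) auto
  also have "(\<Oplus>p\<in>Pair i ` J. f (fst p) (snd p)) = (\<Oplus>j\<in>J. f i j)"
    using insert by (subst finsum_reindex) (auto simp: inj_on_def)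
  also have "(\<Oplus>p\<in>I \<times> J. f (fst p) (snd p)) = (\<Oplus>i\<in>I. \<Oplus>j\<in>J. f i j)"
    using insert by auto
  finally show ?case using insert by (subst finsum_insert) auto
qed simp

section \<open>Additive maps out of a tensor product\<close>

context tensor_product
begin

text \<open>The value is read off from an arbitrary representative of the class; the last clause of
  \<open>tensor_lift\<close> shows that the choice does not matter.\<close>

definition tlift :: "('c, 'm) ring_scheme \<Rightarrow> ('k \<Rightarrow> 'a \<Rightarrow> 'b \<Rightarrow> 'c) \<Rightarrow> ('a \<times> 'b \<Rightarrow>\<^sub>0 'k) set \<Rightarrow> 'c"
  where "tlift M t x = (let f = SOME f. f \<in> carrier Fr \<and> cls f = x in
    \<Oplus>\<^bsub>M\<^esub>u\<in>Poly_Mapping.keys f. t (Poly_Mapping.lookup f u) (fst u) (snd u))"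

context
  fixes M :: "('c, 'm) ring_scheme" and t :: "'k \<Rightarrow> 'a \<Rightarrow> 'b \<Rightarrow> 'c"
  assumes M: "abelian_group M"
    and t: "\<And>c a b. a \<in> carrier A \<Longrightarrow> b \<in> carrier B \<Longrightarrow> t c a b \<in> carrier M"
      "\<And>c d a b. a \<in> carrier A \<Longrightarrow> b \<in> carrier B \<Longrightarrow> t (c + d) a b = t c a b \<oplus>\<^bsub>M\<^esub> t d a b"
      "\<And>c a a' b. a \<in> carrier A \<Longrightarrow> a' \<in> carrier A \<Longrightarrow> b \<in> carrier B \<Longrightarrow> t c (a \<oplus>\<^bsub>A\<^esub> a') b = t c a b \<oplus>\<^bsub>M\<^esub> t c a' b"
      "\<And>c a b b'. a \<in> carrier A \<Longrightarrow> b \<in> carrier B \<Longrightarrow> b' \<in> carrier B \<Longrightarrow> t c a (b \<oplus>\<^bsub>B\<^esub> b') = t c a b \<oplus>\<^bsub>M\<^esub> t c a b'"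
      "\<And>c d a b. a \<in> carrier A \<Longrightarrow> b \<in> carrier B \<Longrightarrow> t c (d \<odot>\<^bsub>A\<^esub> a) b = t (c * d) a b"
      "\<And>c d a b. a \<in> carrier A \<Longrightarrow> b \<in> carrier B \<Longrightarrow> t c a (d \<odot>\<^bsub>B\<^esub> b) = t (c * d) a b"
begin

lemma tlift_cls:
  assumes "f \<in> carrier Fr"
  shows "tlift M t (cls f) = (\<Oplus>\<^bsub>M\<^esub>u\<in>Poly_Mapping.keys f. t (Poly_Mapping.lookup f u) (fst u) (snd u))"
proof -
  have "(SOME g. g \<in> carrier Fr \<and> cls g = cls f) \<in> carrier Fr \<and> cls (SOME g. g \<in> carrier Fr \<and> cls g = cls f) = cls f"
    using assms by (intro someI[of "\<lambda>g. g \<in> carrier Fr \<and> cls g = cls f" f]) auto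
  then show ?thesis unfolding tlift_def Let_def using tensor_lift(4)[OF M t] assms by blast
qed

lemma tlift_closed: "x \<in> carrier T \<Longrightarrow> tlift M t x \<in> carrier M"
  using tensor_lift(1)[OF M t] by (auto simp: T_carrier tlift_cls)

lemma tlift_add: "x \<in> carrier T \<Longrightarrow> y \<in> carrier T \<Longrightarrow> tlift M t (x \<oplus>\<^bsub>T\<^esub> y) = tlift M t x \<oplus>\<^bsub>M\<^esub> tlift M t y"
  using tensor_lift(2)[OF M t] by (auto simp: T_carrier tlift_cls T_add_cls Fr_add_closed)

lemma tlift_pt: "a \<in> carrier A \<Longrightarrow> b \<in> carrier B \<Longrightarrow> tlift M t (pt a b) = t 1 a b"
  using tensor_lift(3)[OF M t, of a b 1] by (simp add: pure_tensor_def tlift_cls del: keys_single)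

end

lemma pt_finsum_l:
  assumes "y \<in> carrier B" "\<And>j. j \<in> J \<Longrightarrow> f j \<in> carrier A"
  shows "pt (\<Oplus>\<^bsub>A\<^esub>j\<in>J. f j) y = (\<Oplus>\<^bsub>T\<^esub>j\<in>J. pt (f j) y)"
  using additive_finsum[of A T "carrier A" "\<lambda>a. pt a y" J f] assms
  by (simp add: A.abelian_monoid_axioms T.abelian_monoid_axioms pt_add_l pt_zero_l)

lemma pt_finsum_r:
  assumes "a \<in> carrier A" "\<And>j. j \<in> J \<Longrightarrow> f j \<in> carrier B"
  shows "pt a (\<Oplus>\<^bsub>B\<^esub>j\<in>J. f j) = (\<Oplus>\<^bsub>T\<^esub>j\<in>J. pt a (f j))"
  using additive_finsum[of B T "carrier B" "\<lambda>y. pt a y" J f] assms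
  by (simp add: B.abelian_monoid_axioms T.abelian_monoid_axioms pt_add_r pt_zero_r)

end

section \<open>Tensor products whose first factor has a basis\<close>

locale tensor_based = tensor_product A B + A: based_space A "carrier A" I b coord
  for A :: "('k::field, 'a) module" and B :: "('k, 'b) module" and I :: "'i set" and b coord
begin

text \<open>The tensor product is the direct sum of the copies \<open>b i \<otimes> B\<close>, and
  \<open>tcoord i\<close> is the projection to the copy with index \<open>i\<close>. A basis is
  required of \<open>A\<close> alone, since \<open>B\<close> may be an algebraic closure of infinite
  degree.\<close>

definition tcoord :: "'i \<Rightarrow> ('a \<times> 'b \<Rightarrow>\<^sub>0 'k) set \<Rightarrow> 'b"
  where "tcoord i = tlift B (\<lambda>c a y. (c * coord i a) \<odot>\<^bsub>B\<^esub> y)"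

context
  fixes i assumes i: "i \<in> I"
begin

private lemma tcoord_hyps:
  "\<And>c a y. a \<in> carrier A \<Longrightarrow> y \<in> carrier B \<Longrightarrow> (c * coord i a) \<odot>\<^bsub>B\<^esub> y \<in> carrier B"
  "\<And>c d a y. a \<in> carrier A \<Longrightarrow> y \<in> carrier B \<Longrightarrow>
    ((c + d) * coord i a) \<odot>\<^bsub>B\<^esub> y = (c * coord i a) \<odot>\<^bsub>B\<^esub> y \<oplus>\<^bsub>B\<^esub> (d * coord i a) \<odot>\<^bsub>B\<^esub> y"
  "\<And>c a a' y. a \<in> carrier A \<Longrightarrow> a' \<in> carrier A \<Longrightarrow> y \<in> carrier B \<Longrightarrow>
    (c * coord i (a \<oplus>\<^bsub>A\<^esub> a')) \<odot>\<^bsub>B\<^esub> y = (c * coord i a) \<odot>\<^bsub>B\<^esub> y \<oplus>\<^bsub>B\<^esub> (c * coord i a') \<odot>\<^bsub>B\<^esub> y"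
  "\<And>c a y y'. a \<in> carrier A \<Longrightarrow> y \<in> carrier B \<Longrightarrow> y' \<in> carrier B \<Longrightarrow>
    (c * coord i a) \<odot>\<^bsub>B\<^esub> (y \<oplus>\<^bsub>B\<^esub> y') = (c * coord i a) \<odot>\<^bsub>B\<^esub> y \<oplus>\<^bsub>B\<^esub> (c * coord i a) \<odot>\<^bsub>B\<^esub> y'"
  "\<And>c d a y. a \<in> carrier A \<Longrightarrow> y \<in> carrier B \<Longrightarrow> (c * coord i (d \<odot>\<^bsub>A\<^esub> a)) \<odot>\<^bsub>B\<^esub> y = (c * d * coord i a) \<odot>\<^bsub>B\<^esub> y"
  "\<And>c d a y. a \<in> carrier A \<Longrightarrow> y \<in> carrier B \<Longrightarrow> (c * coord i a) \<odot>\<^bsub>B\<^esub> (d \<odot>\<^bsub>B\<^esub> y) = (c * d * coord i a) \<odot>\<^bsub>B\<^esub> y"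
  using i by (simp_all add: A.coord_add A.coord_smult distrib_left distrib_right B.smult_l_distr B.smult_r_distr
    mult.assoc flip: B.smult_assoc) (simp add: mult.commute)

lemma tcoord_closed [simp]: "x \<in> carrier T \<Longrightarrow> tcoord i x \<in> carrier B"
  unfolding tcoord_def by (rule tlift_closed[OF B.is_abelian_group tcoord_hyps])

lemma tcoord_add: "x \<in> carrier T \<Longrightarrow> y \<in> carrier T \<Longrightarrow> tcoord i (x \<oplus>\<^bsub>T\<^esub> y) = tcoord i x \<oplus>\<^bsub>B\<^esub> tcoord i y"
  unfolding tcoord_def by (rule tlift_add[OF B.is_abelian_group tcoord_hyps])

lemma tcoord_pt: "a \<in> carrier A \<Longrightarrow> y \<in> carrier B \<Longrightarrow> tcoord i (pt a y) = coord i a \<odot>\<^bsub>B\<^esub> y"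
  unfolding tcoord_def using tlift_pt[OF B.is_abelian_group tcoord_hyps, of a y] by simp

lemma tcoord_smult: "x \<in> carrier T \<Longrightarrow> tcoord i (c \<odot>\<^bsub>T\<^esub> x) = c \<odot>\<^bsub>B\<^esub> tcoord i x"
proof (induction x rule: T_induct)
  case (pure a y)
  then show ?case
    using i by (simp add: tcoord_pt A.coord_smult B.smult_assoc flip: pt_smult_l)
next
  case (add x y)
  then show ?case by (simp add: T.smult_r_distr tcoord_add B.smult_r_distr)
qed

lemma tcoord_finsum:
  assumes "\<And>j. j \<in> J \<Longrightarrow> f j \<in> carrier T"
  shows "tcoord i (\<Oplus>\<^bsub>T\<^esub>j\<in>J. f j) = (\<Oplus>\<^bsub>B\<^esub>j\<in>J. tcoord i (f j))"
proof -
  have "tcoord i \<zero>\<^bsub>T\<^esub> = \<zero>\<^bsub>B\<^esub>" using tcoord_smult[of "\<zero>\<^bsub>T\<^esub>" 0] by simp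
  then show ?thesis
    using additive_finsum[of T B "carrier T" "tcoord i" J f] assms
    by (simp add: B.abelian_monoid_axioms T.abelian_monoid_axioms tcoord_add)
qed

text \<open>Multiplication by \<open>1 \<otimes> z\<close> leaves the basis vectors of
  \<open>A\<close> alone and acts on the coordinates in \<open>B\<close>. Hence commuting with the
  image of \<open>B\<close> can be tested coordinatewise.\<close>

lemma tcoord_mult_r:
  assumes "x \<in> carrier T" "z \<in> carrier B"
  shows "tcoord i (x \<otimes>\<^bsub>T\<^esub> pt \<one>\<^bsub>A\<^esub> z) = tcoord i x \<otimes>\<^bsub>B\<^esub> z"
    and "tcoord i (pt \<one>\<^bsub>A\<^esub> z \<otimes>\<^bsub>T\<^esub> x) = z \<otimes>\<^bsub>B\<^esub> tcoord i x"
  using assms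
  by (induction x rule: T_induct)
    (simp_all add: pt_mult tcoord_pt B.smult_mult_l B.smult_mult_r T.l_distr T.r_distr tcoord_add B.l_distr B.r_distr)

end

lemma tcoord_expand:
  assumes "x \<in> carrier T" shows "(\<Oplus>\<^bsub>T\<^esub>i\<in>I. pt (b i) (tcoord i x)) = x"
  using assms
proof (induction x rule: T_induct)
  case (pure a y)
  have "(\<Oplus>\<^bsub>T\<^esub>i\<in>I. pt (b i) (tcoord i (pt a y))) = (\<Oplus>\<^bsub>T\<^esub>i\<in>I. pt (coord i a \<odot>\<^bsub>A\<^esub> b i) y)"
    using pure by (intro T.finsum_cong') (auto simp: tcoord_pt pt_smult_l pt_smult_r)
  also have "\<dots> = pt (\<Oplus>\<^bsub>A\<^esub>i\<in>I. coord i a \<odot>\<^bsub>A\<^esub> b i) y"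
    using pure by (intro pt_finsum_l[symmetric]) auto
  finally show ?case using pure by (simp add: A.expand)
next
  case (add x y)
  have "(\<Oplus>\<^bsub>T\<^esub>i\<in>I. pt (b i) (tcoord i (x \<oplus>\<^bsub>T\<^esub> y))) =
      (\<Oplus>\<^bsub>T\<^esub>i\<in>I. pt (b i) (tcoord i x) \<oplus>\<^bsub>T\<^esub> pt (b i) (tcoord i y))"
    using add by (intro T.finsum_cong') (auto simp: tcoord_add pt_add_r)
  also have "\<dots> = x \<oplus>\<^bsub>T\<^esub> y"
    using add by (subst T.finsum_addf) auto
  finally show ?case .
qed

lemma tcoord_eqI:
  assumes "x \<in> carrier T" "y \<in> carrier T" "\<And>i. i \<in> I \<Longrightarrow> tcoord i x = tcoord i y"
  shows "x = y"
proof -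
  have "(\<Oplus>\<^bsub>T\<^esub>i\<in>I. pt (b i) (tcoord i x)) = (\<Oplus>\<^bsub>T\<^esub>i\<in>I. pt (b i) (tcoord i y))"
    using assms by (intro T.finsum_cong') auto
  then show ?thesis using tcoord_expand assms by simp
qed

lemma tcoord_zero: "i \<in> I \<Longrightarrow> tcoord i \<zero>\<^bsub>T\<^esub> = \<zero>\<^bsub>B\<^esub>"
  using tcoord_smult[of i "\<zero>\<^bsub>T\<^esub>" 0] by simp

lemma based_space_tensor:
  fixes J :: "'j set"
  assumes "based_space B (carrier B) J b' coord'"
  shows "based_space T (carrier T) (I \<times> J) (\<lambda>(i, j). pt (b i) (b' j)) (\<lambda>(i, j) x. coord' j (tcoord i x))"
proof -
  interpret B: based_space B "carrier B" J b' coord' by fact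
  show ?thesis
  proof unfold_locales
    show "finite (I \<times> J)" by simp
    show "(\<Oplus>\<^bsub>T\<^esub>p\<in>I \<times> J. (case p of (i, j) \<Rightarrow> \<lambda>x. coord' j (tcoord i x)) x \<odot>\<^bsub>T\<^esub> (case p of (i, j) \<Rightarrow> pt (b i) (b' j))) = x"
      (is "?s = x") if "x \<in> carrier T" for x
    proof -
      have "?s = (\<Oplus>\<^bsub>T\<^esub>p\<in>Sigma I (\<lambda>_. J). pt (b (fst p)) (coord' (snd p) (tcoord (fst p) x) \<odot>\<^bsub>B\<^esub> b' (snd p)))"
        using that by (intro T.finsum_cong') (auto simp: pt_smult_r)
      also have "\<dots> = (\<Oplus>\<^bsub>T\<^esub>i\<in>I. \<Oplus>\<^bsub>T\<^esub>j\<in>J. pt (b i) (coord' j (tcoord i x) \<odot>\<^bsub>B\<^esub> b' j))"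
        using that by (intro T.finsum_Times) auto
      also have "\<dots> = (\<Oplus>\<^bsub>T\<^esub>i\<in>I. pt (b i) (\<Oplus>\<^bsub>B\<^esub>j\<in>J. coord' j (tcoord i x) \<odot>\<^bsub>B\<^esub> b' j))"
        using that by (intro T.finsum_cong') (auto simp: pt_finsum_r)
      also have "\<dots> = (\<Oplus>\<^bsub>T\<^esub>i\<in>I. pt (b i) (tcoord i x))"
        using that by (intro T.finsum_cong') (auto simp: B.expand)
      finally show ?thesis using tcoord_expand that by simp
    qed
  qed (auto simp: tcoord_add tcoord_smult B.coord_add B.coord_smult tcoord_pt A.coord_b B.coord_b B.coord_zero
      split: if_splits)
qed

section \<open>Simplicity and centre of the tensor product\<close>

definition left_independent :: "'s set \<Rightarrow> ('s \<Rightarrow> 'b) \<Rightarrow> bool"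
  where "left_independent S y \<longleftrightarrow>
    (\<forall>c. (\<Oplus>\<^bsub>B\<^esub>k\<in>S. c k \<odot>\<^bsub>B\<^esub> y k) = \<zero>\<^bsub>B\<^esub> \<longrightarrow> (\<forall>k\<in>S. c k = 0))"

text \<open>Applying \<open>tcoord i\<close> gives a linear relation among the \<open>y k\<close>
  with coefficients \<open>coord i (a k)\<close>; independence makes all these coordinates
  vanish.\<close>

lemma tensor_sum_eq_zero:
  assumes y: "left_independent S y" "\<And>k. k \<in> S \<Longrightarrow> y k \<in> carrier B" and a: "\<And>k. k \<in> S \<Longrightarrow> a k \<in> carrier A"
    and z: "(\<Oplus>\<^bsub>T\<^esub>k\<in>S. pt (a k) (y k)) = \<zero>\<^bsub>T\<^esub>" and k: "k \<in> S"
  shows "a k = \<zero>\<^bsub>A\<^esub>"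
proof (rule A.coord_eqI)
  fix i assume i: "i \<in> I"
  have "(\<Oplus>\<^bsub>B\<^esub>k\<in>S. coord i (a k) \<odot>\<^bsub>B\<^esub> y k) = (\<Oplus>\<^bsub>B\<^esub>k\<in>S. tcoord i (pt (a k) (y k)))"
    using a y i by (intro B.finsum_cong') (auto simp: tcoord_pt)
  also have "\<dots> = tcoord i (\<Oplus>\<^bsub>T\<^esub>k\<in>S. pt (a k) (y k))"
    using a y i by (intro tcoord_finsum[symmetric]) auto
  also have "\<dots> = \<zero>\<^bsub>B\<^esub>" using i by (simp add: z tcoord_zero)
  finally show "coord i (a k) = coord i \<zero>\<^bsub>A\<^esub>"
    using y(1) k i by (auto simp: left_independent_def A.coord_zero)
qed (use a k in auto)

lemma T_one_neq_zero:
  assumes "\<one>\<^bsub>A\<^esub> \<noteq> \<zero>\<^bsub>A\<^esub>" "\<one>\<^bsub>B\<^esub> \<noteq> \<zero>\<^bsub>B\<^esub>"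
  shows "\<one>\<^bsub>T\<^esub> \<noteq> \<zero>\<^bsub>T\<^esub>"
proof
  assume "\<one>\<^bsub>T\<^esub> = \<zero>\<^bsub>T\<^esub>"
  then have "(\<Oplus>\<^bsub>T\<^esub>k\<in>{()}. pt \<one>\<^bsub>A\<^esub> \<one>\<^bsub>B\<^esub>) = \<zero>\<^bsub>T\<^esub>" by (simp add: pt_one)
  moreover have "left_independent {()} (\<lambda>_. \<one>\<^bsub>B\<^esub>)"
    using assms(2) B.smult_eq_zero[of "\<one>\<^bsub>B\<^esub>"] by (auto simp: left_independent_def)
  ultimately show False using tensor_sum_eq_zero[of "{()}" "\<lambda>_. \<one>\<^bsub>B\<^esub>" "\<lambda>_. \<one>\<^bsub>A\<^esub>" "()"] assms by auto
qed

text \<open>Among the nonzero elements of \<open>J\<close>, take a sum of pure tensors \<open>a\<^sub>k \<otimes> y\<^sub>k\<close> with a minimal number of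
  terms. Then the \<open>y\<^sub>k\<close> are independent, and one may assume that some \<open>a\<^sub>s\<close> is \<open>1\<close>. Commutators with
  elements of \<open>A\<close> have fewer terms, hence vanish, so all \<open>a\<^sub>k\<close> are scalars and the sum is \<open>1 \<otimes> z\<close>.\<close>

lemma T_simple:
  assumes A: "\<one>\<^bsub>A\<^esub> \<noteq> \<zero>\<^bsub>A\<^esub>" "center A = scalars A" "\<And>Q. ideal Q A \<Longrightarrow> Q = {\<zero>\<^bsub>A\<^esub>} \<or> Q = carrier A"
    and B: "\<And>Q. ideal Q B \<Longrightarrow> Q = {\<zero>\<^bsub>B\<^esub>} \<or> Q = carrier B"
    and J: "ideal J T"
  shows "J = {\<zero>\<^bsub>T\<^esub>} \<or> J = carrier T"
proof (cases "J = {\<zero>\<^bsub>T\<^esub>}")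
  case False
  interpret J: ideal J T by (rule J)
  define tsum where "tsum S a y = (\<Oplus>\<^bsub>T\<^esub>k\<in>S. pt (a k) (y k))" for S :: "'i set" and a y
  define R where "R S a y \<longleftrightarrow> S \<subseteq> I \<and> a \<in> S \<rightarrow> carrier A \<and> y \<in> S \<rightarrow> carrier B \<and>
    tsum S a y \<in> J \<and> tsum S a y \<noteq> \<zero>\<^bsub>T\<^esub>" for S a y
  have tsum_drop: "tsum S a y = tsum (S - {s}) a y"
    if "S \<subseteq> I" "a \<in> S \<rightarrow> carrier A" "y \<in> S \<rightarrow> carrier B" "s \<in> S" "a s = \<zero>\<^bsub>A\<^esub>" for S a y s
  proof -
    have f: "finite S" using that(1) finite_subset A.finite_I by blast
    have "tsum (insert s (S - {s})) a y = pt (a s) (y s) \<oplus>\<^bsub>T\<^esub> tsum (S - {s}) a y"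
      unfolding tsum_def by (subst T.finsum_insert) (use that f in auto)
    moreover have "insert s (S - {s}) = S" "tsum (S - {s}) a y \<in> carrier T" "y s \<in> carrier B"
      using that unfolding tsum_def by (auto intro!: T.finsum_closed)
    ultimately show ?thesis using that by (simp add: pt_zero_l)
  qed
  have "\<exists>x\<in>J. x \<noteq> \<zero>\<^bsub>T\<^esub>" using False J.zero_closed by auto
  then obtain x where x: "x \<in> J" "x \<noteq> \<zero>\<^bsub>T\<^esub>" by blast
  then have xT: "x \<in> carrier T" using J.a_subset by auto
  have "R I b (\<lambda>i. tcoord i x)" using x xT by (auto simp: R_def tsum_def tcoord_expand)
  then have "\<exists>S a y. R S a y" by blast
  then obtain S where "\<exists>a y. R S a y" and min: "\<And>S' a y. R S' a y \<Longrightarrow> card S \<le> card S'"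
    using ex_has_least_nat[of "\<lambda>S. \<exists>a y. R S a y" _ card] by blast
  then obtain a y where R: "R S a y" by blast
  then have S: "S \<subseteq> I" "finite S" and y: "\<And>k. k \<in> S \<Longrightarrow> y k \<in> carrier B"
    and a: "\<And>k. k \<in> S \<Longrightarrow> a k \<in> carrier A"
    unfolding R_def using finite_subset[of S I] by auto
  have drop: "tsum S a' y = \<zero>\<^bsub>T\<^esub>"
    if "a' \<in> S \<rightarrow> carrier A" "tsum S a' y \<in> J" "s \<in> S" "a' s = \<zero>\<^bsub>A\<^esub>" for a' s
  proof (rule ccontr)
    assume n: "tsum S a' y \<noteq> \<zero>\<^bsub>T\<^esub>"
    have "tsum S a' y = tsum (S - {s}) a' y" using that S y by (intro tsum_drop) auto
    then have "R (S - {s}) a' y" using that n S y by (auto simp: R_def)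
    from min[OF this] show False using S(2) that(3) by (meson card_Diff1_less leD)
  qed
  have ind: "left_independent S y"
    unfolding left_independent_def
  proof (intro allI impI ballI, rule ccontr)
    fix c s assume c: "(\<Oplus>\<^bsub>B\<^esub>k\<in>S. c k \<odot>\<^bsub>B\<^esub> y k) = \<zero>\<^bsub>B\<^esub>" and s: "s \<in> S" "c s \<noteq> 0"
    \<comment> \<open>The relation is normalised to the coefficient \<open>- 1\<close> at
      \<open>s\<close>. Adding \<open>a s\<close> tensored with this vanishing combination does not
      change the sum, but it cancels the term at \<open>s\<close>.\<close>
    define d where "d k = - (c k / c s)" for k
    define a' where "a' k = a k \<oplus>\<^bsub>A\<^esub> d k \<odot>\<^bsub>A\<^esub> a s" for k
    have a': "a' \<in> S \<rightarrow> carrier A" using a s by (auto simp: a'_def)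
    have "(\<Oplus>\<^bsub>B\<^esub>k\<in>S. d k \<odot>\<^bsub>B\<^esub> y k) = (\<Oplus>\<^bsub>B\<^esub>k\<in>S. (- inverse (c s)) \<odot>\<^bsub>B\<^esub> (c k \<odot>\<^bsub>B\<^esub> y k))"
      using y by (intro B.finsum_cong') (auto simp: d_def divide_inverse mult.commute simp flip: B.smult_assoc)
    also have "\<dots> = (- inverse (c s)) \<odot>\<^bsub>B\<^esub> (\<Oplus>\<^bsub>B\<^esub>k\<in>S. c k \<odot>\<^bsub>B\<^esub> y k)"
      using y by (intro B.smult_finsum[symmetric]) auto
    finally have 0: "(\<Oplus>\<^bsub>B\<^esub>k\<in>S. d k \<odot>\<^bsub>B\<^esub> y k) = \<zero>\<^bsub>B\<^esub>" by (simp add: c)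
    have "tsum S a' y = (\<Oplus>\<^bsub>T\<^esub>k\<in>S. pt (a k) (y k) \<oplus>\<^bsub>T\<^esub> pt (a s) (d k \<odot>\<^bsub>B\<^esub> y k))"
      unfolding tsum_def using a y s
      by (intro T.finsum_cong') (auto simp: a'_def pt_add_l pt_smult_l pt_smult_r)
    also have "\<dots> = tsum S a y \<oplus>\<^bsub>T\<^esub> (\<Oplus>\<^bsub>T\<^esub>k\<in>S. pt (a s) (d k \<odot>\<^bsub>B\<^esub> y k))"
      unfolding tsum_def using a y s by (intro T.finsum_addf) auto
    also have "(\<Oplus>\<^bsub>T\<^esub>k\<in>S. pt (a s) (d k \<odot>\<^bsub>B\<^esub> y k)) = pt (a s) (\<Oplus>\<^bsub>B\<^esub>k\<in>S. d k \<odot>\<^bsub>B\<^esub> y k)"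
      using a y s by (intro pt_finsum_r[symmetric]) auto
    also have "\<dots> = \<zero>\<^bsub>T\<^esub>" using a s by (simp add: 0 pt_zero_r)
    finally have e: "tsum S a' y = tsum S a y"
      using R J.a_subset by (auto simp: R_def)
    have "d s = - 1" using s by (simp add: d_def)
    then have "a' s = \<zero>\<^bsub>A\<^esub>" using a s by (simp add: a'_def A.smult_minus_l A.r_neg)
    from drop[OF a' _ s(1) this] R show False by (simp add: e R_def)
  qed
  have "S \<noteq> {}" using R by (auto simp: R_def tsum_def)
  then obtain s where s: "s \<in> S" by blast
  \<comment> \<open>With the \<open>y k\<close> fixed, the coefficients that occur at
    \<open>s\<close> in elements of \<open>J\<close> form a two-sided ideal of \<open>A\<close>. It
    contains the nonzero \<open>a s\<close>, hence the unit, which justifies the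
    normalisation.\<close>
  define Q where "Q = {p. \<exists>a'. a' \<in> S \<rightarrow> carrier A \<and> tsum S a' y \<in> J \<and> a' s = p}"
  have tsum_add: "tsum S (\<lambda>k. a1 k \<oplus>\<^bsub>A\<^esub> a2 k) y = tsum S a1 y \<oplus>\<^bsub>T\<^esub> tsum S a2 y"
    if "a1 \<in> S \<rightarrow> carrier A" "a2 \<in> S \<rightarrow> carrier A" for a1 a2
  proof -
    have "tsum S (\<lambda>k. a1 k \<oplus>\<^bsub>A\<^esub> a2 k) y = (\<Oplus>\<^bsub>T\<^esub>k\<in>S. pt (a1 k) (y k) \<oplus>\<^bsub>T\<^esub> pt (a2 k) (y k))"
      unfolding tsum_def using that y by (intro T.finsum_cong') (auto simp: pt_add_l Pi_iff)
    also have "\<dots> = tsum S a1 y \<oplus>\<^bsub>T\<^esub> tsum S a2 y"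
      unfolding tsum_def using that y by (intro T.finsum_addf) auto
    finally show ?thesis .
  qed
  have tsum_l: "tsum S (\<lambda>k. p \<otimes>\<^bsub>A\<^esub> a1 k) y = pt p \<one>\<^bsub>B\<^esub> \<otimes>\<^bsub>T\<^esub> tsum S a1 y"
    and tsum_r: "tsum S (\<lambda>k. a1 k \<otimes>\<^bsub>A\<^esub> p) y = tsum S a1 y \<otimes>\<^bsub>T\<^esub> pt p \<one>\<^bsub>B\<^esub>"
    if "a1 \<in> S \<rightarrow> carrier A" "p \<in> carrier A" for a1 p
  proof -
    have "tsum S (\<lambda>k. p \<otimes>\<^bsub>A\<^esub> a1 k) y = (\<Oplus>\<^bsub>T\<^esub>k\<in>S. pt p \<one>\<^bsub>B\<^esub> \<otimes>\<^bsub>T\<^esub> pt (a1 k) (y k))"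
      unfolding tsum_def using that y by (intro T.finsum_cong') (auto simp: pt_mult Pi_iff)
    also have "\<dots> = pt p \<one>\<^bsub>B\<^esub> \<otimes>\<^bsub>T\<^esub> tsum S a1 y"
      unfolding tsum_def using that y S by (intro T.finsum_rdistr[symmetric]) auto
    finally show "tsum S (\<lambda>k. p \<otimes>\<^bsub>A\<^esub> a1 k) y = pt p \<one>\<^bsub>B\<^esub> \<otimes>\<^bsub>T\<^esub> tsum S a1 y" .
    have "tsum S (\<lambda>k. a1 k \<otimes>\<^bsub>A\<^esub> p) y = (\<Oplus>\<^bsub>T\<^esub>k\<in>S. pt (a1 k) (y k) \<otimes>\<^bsub>T\<^esub> pt p \<one>\<^bsub>B\<^esub>)"
      unfolding tsum_def using that y by (intro T.finsum_cong') (auto simp: pt_mult Pi_iff)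
    also have "\<dots> = tsum S a1 y \<otimes>\<^bsub>T\<^esub> pt p \<one>\<^bsub>B\<^esub>"
      unfolding tsum_def using that y S by (intro T.finsum_ldistr[symmetric]) auto
    finally show "tsum S (\<lambda>k. a1 k \<otimes>\<^bsub>A\<^esub> p) y = tsum S a1 y \<otimes>\<^bsub>T\<^esub> pt p \<one>\<^bsub>B\<^esub>" .
  qed
  have Ql: "p \<otimes>\<^bsub>A\<^esub> q \<in> Q" and Qr: "q \<otimes>\<^bsub>A\<^esub> p \<in> Q" if pq: "q \<in> Q" "p \<in> carrier A" for p q
  proof -
    obtain a1 where a1: "a1 \<in> S \<rightarrow> carrier A" "tsum S a1 y \<in> J" "a1 s = q" using pq by (auto simp: Q_def)
    show "p \<otimes>\<^bsub>A\<^esub> q \<in> Q"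
      unfolding Q_def using a1 pq J.I_l_closed
      by (intro CollectI exI[of _ "\<lambda>k. p \<otimes>\<^bsub>A\<^esub> a1 k"]) (auto simp: tsum_l)
    show "q \<otimes>\<^bsub>A\<^esub> p \<in> Q"
      unfolding Q_def using a1 pq J.I_r_closed
      by (intro CollectI exI[of _ "\<lambda>k. a1 k \<otimes>\<^bsub>A\<^esub> p"]) (auto simp: tsum_r)
  qed
  have "a s \<in> Q" unfolding Q_def using a R by (intro CollectI exI[of _ a]) (auto simp: R_def)
  have Q_sub: "q \<in> carrier A" if "q \<in> Q" for q using that s by (auto simp: Q_def)
  have "ideal Q A"
  proof (rule idealI[OF A.ring_axioms])
    show "subgroup Q (add_monoid A)"
    proof (rule A.add.subgroupI)
      show "Q \<subseteq> carrier A" using Q_sub by auto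
      show "Q \<noteq> {}" using \<open>a s \<in> Q\<close> by auto
      show "\<ominus>\<^bsub>A\<^esub> q \<in> Q" if "q \<in> Q" for q
        using Ql[OF that, of "\<ominus>\<^bsub>A\<^esub> \<one>\<^bsub>A\<^esub>"] Q_sub[OF that] by (simp add: A.l_minus)
      show "q \<oplus>\<^bsub>A\<^esub> q' \<in> Q" if "q \<in> Q" "q' \<in> Q" for q q'
      proof -
        obtain a1 a2 where a1: "a1 \<in> S \<rightarrow> carrier A" "tsum S a1 y \<in> J" "a1 s = q"
          and a2: "a2 \<in> S \<rightarrow> carrier A" "tsum S a2 y \<in> J" "a2 s = q'" using \<open>q \<in> Q\<close> \<open>q' \<in> Q\<close> by (auto simp: Q_def)
        show "q \<oplus>\<^bsub>A\<^esub> q' \<in> Q"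
          unfolding Q_def using a1 a2
          by (intro CollectI exI[of _ "\<lambda>k. a1 k \<oplus>\<^bsub>A\<^esub> a2 k"]) (auto simp: tsum_add)
      qed
    qed
  qed (use Ql Qr in auto)
  moreover have "a s \<noteq> \<zero>\<^bsub>A\<^esub>" using drop[of a s] R s by (auto simp: R_def)
  ultimately have "\<one>\<^bsub>A\<^esub> \<in> Q" using A(3)[of Q] \<open>a s \<in> Q\<close> by auto
  then obtain a1 where a1: "a1 \<in> S \<rightarrow> carrier A" "tsum S a1 y \<in> J" "a1 s = \<one>\<^bsub>A\<^esub>"
    by (auto simp: Q_def)
  have "a1 k \<in> scalars A" if k: "k \<in> S" for k
    unfolding A(2)[symmetric] center_def
  proof (safe)
    show a1k: "a1 k \<in> carrier A" using a1 k by auto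
    fix p assume p: "p \<in> carrier A"
    let ?a = "\<lambda>k. p \<otimes>\<^bsub>A\<^esub> a1 k \<oplus>\<^bsub>A\<^esub> a1 k \<otimes>\<^bsub>A\<^esub> (\<ominus>\<^bsub>A\<^esub> p)"
    have "tsum S ?a y = pt p \<one>\<^bsub>B\<^esub> \<otimes>\<^bsub>T\<^esub> tsum S a1 y \<oplus>\<^bsub>T\<^esub> tsum S a1 y \<otimes>\<^bsub>T\<^esub> pt (\<ominus>\<^bsub>A\<^esub> p) \<one>\<^bsub>B\<^esub>"
      using a1 p by (subst tsum_add) (auto simp: tsum_l tsum_r)
    also have "\<dots> \<in> J" using J.I_l_closed J.I_r_closed a1 p by auto
    finally have "tsum S ?a y = \<zero>\<^bsub>T\<^esub>"
      using s a1 p by (intro drop[of ?a s]) (auto simp: A.r_neg)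
    then have "?a k = \<zero>\<^bsub>A\<^esub>"
      using ind y a1 p k unfolding tsum_def by (intro tensor_sum_eq_zero[of S y ?a k]) (auto simp: Pi_iff)
    then have "p \<otimes>\<^bsub>A\<^esub> a1 k \<oplus>\<^bsub>A\<^esub> \<ominus>\<^bsub>A\<^esub> (a1 k \<otimes>\<^bsub>A\<^esub> p) = \<zero>\<^bsub>A\<^esub>" using a1k p by (simp add: A.r_minus)
    then show "a1 k \<otimes>\<^bsub>A\<^esub> p = p \<otimes>\<^bsub>A\<^esub> a1 k" using a1k p
      by (metis A.minus_equality A.minus_minus A.m_closed A.a_inv_closed)
  qed
  then have "\<forall>k\<in>S. \<exists>c. a1 k = c \<odot>\<^bsub>A\<^esub> \<one>\<^bsub>A\<^esub>" by (auto simp: scalars_def)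
  then obtain c where c: "\<And>k. k \<in> S \<Longrightarrow> a1 k = c k \<odot>\<^bsub>A\<^esub> \<one>\<^bsub>A\<^esub>" by metis
  define z where "z = (\<Oplus>\<^bsub>B\<^esub>k\<in>S. c k \<odot>\<^bsub>B\<^esub> y k)"
  have z: "z \<in> carrier B" unfolding z_def using y by (intro B.finsum_closed) auto
  have "tsum S a1 y = (\<Oplus>\<^bsub>T\<^esub>k\<in>S. pt \<one>\<^bsub>A\<^esub> (c k \<odot>\<^bsub>B\<^esub> y k))"
    unfolding tsum_def using y by (intro T.finsum_cong') (auto simp: c pt_smult_l pt_smult_r)
  also have "\<dots> = pt \<one>\<^bsub>A\<^esub> z" unfolding z_def using y by (intro pt_finsum_r[symmetric]) auto
  finally have zJ: "pt \<one>\<^bsub>A\<^esub> z \<in> J" using a1 by simp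
  have "z \<noteq> \<zero>\<^bsub>B\<^esub>"
  proof
    assume "z = \<zero>\<^bsub>B\<^esub>"
    then have "c s = 0" using ind s by (auto simp: left_independent_def z_def)
    then show False using c[OF s] a1(3) A(1) by simp
  qed
  \<comment> \<open>\<open>J\<close> now contains \<open>1 \<otimes> z\<close> with nonzero
    \<open>z\<close>; simplicity of \<open>B\<close> replaces \<open>z\<close> by the unit.\<close>
  have "ideal {q \<in> carrier B. pt \<one>\<^bsub>A\<^esub> q \<in> J} B"
  proof (rule idealI[OF B.ring_axioms])
    have l: "pt \<one>\<^bsub>A\<^esub> (p \<otimes>\<^bsub>B\<^esub> q) \<in> J" if "q \<in> carrier B" "pt \<one>\<^bsub>A\<^esub> q \<in> J" "p \<in> carrier B" for p q
      using that J.I_l_closed[of "pt \<one>\<^bsub>A\<^esub> q" "pt \<one>\<^bsub>A\<^esub> p"] by (simp add: pt_mult)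
    have r: "pt \<one>\<^bsub>A\<^esub> (q \<otimes>\<^bsub>B\<^esub> p) \<in> J" if "q \<in> carrier B" "pt \<one>\<^bsub>A\<^esub> q \<in> J" "p \<in> carrier B" for p q
      using that J.I_r_closed[of "pt \<one>\<^bsub>A\<^esub> q" "pt \<one>\<^bsub>A\<^esub> p"] by (simp add: pt_mult)
    show "subgroup {q \<in> carrier B. pt \<one>\<^bsub>A\<^esub> q \<in> J} (add_monoid B)"
    proof (rule B.add.subgroupI)
      show "\<ominus>\<^bsub>B\<^esub> q \<in> {q \<in> carrier B. pt \<one>\<^bsub>A\<^esub> q \<in> J}" if "q \<in> {q \<in> carrier B. pt \<one>\<^bsub>A\<^esub> q \<in> J}" for q
        using l[of q "\<ominus>\<^bsub>B\<^esub> \<one>\<^bsub>B\<^esub>"] that by (simp add: B.l_minus)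
    qed (use z zJ in \<open>auto simp: pt_add_r\<close>)
    show "\<And>q p. q \<in> {q \<in> carrier B. pt \<one>\<^bsub>A\<^esub> q \<in> J} \<Longrightarrow> p \<in> carrier B \<Longrightarrow> p \<otimes>\<^bsub>B\<^esub> q \<in> {q \<in> carrier B. pt \<one>\<^bsub>A\<^esub> q \<in> J}"
      using l by auto
    show "\<And>q p. q \<in> {q \<in> carrier B. pt \<one>\<^bsub>A\<^esub> q \<in> J} \<Longrightarrow> p \<in> carrier B \<Longrightarrow> q \<otimes>\<^bsub>B\<^esub> p \<in> {q \<in> carrier B. pt \<one>\<^bsub>A\<^esub> q \<in> J}"
      using r by auto
  qed
  from B[OF this] have "pt \<one>\<^bsub>A\<^esub> \<one>\<^bsub>B\<^esub> \<in> J" using z zJ \<open>z \<noteq> \<zero>\<^bsub>B\<^esub>\<close> by auto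
  then show ?thesis using J.one_imp_carrier by (simp add: pt_one)
qed simp

text \<open>A central \<open>x\<close> commutes with every \<open>1 \<otimes> z\<close>, so its
  coordinates are central in \<open>B\<close>, that is, scalars; hence
  \<open>x = a \<otimes> 1\<close>. As \<open>p \<mapsto> p \<otimes> 1\<close> is injective,
  \<open>a\<close> is central in \<open>A\<close>.\<close>

lemma T_central:
  assumes one: "\<one>\<^bsub>B\<^esub> \<noteq> \<zero>\<^bsub>B\<^esub>" and cA: "center A = scalars A" and cB: "center B = scalars B"
  shows "center T = scalars T"
proof (intro equalityI subsetI)
  fix x assume "x \<in> scalars T"
  then show "x \<in> center T"
    by (auto simp: scalars_def center_def T.smult_mult_l T.smult_mult_r)
next
  fix x assume x: "x \<in> center T"
  then have xT: "x \<in> carrier T" by (simp add: center_def)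
  have "tcoord i x \<in> scalars B" if "i \<in> I" for i
    unfolding cB[symmetric] center_def
  proof (safe)
    show "tcoord i x \<in> carrier B" using that xT by simp
    fix z assume "z \<in> carrier B"
    then show "tcoord i x \<otimes>\<^bsub>B\<^esub> z = z \<otimes>\<^bsub>B\<^esub> tcoord i x"
      using tcoord_mult_r[OF that xT, of z] x by (auto simp: center_def)
  qed
  then have "\<forall>i\<in>I. \<exists>c. tcoord i x = c \<odot>\<^bsub>B\<^esub> \<one>\<^bsub>B\<^esub>" by (auto simp: scalars_def)
  then obtain c where c: "\<And>i. i \<in> I \<Longrightarrow> tcoord i x = c i \<odot>\<^bsub>B\<^esub> \<one>\<^bsub>B\<^esub>" by metis
  define a where "a = (\<Oplus>\<^bsub>A\<^esub>i\<in>I. c i \<odot>\<^bsub>A\<^esub> b i)"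
  have a: "a \<in> carrier A" unfolding a_def by (intro A.finsum_closed) auto
  have "x = (\<Oplus>\<^bsub>T\<^esub>i\<in>I. pt (b i) (tcoord i x))" using tcoord_expand[OF xT] by simp
  also have "\<dots> = (\<Oplus>\<^bsub>T\<^esub>i\<in>I. pt (c i \<odot>\<^bsub>A\<^esub> b i) \<one>\<^bsub>B\<^esub>)"
    by (intro T.finsum_cong') (auto simp: c pt_smult_l pt_smult_r)
  also have "\<dots> = pt a \<one>\<^bsub>B\<^esub>" unfolding a_def by (intro pt_finsum_l[symmetric]) auto
  finally have xa: "x = pt a \<one>\<^bsub>B\<^esub>" .
  have inj: "p = q" if "pt p \<one>\<^bsub>B\<^esub> = pt q \<one>\<^bsub>B\<^esub>" "p \<in> carrier A" "q \<in> carrier A" for p q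
  proof (rule A.coord_eqI)
    fix i assume i: "i \<in> I"
    then have "coord i p \<odot>\<^bsub>B\<^esub> \<one>\<^bsub>B\<^esub> = coord i q \<odot>\<^bsub>B\<^esub> \<one>\<^bsub>B\<^esub>"
      using that tcoord_pt[OF i, of p "\<one>\<^bsub>B\<^esub>"] tcoord_pt[OF i, of q "\<one>\<^bsub>B\<^esub>"] by simp
    then show "coord i p = coord i q" using B.smult_one_inj[OF one] by blast
  qed (use that in auto)
  have "a \<in> center A"
    unfolding center_def
  proof (safe)
    fix p assume p: "p \<in> carrier A"
    have "x \<otimes>\<^bsub>T\<^esub> pt p \<one>\<^bsub>B\<^esub> = pt p \<one>\<^bsub>B\<^esub> \<otimes>\<^bsub>T\<^esub> x" using x p by (auto simp: center_def)
    then show "a \<otimes>\<^bsub>A\<^esub> p = p \<otimes>\<^bsub>A\<^esub> a"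
      using a p by (intro inj) (simp_all add: xa pt_mult)
  qed (rule a)
  then obtain d where "a = d \<odot>\<^bsub>A\<^esub> \<one>\<^bsub>A\<^esub>" unfolding cA by (auto simp: scalars_def)
  then have "x = d \<odot>\<^bsub>T\<^esub> \<one>\<^bsub>T\<^esub>" by (simp add: xa pt_smult_l pt_one)
  then show "x \<in> scalars T" by (auto simp: scalars_def)
qed

end

section \<open>Simple algebras over an algebraically closed field\<close>

lemma ex_eigenvector:
  fixes M :: "'l::alg_closed_field mat"
  assumes M: "M \<in> carrier_mat n n" and "n > 0"
  obtains u k where "u \<in> carrier_vec n" "u \<noteq> 0\<^sub>v n" "M *\<^sub>v u = k \<cdot>\<^sub>v u"
proof -
  have "degree (char_poly M) > 0" using degree_monic_char_poly[OF M] assms by simp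
  then obtain k where "poly (char_poly M) k = 0" using alg_closed_imp_poly_has_root by blast
  then have "eigenvalue M k" using eigenvalue_root_char_poly[OF M] by simp
  then show thesis using that M by (auto simp: eigenvalue_def eigenvector_def)
qed

context algebra_over
begin

definition left_ideal :: "'a set \<Rightarrow> bool"
  where "left_ideal V \<longleftrightarrow> V \<subseteq> carrier A \<and> \<zero> \<in> V \<and> (\<forall>x\<in>V. \<forall>y\<in>V. x \<oplus> y \<in> V) \<and>
    (\<forall>c\<in>carrier A. \<forall>x\<in>V. c \<otimes> x \<in> V)"

text \<open>Negatives and scalar multiples arise from left multiplication by \<open>- 1\<close> and
  by \<open>c \<odot> \<one>\<close>. In this form left ideals are accessible to dimension
  theory.\<close>

lemma left_ideal_subalgebra:
  assumes "left_ideal V" shows "subalgebra (scalars A) V A"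
proof (intro subalgebra.intro subalgebra_axioms.intro add.subgroupI)
  show "\<ominus> x \<in> V" if "x \<in> V" for x
  proof -
    have "(\<ominus> \<one>) \<otimes> x \<in> V" using assms that by (auto simp: left_ideal_def)
    then show ?thesis using assms that by (auto simp: left_ideal_def l_minus subset_iff)
  qed
qed (use assms in \<open>auto simp: left_ideal_def scalars_def\<close>)

text \<open>Take a nonzero left ideal \<open>V\<close> of least dimension. A basis of a nonzero left
  ideal \<open>W\<close> inside \<open>V\<close> extends to a basis of \<open>V\<close>, and by
  minimality no vector is added.\<close>

lemma ex_minimal_left_ideal:
  assumes one: "\<one> \<noteq> \<zero>" and fd: "finite_dimension (scalars A) (carrier A)"
  obtains V where "left_ideal V" "V \<noteq> {\<zero>}"
    "\<And>W. left_ideal W \<Longrightarrow> W \<subseteq> V \<Longrightarrow> W \<noteq> {\<zero>} \<Longrightarrow> W = V"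
proof -
  note K = scalars_subfield[OF one]
  have fdV: "finite_dimension (scalars A) V" if "left_ideal V" for V
    using subalbegra_incl_imp_finite_dimension[OF K fd left_ideal_subalgebra[OF that]] that
    by (auto simp: left_ideal_def)
  have "left_ideal (carrier A) \<and> carrier A \<noteq> {\<zero>}" using one by (auto simp: left_ideal_def)
  then obtain V where V: "left_ideal V" "V \<noteq> {\<zero>}"
    and min: "\<And>W. left_ideal W \<Longrightarrow> W \<noteq> {\<zero>} \<Longrightarrow> (dim over scalars A) V \<le> (dim over scalars A) W"
    using ex_has_least_nat[of "\<lambda>V. left_ideal V \<and> V \<noteq> {\<zero>}" _ "dim over scalars A"] by blast
  have "W = V" if W: "left_ideal W" "W \<subseteq> V" "W \<noteq> {\<zero>}" for W
  proof -
    define n m where "n = (dim over scalars A) V" and "m = (dim over scalars A) W"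
    have dV: "dimension n (scalars A) V" and dW: "dimension m (scalars A) W"
      unfolding n_def m_def using finite_dimensionE[OF K fdV] V W by auto
    have "n \<le> m" unfolding n_def m_def using min W by auto
    obtain Us where Us: "set Us \<subseteq> carrier A" "independent (scalars A) Us" "length Us = m" "Span (scalars A) Us = W"
      using exists_base[OF K dW] by blast
    have "set Us \<subseteq> W" using Span_base_incl[OF K Us(1)] Us by auto
    then obtain Vs where Vs: "length (Vs @ Us) = n" "Span (scalars A) (Vs @ Us) = V"
      using complete_base[OF K dV Us(2)] W(2) by auto
    then have "length Vs + m = n" using Us(3) by simp
    then have "length Vs = 0" using \<open>n \<le> m\<close> by linarith
    then have "Vs = []" by simp
    then show "W = V" using Vs Us by simp
  qed
  with V that show thesis by blast
qed

end

text \<open>\<open>A\<close> acts by left multiplication on a minimal left ideal \<open>V\<close>.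
  This action is faithful and reaches every endomorphism of \<open>V\<close>, so the matrices of the
  left multiplications in a basis of \<open>V\<close> give the isomorphism. Eigenvectors replace
  Schur's lemma and the division algebra of endomorphisms.\<close>

theorem wedderburn_alg_closed:
  fixes A :: "('l::alg_closed_field, 'a) module"
  assumes "based_space A (carrier A) I b coord" and one: "\<one>\<^bsub>A\<^esub> \<noteq> \<zero>\<^bsub>A\<^esub>"
    and simple: "\<And>J. ideal J A \<Longrightarrow> J = {\<zero>\<^bsub>A\<^esub>} \<or> J = carrier A"
  obtains n h where "h \<in> ring_iso A (ring_mat TYPE('l) n ())" "\<And>l. h (l \<odot>\<^bsub>A\<^esub> \<one>\<^bsub>A\<^esub>) = l \<cdot>\<^sub>m 1\<^sub>m n"
proof -
  interpret A: based_space A "carrier A" I b coord by fact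
  obtain V where V: "A.left_ideal V" "V \<noteq> {\<zero>\<^bsub>A\<^esub>}"
    and min: "\<And>W. A.left_ideal W \<Longrightarrow> W \<subseteq> V \<Longrightarrow> W \<noteq> {\<zero>\<^bsub>A\<^esub>} \<Longrightarrow> W = V"
    using A.ex_minimal_left_ideal[OF one A.finite_dimension[OF one refl]] by blast
  have sub: "x \<in> carrier A" if "x \<in> V" for x using V that by (auto simp: A.left_ideal_def)
  have lmult: "c \<otimes>\<^bsub>A\<^esub> x \<in> V" if "c \<in> carrier A" "x \<in> V" for c x
    using V that by (auto simp: A.left_ideal_def)
  have "A.finite_dimension (scalars A) V"
    using A.subalbegra_incl_imp_finite_dimension[OF A.scalars_subfield[OF one] A.finite_dimension[OF one refl]
      A.left_ideal_subalgebra[OF V(1)]] sub by auto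
  then obtain n where "A.dimension n (scalars A) V" by (auto simp: A.finite_dimension_def)
  then obtain v cv where "based_space A V {..<n} v cv"
    using A.based_space_of_dimension[OF one] by blast
  then interpret V: based_space A V "{..<n}" v cv .
  obtain e where e: "e \<in> V" "e \<noteq> \<zero>\<^bsub>A\<^esub>" using V by (auto simp: A.left_ideal_def)
  note eA = sub[OF e(1)]
  have "n > 0"
  proof (rule ccontr)
    assume "\<not> n > 0"
    then show False using V.expand[OF e(1)] e(2) by simp
  qed

  text \<open>Every \<open>e c e\<close> is a scalar multiple of \<open>e\<close>: right multiplication by \<open>c e\<close> has an eigenvector
    in \<open>V\<close>, and the eigenspace is a left ideal.\<close>
  have ece: "\<exists>k. e \<otimes>\<^bsub>A\<^esub> (c \<otimes>\<^bsub>A\<^esub> e) = k \<odot>\<^bsub>A\<^esub> e" if c: "c \<in> carrier A" for c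
  proof -
    let ?w = "c \<otimes>\<^bsub>A\<^esub> e"
    have w: "?w \<in> V" "?w \<in> carrier A" using lmult c e eA by auto
    \<comment> \<open>\<open>M\<close> is the matrix of right multiplication by \<open>?w\<close>,
      which maps \<open>V\<close> to itself because \<open>?w\<close> lies in the left ideal
      \<open>V\<close>. Below, \<open>x\<close> is the element of \<open>V\<close> whose coordinates
      form an eigenvector.\<close>
    define M where "M = mat n n (\<lambda>(i, j). cv i (v j \<otimes>\<^bsub>A\<^esub> ?w))"
    have M: "M \<in> carrier_mat n n" by (simp add: M_def)
    obtain u k where u: "u \<in> carrier_vec n" "u \<noteq> 0\<^sub>v n" "M *\<^sub>v u = k \<cdot>\<^sub>v u"
      using ex_eigenvector[OF M \<open>n > 0\<close>] by blast
    define x where "x = (\<Oplus>\<^bsub>A\<^esub>j\<in>{..<n}. u $ j \<odot>\<^bsub>A\<^esub> v j)"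
    have x: "x \<in> V" unfolding x_def by (rule V.V_finsum) simp
    have cx: "cv i x = u $ i" if "i < n" for i
    proof -
      have "cv i x = (\<Sum>j\<in>{..<n}. cv i (u $ j \<odot>\<^bsub>A\<^esub> v j))"
        unfolding x_def using that by (intro V.coord_finsum) auto
      also have "\<dots> = (\<Sum>j\<in>{..<n}. if j = i then u $ j else 0)"
        using that by (intro sum.cong) (auto simp: V.coord_smult V.coord_b)
      finally show ?thesis using that by simp
    qed
    have rm: "linear_endo A V (\<lambda>y. y \<otimes>\<^bsub>A\<^esub> ?w)"
      unfolding linear_endo_def using lmult w sub by (auto simp: A.l_distr A.smult_mult_l)
    have xw: "x \<otimes>\<^bsub>A\<^esub> ?w = k \<odot>\<^bsub>A\<^esub> x"
    proof (rule V.coord_eqI)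
      fix i assume i: "i \<in> {..<n}"
      have "cv i (x \<otimes>\<^bsub>A\<^esub> ?w) = (\<Sum>j\<in>{..<n}. cv j x * cv i (v j \<otimes>\<^bsub>A\<^esub> ?w))"
        by (rule V.functional_expand[OF V.functional_comp_endo[OF rm V.linear_functional_coord[OF i]] x])
      also have "\<dots> = (M *\<^sub>v u) $ i"
        using i u(1) M by (simp add: scalar_prod_def M_def cx mult.commute lessThan_atLeast0)
      also have "\<dots> = cv i (k \<odot>\<^bsub>A\<^esub> x)" using i u(1) x unfolding u(3) by (simp add: V.coord_smult cx)
      finally show "cv i (x \<otimes>\<^bsub>A\<^esub> ?w) = cv i (k \<odot>\<^bsub>A\<^esub> x)" .
    qed (use x w lmult sub in auto)
    have "x \<noteq> \<zero>\<^bsub>A\<^esub>"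
    proof
      assume "x = \<zero>\<^bsub>A\<^esub>"
      then have "u $ i = 0" if "i < n" for i using cx[OF that] V.coord_zero[of i] that by simp
      then have "u = 0\<^sub>v n" using u(1) by (intro eq_vecI) auto
      with u(2) show False ..
    qed
    define W where "W = {y \<in> V. y \<otimes>\<^bsub>A\<^esub> ?w = k \<odot>\<^bsub>A\<^esub> y}"
    have "A.left_ideal W"
      unfolding A.left_ideal_def W_def using V w sub lmult
      by (auto simp: A.l_distr A.smult_r_distr A.m_assoc A.smult_mult_r)
    moreover have "W \<noteq> {\<zero>\<^bsub>A\<^esub>}" using x xw \<open>x \<noteq> \<zero>\<^bsub>A\<^esub>\<close> by (auto simp: W_def)
    ultimately have "W = V" using min[of W] by (auto simp: W_def)
    then show ?thesis using e(1) by (auto simp: W_def)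
  qed
  \<comment> \<open>\<open>A e\<close> is a left ideal inside \<open>V\<close> that contains
    \<open>e\<close>, so minimality makes it all of \<open>V\<close>.\<close>
  have Ve: "V = (\<lambda>c. c \<otimes>\<^bsub>A\<^esub> e) ` carrier A"
  proof -
    have "A.left_ideal ((\<lambda>c. c \<otimes>\<^bsub>A\<^esub> e) ` carrier A)"
      unfolding A.left_ideal_def
    proof (intro conjI ballI)
      show "\<zero>\<^bsub>A\<^esub> \<in> (\<lambda>c. c \<otimes>\<^bsub>A\<^esub> e) ` carrier A" using eA by (auto intro!: image_eqI[of _ _ "\<zero>\<^bsub>A\<^esub>"])
      fix x assume "x \<in> (\<lambda>c. c \<otimes>\<^bsub>A\<^esub> e) ` carrier A"
      then obtain c where c: "x = c \<otimes>\<^bsub>A\<^esub> e" "c \<in> carrier A" by blast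
      show "x \<oplus>\<^bsub>A\<^esub> y \<in> (\<lambda>c. c \<otimes>\<^bsub>A\<^esub> e) ` carrier A" if "y \<in> (\<lambda>c. c \<otimes>\<^bsub>A\<^esub> e) ` carrier A" for y
        using that c eA by (auto simp flip: A.l_distr)
      show "d \<otimes>\<^bsub>A\<^esub> x \<in> (\<lambda>c. c \<otimes>\<^bsub>A\<^esub> e) ` carrier A" if "d \<in> carrier A" for d
        using that c eA by (auto simp flip: A.m_assoc)
    qed (use eA in auto)
    moreover have "(\<lambda>c. c \<otimes>\<^bsub>A\<^esub> e) ` carrier A \<subseteq> V" using lmult e by auto
    moreover have "e \<in> (\<lambda>c. c \<otimes>\<^bsub>A\<^esub> e) ` carrier A" using eA by (auto intro!: image_eqI[of _ _ "\<one>\<^bsub>A\<^esub>"])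
    ultimately show ?thesis using min e by blast
  qed
  have lm: "linear_endo A V (\<lambda>x. c \<otimes>\<^bsub>A\<^esub> x)" if "c \<in> carrier A" for c
    unfolding linear_endo_def using lmult that sub by (auto simp: A.r_distr A.smult_mult_r)

  text \<open>Every endomorphism of \<open>V\<close> is a left multiplication: the \<open>q\<close> for which all \<open>v \<mapsto> f (q v)\<close> are
    left multiplications form an ideal, which contains \<open>e\<close>.\<close>
  define Q where "Q = {q \<in> carrier A. \<forall>f. linear_endo A V f \<longrightarrow>
    (\<exists>c\<in>carrier A. \<forall>x\<in>V. f (q \<otimes>\<^bsub>A\<^esub> x) = c \<otimes>\<^bsub>A\<^esub> x)}"
  have Ql: "p \<otimes>\<^bsub>A\<^esub> q \<in> Q" if "q \<in> Q" "p \<in> carrier A" for p q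
  proof -
    have "\<exists>c\<in>carrier A. \<forall>x\<in>V. f ((p \<otimes>\<^bsub>A\<^esub> q) \<otimes>\<^bsub>A\<^esub> x) = c \<otimes>\<^bsub>A\<^esub> x" if f: "linear_endo A V f" for f
    proof -
      have "linear_endo A V (\<lambda>x. f (p \<otimes>\<^bsub>A\<^esub> x))"
        using f lm[OF \<open>p \<in> carrier A\<close>] by (auto simp: linear_endo_def Pi_iff)
      then show ?thesis using \<open>q \<in> Q\<close> \<open>p \<in> carrier A\<close> sub by (fastforce simp: Q_def A.m_assoc)
    qed
    then show ?thesis using that by (auto simp: Q_def)
  qed
  have Qr: "q \<otimes>\<^bsub>A\<^esub> p \<in> Q" if "q \<in> Q" "p \<in> carrier A" for p q
  proof -
    have "\<exists>c\<in>carrier A. \<forall>x\<in>V. f ((q \<otimes>\<^bsub>A\<^esub> p) \<otimes>\<^bsub>A\<^esub> x) = c \<otimes>\<^bsub>A\<^esub> x" if f: "linear_endo A V f" for f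
    proof -
      obtain c where c: "c \<in> carrier A" "\<forall>x\<in>V. f (q \<otimes>\<^bsub>A\<^esub> x) = c \<otimes>\<^bsub>A\<^esub> x"
        using \<open>q \<in> Q\<close> f by (auto simp: Q_def)
      then show ?thesis using \<open>q \<in> Q\<close> \<open>p \<in> carrier A\<close> sub lmult
        by (intro bexI[of _ "c \<otimes>\<^bsub>A\<^esub> p"]) (auto simp: A.m_assoc Q_def)
    qed
    then show ?thesis using that by (auto simp: Q_def)
  qed
  have "e \<in> Q"
    unfolding Q_def
  proof (safe)
    fix f assume f: "linear_endo A V f"
    \<comment> \<open>As \<open>V = A e\<close>, one can write \<open>f e = z e\<close>. Every
      \<open>e x\<close> is a multiple of \<open>e\<close>, so \<open>f (e x) = z (e x)\<close>, and
      \<open>z e\<close> is the multiplier sought.\<close>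
    have "f e \<in> V" using f e by (auto simp: linear_endo_def)
    then obtain z where z: "z \<in> carrier A" "f e = z \<otimes>\<^bsub>A\<^esub> e" unfolding Ve by blast
    show "\<exists>c\<in>carrier A. \<forall>x\<in>V. f (e \<otimes>\<^bsub>A\<^esub> x) = c \<otimes>\<^bsub>A\<^esub> x"
    proof (intro bexI ballI)
      fix x assume "x \<in> V"
      then obtain c where c: "c \<in> carrier A" "x = c \<otimes>\<^bsub>A\<^esub> e" unfolding Ve by blast
      obtain k where k: "e \<otimes>\<^bsub>A\<^esub> x = k \<odot>\<^bsub>A\<^esub> e" using ece c by blast
      have "f (e \<otimes>\<^bsub>A\<^esub> x) = k \<odot>\<^bsub>A\<^esub> (z \<otimes>\<^bsub>A\<^esub> e)" using f e z by (auto simp: k linear_endo_def)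
      also have "\<dots> = z \<otimes>\<^bsub>A\<^esub> (e \<otimes>\<^bsub>A\<^esub> x)" using z eA by (simp add: k A.smult_mult_r)
      finally show "f (e \<otimes>\<^bsub>A\<^esub> x) = (z \<otimes>\<^bsub>A\<^esub> e) \<otimes>\<^bsub>A\<^esub> x" using z eA sub \<open>x \<in> V\<close> by (simp add: A.m_assoc)
    qed (use z eA in auto)
  qed (rule eA)
  have "ideal Q A"
  proof (rule idealI[OF A.ring_axioms])
    show "subgroup Q (add_monoid A)"
    proof (rule A.add.subgroupI)
      show "\<ominus>\<^bsub>A\<^esub> q \<in> Q" if "q \<in> Q" for q
        using Ql[OF that, of "\<ominus>\<^bsub>A\<^esub> \<one>\<^bsub>A\<^esub>"] that by (simp add: A.l_minus Q_def)
      show "q \<oplus>\<^bsub>A\<^esub> q' \<in> Q" if q: "q \<in> Q" "q' \<in> Q" for q q'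
      proof -
        have "\<exists>c\<in>carrier A. \<forall>x\<in>V. f ((q \<oplus>\<^bsub>A\<^esub> q') \<otimes>\<^bsub>A\<^esub> x) = c \<otimes>\<^bsub>A\<^esub> x" if f: "linear_endo A V f" for f
        proof -
          obtain c where "c \<in> carrier A" "\<forall>x\<in>V. f (q \<otimes>\<^bsub>A\<^esub> x) = c \<otimes>\<^bsub>A\<^esub> x"
            using q(1) f by (auto simp: Q_def)
          moreover obtain c' where "c' \<in> carrier A" "\<forall>x\<in>V. f (q' \<otimes>\<^bsub>A\<^esub> x) = c' \<otimes>\<^bsub>A\<^esub> x"
            using q(2) f by (auto simp: Q_def)
          ultimately show ?thesis using q f lmult sub
            by (intro bexI[of _ "c \<oplus>\<^bsub>A\<^esub> c'"]) (auto simp: A.l_distr Q_def linear_endo_def)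
        qed
        then show ?thesis using q by (auto simp: Q_def)
      qed
    qed (use \<open>e \<in> Q\<close> in \<open>auto simp: Q_def\<close>)
  qed (use Ql Qr in auto)
  then have "\<one>\<^bsub>A\<^esub> \<in> Q" using simple[of Q] \<open>e \<in> Q\<close> e by auto
  then have dense: "\<exists>c\<in>carrier A. \<forall>x\<in>V. f x = c \<otimes>\<^bsub>A\<^esub> x" if "linear_endo A V f" for f
    using that sub by (fastforce simp: Q_def)

  \<comment> \<open>The kernel of the action on \<open>V\<close> is a two-sided ideal without the
    unit, hence zero; this gives injectivity of the representation.\<close>
  define Z where "Z = {c \<in> carrier A. \<forall>x\<in>V. c \<otimes>\<^bsub>A\<^esub> x = \<zero>\<^bsub>A\<^esub>}"
  have "ideal Z A"
  proof (rule idealI[OF A.ring_axioms])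
    show "subgroup Z (add_monoid A)"
      by (rule A.add.subgroupI) (auto simp: Z_def A.l_distr A.l_minus sub intro!: exI[of _ "\<zero>\<^bsub>A\<^esub>"])
  qed (auto simp: Z_def A.m_assoc lmult sub)
  moreover have "\<one>\<^bsub>A\<^esub> \<notin> Z" using e eA by (auto simp: Z_def intro!: bexI[of _ e])
  ultimately have Z: "Z = {\<zero>\<^bsub>A\<^esub>}" using simple[of Z] by auto

  define h where "h c = mat n n (\<lambda>(i, j). cv i (c \<otimes>\<^bsub>A\<^esub> v j))" for c
  have vV: "v j \<in> V" "v j \<in> carrier A" if "j < n" for j using that sub by auto
  have "h \<in> Ring.ring_hom A (ring_mat TYPE('l) n ())"
  proof (rule ring_hom_memI)
    show "h c \<in> carrier (ring_mat TYPE('l) n ())" for c by (simp add: h_def ring_mat_simps)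
    fix c d assume cd: "c \<in> carrier A" "d \<in> carrier A"
    show "h (c \<oplus>\<^bsub>A\<^esub> d) = h c \<oplus>\<^bsub>ring_mat TYPE('l) n ()\<^esub> h d"
      using cd vV lmult by (intro eq_matI) (auto simp: h_def ring_mat_simps A.l_distr V.coord_add)
    show "h (c \<otimes>\<^bsub>A\<^esub> d) = h c \<otimes>\<^bsub>ring_mat TYPE('l) n ()\<^esub> h d"
    proof (rule eq_matI)
      fix i j assume "i < dim_row (h c \<otimes>\<^bsub>ring_mat TYPE('l) n ()\<^esub> h d)" "j < dim_col (h c \<otimes>\<^bsub>ring_mat TYPE('l) n ()\<^esub> h d)"
      then have ij: "i < n" "j < n" by (auto simp: h_def ring_mat_simps)
      have "cv i (c \<otimes>\<^bsub>A\<^esub> (d \<otimes>\<^bsub>A\<^esub> v j)) = (\<Sum>k\<in>{..<n}. cv k (d \<otimes>\<^bsub>A\<^esub> v j) * cv i (c \<otimes>\<^bsub>A\<^esub> v k))"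
        by (rule V.functional_expand[OF V.functional_comp_endo[OF lm[OF cd(1)] V.linear_functional_coord]])
          (use ij lmult cd vV in auto)
      also have "\<dots> = (\<Sum>k\<in>{0..<n}. cv i (c \<otimes>\<^bsub>A\<^esub> v k) * cv k (d \<otimes>\<^bsub>A\<^esub> v j))"
        by (intro sum.cong) auto
      also have "\<dots> = (h c * h d) $$ (i, j)" using ij by (simp add: h_def scalar_prod_def)
      also have "c \<otimes>\<^bsub>A\<^esub> (d \<otimes>\<^bsub>A\<^esub> v j) = (c \<otimes>\<^bsub>A\<^esub> d) \<otimes>\<^bsub>A\<^esub> v j"
        using ij cd vV(2) by (simp only: A.m_assoc)
      finally show "h (c \<otimes>\<^bsub>A\<^esub> d) $$ (i, j) = (h c \<otimes>\<^bsub>ring_mat TYPE('l) n ()\<^esub> h d) $$ (i, j)"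
        using ij by (simp add: h_def ring_mat_simps)
    qed (auto simp: h_def ring_mat_simps)
  next
    show "h \<one>\<^bsub>A\<^esub> = \<one>\<^bsub>ring_mat TYPE('l) n ()\<^esub>"
      using vV by (intro eq_matI) (auto simp: h_def ring_mat_simps V.coord_b)
  qed
  moreover have "bij_betw h (carrier A) (carrier (ring_mat TYPE('l) n ()))"
  proof (rule bij_betwI')
    fix c d assume cd: "c \<in> carrier A" "d \<in> carrier A"
    show "h c = h d \<longleftrightarrow> c = d"
    proof
      assume hcd: "h c = h d"
      have "c \<otimes>\<^bsub>A\<^esub> x = d \<otimes>\<^bsub>A\<^esub> x" if x: "x \<in> V" for x
      proof (rule V.coord_eqI)
        fix i assume i: "i \<in> {..<n}"
        have "cv i (c \<otimes>\<^bsub>A\<^esub> v j) = cv i (d \<otimes>\<^bsub>A\<^esub> v j)" if "j < n" for j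
          using arg_cong[OF hcd, of "\<lambda>M. M $$ (i, j)"] i that by (simp add: h_def)
        then show "cv i (c \<otimes>\<^bsub>A\<^esub> x) = cv i (d \<otimes>\<^bsub>A\<^esub> x)"
          using V.functional_expand[OF V.functional_comp_endo[OF lm[OF cd(1)] V.linear_functional_coord[OF i]] x]
            V.functional_expand[OF V.functional_comp_endo[OF lm[OF cd(2)] V.linear_functional_coord[OF i]] x]
          by simp
      qed (use cd lmult x in auto)
      then have "c \<oplus>\<^bsub>A\<^esub> \<ominus>\<^bsub>A\<^esub> d \<in> Z"
        using cd sub by (auto simp: Z_def A.l_distr A.l_minus A.r_neg)
      then have "c \<oplus>\<^bsub>A\<^esub> \<ominus>\<^bsub>A\<^esub> d = \<zero>\<^bsub>A\<^esub>" using Z by auto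
      then show "c = d" using cd by (metis A.minus_equality A.minus_minus A.a_inv_closed)
    qed simp
  next
    fix M assume M: "M \<in> carrier (ring_mat TYPE('l) n ())"
    \<comment> \<open>Surjectivity: \<open>f\<close> is the endomorphism of \<open>V\<close> with
      matrix \<open>M\<close>, and \<open>dense\<close> realises it as a left
      multiplication.\<close>
    define f where "f x = (\<Oplus>\<^bsub>A\<^esub>i\<in>{..<n}. (\<Sum>j<n. M $$ (i, j) * cv j x) \<odot>\<^bsub>A\<^esub> v i)" for x
    have fV: "f x \<in> V" for x unfolding f_def by (rule V.V_finsum) simp
    have cf: "cv i (f x) = (\<Sum>j<n. M $$ (i, j) * cv j x)" if i: "i < n" for i x
    proof -
      have "cv i (f x) = (\<Sum>k\<in>{..<n}. cv i ((\<Sum>j<n. M $$ (k, j) * cv j x) \<odot>\<^bsub>A\<^esub> v k))"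
        unfolding f_def using i by (intro V.coord_finsum) auto
      also have "\<dots> = (\<Sum>k\<in>{..<n}. if k = i then \<Sum>j<n. M $$ (k, j) * cv j x else 0)"
        using i by (intro sum.cong) (auto simp: V.coord_smult V.coord_b)
      finally show ?thesis using i by simp
    qed
    have "linear_endo A V f"
      unfolding linear_endo_def
    proof (intro conjI ballI allI)
      show "f (x \<oplus>\<^bsub>A\<^esub> y) = f x \<oplus>\<^bsub>A\<^esub> f y" if "x \<in> V" "y \<in> V" for x y
        using that fV by (intro V.coord_eqI) (auto simp: cf V.coord_add distrib_left sum.distrib)
      show "f (c \<odot>\<^bsub>A\<^esub> x) = c \<odot>\<^bsub>A\<^esub> f x" if "x \<in> V" for c x
        using that fV by (intro V.coord_eqI) (auto simp: cf V.coord_smult sum_distrib_left mult.left_commute)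
    qed (use fV in auto)
    from dense[OF this] obtain c where c: "c \<in> carrier A" "\<And>x. x \<in> V \<Longrightarrow> f x = c \<otimes>\<^bsub>A\<^esub> x" by blast
    have "M = h c"
    proof (rule eq_matI)
      fix i j assume "i < dim_row (h c)" "j < dim_col (h c)"
      then have ij: "i < n" "j < n" by (auto simp: h_def)
      have "cv i (f (v j)) = (\<Sum>k<n. if k = j then M $$ (i, k) else 0)"
        unfolding cf[OF ij(1)] using ij by (intro sum.cong) (auto simp: V.coord_b)
      then show "M $$ (i, j) = h c $$ (i, j)" using ij vV c by (simp add: h_def)
    qed (use M in \<open>auto simp: h_def ring_mat_simps\<close>)
    then show "\<exists>c\<in>carrier A. M = h c" using c by blast
  qed (auto simp: h_def ring_mat_simps)
  ultimately have "h \<in> ring_iso A (ring_mat TYPE('l) n ())" by (simp add: ring_iso_def)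
  moreover have "h (l \<odot>\<^bsub>A\<^esub> \<one>\<^bsub>A\<^esub>) = l \<cdot>\<^sub>m 1\<^sub>m n" for l
    using vV by (intro eq_matI) (auto simp: h_def A.smult_mult_l V.coord_smult V.coord_b)
  ultimately show thesis by (rule that)
qed

section \<open>The reduced trace\<close>

lemma algebra_over_closure: "algebra_over (closure_algebra :: ('k::field, 'k alg_closure) module)"
proof (intro algebra_over.intro algebra_over_axioms.intro ringI abelian_groupI monoidI)
  show "\<exists>y\<in>carrier closure_algebra. y \<oplus>\<^bsub>closure_algebra\<^esub> x = \<zero>\<^bsub>closure_algebra\<^esub>" for x :: "'k alg_closure"
    by (auto simp: closure_algebra_def intro: exI[of _ "- x"])
qed (auto simp: closure_algebra_def algebra_simps)

lemma closure_algebra_simple: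
  assumes "ideal J (closure_algebra :: ('k::field, 'k alg_closure) module)"
  shows "J = {\<zero>\<^bsub>closure_algebra\<^esub>} \<or> J = carrier closure_algebra"
proof (cases "J \<subseteq> {0}")
  case True
  then show ?thesis
    using additive_subgroup.zero_closed[OF ideal.axioms(1)[OF assms]] by (auto simp: closure_algebra_def)
next
  case False
  then obtain l where l: "l \<in> J" "l \<noteq> 0" by auto
  have "m \<in> J" for m
    using ideal.I_l_closed[OF assms l(1), of "m * inverse l"] l(2)
    by (simp add: closure_algebra_def mult.assoc)
  then show ?thesis by (auto simp: closure_algebra_def)
qed

section \<open>Matrix algebras with the basis of matrix units\<close>

lemma finsum_entry:
  fixes f :: "'j \<Rightarrow> 'l::field mat"
  assumes R: "abelian_monoid R" "carrier R = carrier_mat n n" "\<And>x y. x \<oplus>\<^bsub>R\<^esub> y = x + y" "\<zero>\<^bsub>R\<^esub> = 0\<^sub>m n n"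
    and "finite S" "\<And>s. s \<in> S \<Longrightarrow> f s \<in> carrier_mat n n" and pq: "p < n" "q < n"
  shows "(\<Oplus>\<^bsub>R\<^esub>s\<in>S. f s) $$ (p, q) = (\<Sum>s\<in>S. f s $$ (p, q))"
  using assms(5,6)
proof (induction S)
  case empty
  then show ?case using pq R(4) by (simp add: abelian_monoid.finsum_empty[OF R(1)])
next
  case (insert s S)
  then have f: "f \<in> S \<rightarrow> carrier R" "f s \<in> carrier R" using R by auto
  then have "(\<Oplus>\<^bsub>R\<^esub>s\<in>S. f s) \<in> carrier_mat n n" using abelian_monoid.finsum_closed[OF R(1)] R(2) by auto
  with insert f show ?case using pq R by (simp add: abelian_monoid.finsum_insert[OF R(1)])
qed

lemma algebra_over_mat: "algebra_over (module_mat TYPE('l::field) n n)"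
proof (intro algebra_over.intro algebra_over_axioms.intro ringI abelian_groupI monoidI)
  fix M assume "M \<in> carrier (module_mat TYPE('l) n n)"
  then show "\<exists>Y\<in>carrier (module_mat TYPE('l) n n). Y \<oplus>\<^bsub>module_mat TYPE('l) n n\<^esub> M = \<zero>\<^bsub>module_mat TYPE('l) n n\<^esub>"
    by (intro bexI[of _ "- M"]) (auto simp: module_mat_def)
next
  fix M M' c d assume "M \<in> carrier (module_mat TYPE('l) n n)" "M' \<in> carrier (module_mat TYPE('l) n n)"
  then show "(c \<odot>\<^bsub>module_mat TYPE('l) n n\<^esub> M) \<otimes>\<^bsub>module_mat TYPE('l) n n\<^esub> M' =
      c \<odot>\<^bsub>module_mat TYPE('l) n n\<^esub> (M \<otimes>\<^bsub>module_mat TYPE('l) n n\<^esub> M')"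
    "M \<otimes>\<^bsub>module_mat TYPE('l) n n\<^esub> (c \<odot>\<^bsub>module_mat TYPE('l) n n\<^esub> M') =
      c \<odot>\<^bsub>module_mat TYPE('l) n n\<^esub> (M \<otimes>\<^bsub>module_mat TYPE('l) n n\<^esub> M')"
    by (auto simp: module_mat_def)
qed (auto simp: module_mat_def comm_add_mat add_smult_distrib_left_mat add_smult_distrib_right_mat
    assoc_mult_mat[of _ n n _ n _ n] add_mult_distrib_mat[of _ n n _ _ n]
    mult_add_distrib_mat[of _ n n _ n] intro!: eq_matI simp: algebra_simps)

definition unit_mat :: "nat \<Rightarrow> nat \<times> nat \<Rightarrow> 'l::field mat"
  where "unit_mat n s = mat n n (\<lambda>t. if t = s then 1 else 0)"

lemma based_space_mat:
  "based_space (module_mat TYPE('l::field) n n) (carrier_mat n n) ({..<n} \<times> {..<n}) (unit_mat n) (\<lambda>s M. M $$ s)"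
proof -
  interpret M: algebra_over "module_mat TYPE('l) n n" by (rule algebra_over_mat)
  show ?thesis
  proof unfold_locales
    fix M :: "'l mat" assume M: "M \<in> carrier_mat n n"
    let ?S = "\<Oplus>\<^bsub>module_mat TYPE('l) n n\<^esub>s\<in>{..<n} \<times> {..<n}. M $$ s \<odot>\<^bsub>module_mat TYPE('l) n n\<^esub> unit_mat n s"
    have S: "?S \<in> carrier_mat n n"
      using M.finsum_closed[of _ "{..<n} \<times> {..<n}"] by (auto simp: module_mat_def unit_mat_def)
    show "?S = M"
    proof (rule eq_matI)
      fix p q assume "p < dim_row M" "q < dim_col M"
      then have pq: "p < n" "q < n" using M by auto
      have "?S $$ (p, q) = (\<Sum>s\<in>{..<n} \<times> {..<n}. (M $$ s \<odot>\<^bsub>module_mat TYPE('l) n n\<^esub> unit_mat n s) $$ (p, q))"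
        using pq M.abelian_monoid_axioms by (intro finsum_entry) (auto simp: module_mat_def unit_mat_def)
      also have "\<dots> = (\<Sum>s\<in>{..<n} \<times> {..<n}. if s = (p, q) then M $$ s else 0)"
        using pq by (intro sum.cong) (auto simp: module_mat_def unit_mat_def)
      finally show "?S $$ (p, q) = M $$ (p, q)" using pq by simp
    qed (use S M in auto)
  qed (auto simp: module_mat_def unit_mat_def split: if_splits)
qed

text \<open>The ring \<open>A \<otimes> L\<close> regarded as an algebra over the algebraic closure
  \<open>L\<close>, where \<open>l\<close> acts as multiplication by \<open>1 \<otimes> l\<close>.
  In \<open>tensor_algebra\<close> the scalars are those of \<open>K\<close>, whereas Wedderburn's
  theorem and the comparison of traces take place over \<open>L\<close>.\<close>

definition closure_extension :: "('k::field, 'a) module \<Rightarrow>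
    ('k alg_closure, ('a \<times> 'k alg_closure \<Rightarrow>\<^sub>0 'k) set) module"
  where "closure_extension A = (let T = tensor_algebra A closure_algebra in \<lparr>
    carrier = carrier T, monoid.mult = monoid.mult T, one = one T, ring.zero = ring.zero T, add = add T,
    module.smult = (\<lambda>l x. pure_tensor A closure_algebra \<one>\<^bsub>A\<^esub> l \<otimes>\<^bsub>T\<^esub> x)\<rparr>)"

locale algebra_with_basis = based_space A "carrier A" I b coord
  for A :: "('k::field, 'a) module" (structure) and I :: "'i set" and b coord
begin

abbreviation "cl \<equiv> closure_algebra :: ('k, 'k alg_closure) module"
abbreviation "AL \<equiv> tensor_algebra A cl"
abbreviation "EL \<equiv> closure_extension A"

sublocale AL: tensor_based A cl I b coord
  by (intro tensor_based.intro tensor_product.intro algebra_over_closure based_space_axioms algebra_over_axioms)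

lemma cl_simps [simp]: "carrier cl = UNIV" "x \<otimes>\<^bsub>cl\<^esub> y = x * y" "\<one>\<^bsub>cl\<^esub> = 1" "\<zero>\<^bsub>cl\<^esub> = 0"
    "x \<oplus>\<^bsub>cl\<^esub> y = x + y" "c \<odot>\<^bsub>cl\<^esub> x = to_ac c * x"
  by (simp_all add: closure_algebra_def)

lemma EL_simps [simp]: "carrier EL = carrier AL" "x \<otimes>\<^bsub>EL\<^esub> y = x \<otimes>\<^bsub>AL\<^esub> y" "\<one>\<^bsub>EL\<^esub> = \<one>\<^bsub>AL\<^esub>" "\<zero>\<^bsub>EL\<^esub> = \<zero>\<^bsub>AL\<^esub>"
    "x \<oplus>\<^bsub>EL\<^esub> y = x \<oplus>\<^bsub>AL\<^esub> y" "l \<odot>\<^bsub>EL\<^esub> x = AL.pt \<one> l \<otimes>\<^bsub>AL\<^esub> x"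
  by (simp_all add: closure_extension_def Let_def)

lemma pt_one_commute: "x \<in> carrier AL \<Longrightarrow> x \<otimes>\<^bsub>AL\<^esub> AL.pt \<one> l = AL.pt \<one> l \<otimes>\<^bsub>AL\<^esub> x"
  by (rule AL.tcoord_eqI) (use AL.tcoord_mult_r in \<open>auto simp: mult.commute\<close>)

lemma algebra_over_EL: "algebra_over EL"
proof (intro algebra_over.intro algebra_over_axioms.intro)
  show "ring EL"
  proof (intro ringI abelian_groupI monoidI)
    show "\<exists>y\<in>carrier EL. y \<oplus>\<^bsub>EL\<^esub> x = \<zero>\<^bsub>EL\<^esub>" if "x \<in> carrier EL" for x
      using that by (intro bexI[of _ "\<ominus>\<^bsub>AL\<^esub> x"]) (auto simp: AL.T.l_neg)
  qed (auto simp: AL.T.a_ac AL.T.m_assoc AL.T.l_distr AL.T.r_distr)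
  fix x y and c d :: "'k alg_closure" assume "x \<in> carrier EL" "y \<in> carrier EL"
  then show "x \<otimes>\<^bsub>EL\<^esub> (c \<odot>\<^bsub>EL\<^esub> y) = c \<odot>\<^bsub>EL\<^esub> (x \<otimes>\<^bsub>EL\<^esub> y)"
    by (simp add: AL.T.m_assoc[symmetric] pt_one_commute)
next
  fix x and c d :: "'k alg_closure" assume "x \<in> carrier EL"
  moreover have "AL.pt \<one> (c + d) = AL.pt \<one> c \<oplus>\<^bsub>AL\<^esub> AL.pt \<one> d" using AL.pt_add_r[of \<one> c d] by simp
  moreover have "AL.pt \<one> (c * d) = AL.pt \<one> c \<otimes>\<^bsub>AL\<^esub> AL.pt \<one> d" using AL.pt_mult[of \<one> c \<one> d] by simp
  moreover have "AL.pt \<one> 1 = \<one>\<^bsub>AL\<^esub>" by (simp add: AL.pt_one)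
  ultimately show "(c + d) \<odot>\<^bsub>EL\<^esub> x = c \<odot>\<^bsub>EL\<^esub> x \<oplus>\<^bsub>EL\<^esub> d \<odot>\<^bsub>EL\<^esub> x"
    "(c * d) \<odot>\<^bsub>EL\<^esub> x = c \<odot>\<^bsub>EL\<^esub> (d \<odot>\<^bsub>EL\<^esub> x)" "1 \<odot>\<^bsub>EL\<^esub> x = x"
    by (simp_all add: AL.T.l_distr AL.T.m_assoc)
qed (auto simp: AL.T.r_distr AL.T.m_assoc)

lemma based_space_EL: "based_space EL (carrier EL) I (\<lambda>i. AL.pt (b i) 1) AL.tcoord"
proof -
  interpret EL: algebra_over EL by (rule algebra_over_EL)
  show ?thesis
  proof unfold_locales
    fix x assume x: "x \<in> carrier EL"
    have "(\<Oplus>\<^bsub>EL\<^esub>i\<in>I. AL.tcoord i x \<odot>\<^bsub>EL\<^esub> AL.pt (b i) 1) = (\<Oplus>\<^bsub>EL\<^esub>i\<in>I. AL.pt (b i) (AL.tcoord i x))"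
      using AL.pt_mult[of \<one> _ "b _" 1] by (intro EL.finsum_cong') auto
    also have "\<dots> = (\<Oplus>\<^bsub>AL\<^esub>i\<in>I. AL.pt (b i) (AL.tcoord i x))"
      by (simp add: finsum_def finprod_def closure_extension_def Let_def)
    also have "\<dots> = x" using x AL.tcoord_expand by simp
    finally show "(\<Oplus>\<^bsub>EL\<^esub>i\<in>I. AL.tcoord i x \<odot>\<^bsub>EL\<^esub> AL.pt (b i) 1) = x" .
  next
    fix i c x assume "i \<in> I" "x \<in> carrier EL"
    then show "AL.tcoord i (c \<odot>\<^bsub>EL\<^esub> x) = c * AL.tcoord i x"
      using AL.tcoord_mult_r(2)[of i x c] by simp
  qed (auto simp: AL.tcoord_add AL.tcoord_pt coord_b)
qed

lemma EL_one: "\<one> \<noteq> \<zero> \<Longrightarrow> \<one>\<^bsub>EL\<^esub> \<noteq> \<zero>\<^bsub>EL\<^esub>"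
  using AL.T_one_neq_zero by simp

lemma ideal_EL: "ideal J EL \<Longrightarrow> ideal J AL"
proof (intro idealI AL.T.ring_axioms AL.T.add.subgroupI)
  assume J: "ideal J EL"
  note a_subset = additive_subgroup.a_subset[OF ideal.axioms(1)[OF J]]
    and zero_closed = additive_subgroup.zero_closed[OF ideal.axioms(1)[OF J]]
    and a_closed = additive_subgroup.a_closed[OF ideal.axioms(1)[OF J]]
    and I_l_closed = ideal.I_l_closed[OF J] and I_r_closed = ideal.I_r_closed[OF J]
  show "J \<subseteq> carrier AL" using a_subset by simp
  show "J \<noteq> {}" using zero_closed by auto
  show "x \<oplus>\<^bsub>AL\<^esub> y \<in> J" if "x \<in> J" "y \<in> J" for x y using a_closed that by simp
  show *: "z \<otimes>\<^bsub>AL\<^esub> x \<in> J" "x \<otimes>\<^bsub>AL\<^esub> z \<in> J" if "x \<in> J" "z \<in> carrier AL" for x z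
    using I_l_closed[of x z] I_r_closed[of x z] that by auto
  show "\<ominus>\<^bsub>AL\<^esub> x \<in> J" if "x \<in> J" for x
    using *(1)[OF that, of "\<ominus>\<^bsub>AL\<^esub> \<one>\<^bsub>AL\<^esub>"] a_subset that by (auto simp: AL.T.l_minus subset_iff)
qed

text \<open>\<open>T_simple\<close> makes \<open>A \<otimes> L\<close> simple, as \<open>A\<close>
  is central simple and the field \<open>L\<close> is simple. Over \<open>L\<close> it has a finite
  basis, so \<open>wedderburn_alg_closed\<close> applies; going back from \<open>EL\<close> to
  \<open>AL\<close> changes only the scalars.\<close>

lemma ex_splitting:
  assumes one: "\<one> \<noteq> \<zero>" and c: "center A = scalars A"
    and simple: "\<And>Q. ideal Q A \<Longrightarrow> Q = {\<zero>} \<or> Q = carrier A"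
  obtains n h where "splitting A n h"
proof -
  have "J = {\<zero>\<^bsub>EL\<^esub>} \<or> J = carrier EL" if "ideal J EL" for J
    using AL.T_simple[OF one c simple closure_algebra_simple ideal_EL[OF that]] by simp
  then obtain n h where h: "h \<in> ring_iso EL (ring_mat TYPE('k alg_closure) n ())"
    "\<And>l. h (l \<odot>\<^bsub>EL\<^esub> \<one>\<^bsub>EL\<^esub>) = l \<cdot>\<^sub>m 1\<^sub>m n"
    using wedderburn_alg_closed[OF based_space_EL EL_one[OF one]] by metis
  have "h \<in> ring_iso AL (ring_mat TYPE('k alg_closure) n ())"
    using h(1) by (simp add: ring_iso_def Ring.ring_hom_def)
  moreover have "h (AL.pt \<one> l) = l \<cdot>\<^sub>m 1\<^sub>m n" for l using h(2)[of l] by simp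
  ultimately have "splitting A n h" by (simp add: splitting_def)
  then show thesis by (rule that)
qed

text \<open>On matrix units one sees that left or right multiplication by \<open>X\<close> on all
  matrices of size \<open>n\<close> has trace \<open>n\<close> times that of \<open>X\<close>. The
  images under \<open>h\<close> of the basis vectors \<open>b i \<otimes> 1\<close> form a second
  basis, in which the same trace is the regular trace of \<open>A\<close>. The identity map gives
  the dimension, as an equation in \<open>L\<close>.\<close>

lemma splitting_trace:
  assumes "splitting A n h"
  shows "(of_nat (card I) :: 'k alg_closure) = of_nat (n * n)"
    and "a \<in> carrier A \<Longrightarrow> of_nat n * mat_trace (h (AL.pt a 1)) = to_ac (trace (\<lambda>x. a \<otimes> x))"
    and "a \<in> carrier A \<Longrightarrow> of_nat n * mat_trace (h (AL.pt a 1)) = to_ac (trace (\<lambda>x. x \<otimes> a))"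
proof -
  let ?M = "module_mat TYPE('k alg_closure) n n"
  interpret EL: based_space EL "carrier EL" I "\<lambda>i. AL.pt (b i) 1" AL.tcoord by (rule based_space_EL)
  interpret M: based_space ?M "carrier_mat n n" "{..<n} \<times> {..<n}" "unit_mat n" "\<lambda>s M. M $$ s"
    by (rule based_space_mat)
  have hom: "h \<in> Ring.ring_hom AL (ring_mat TYPE('k alg_closure) n ())"
    and bij: "bij_betw h (carrier AL) (carrier_mat n n)"
    and h1: "\<And>l. h (AL.pt \<one> l) = l \<cdot>\<^sub>m 1\<^sub>m n"
    using assms by (auto simp: splitting_def ring_iso_def ring_mat_simps)
  define g where "g = inv_into (carrier AL) h"
  have hc: "h x \<in> carrier_mat n n" and gh: "g (h x) = x" if "x \<in> carrier AL" for x
    using bij that by (auto simp: g_def bij_betw_def)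
  have gc: "g M \<in> carrier AL" and hg: "h (g M) = M" if "M \<in> carrier_mat n n" for M
    using bij that unfolding g_def by (auto simp: bij_betw_def inv_into_into f_inv_into_f)
  have h_add: "h (x \<oplus>\<^bsub>AL\<^esub> y) = h x + h y" and h_mult: "h (x \<otimes>\<^bsub>AL\<^esub> y) = h x * h y"
    if "x \<in> carrier AL" "y \<in> carrier AL" for x y
    using ring_hom_add[OF hom] ring_hom_mult[OF hom] that by (auto simp: ring_mat_simps)
  have h_smult: "h (l \<odot>\<^bsub>EL\<^esub> x) = l \<cdot>\<^sub>m h x" if "x \<in> carrier AL" for l x
    using that hc[OF that] by (simp add: h_mult h1 mult_smult_assoc_mat[of _ n n _ n])
  have B: "based_space ?M (carrier_mat n n) I (\<lambda>i. h (AL.pt (b i) 1)) (\<lambda>i M. AL.tcoord i (g M))"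
    by (rule based_space_transport[OF based_space_EL algebra_over_mat, where s = "\<lambda>c. c" and s' = "\<lambda>c. c"])
      (use hc gh gc hg h_add h_smult in \<open>simp_all add: module_mat_def\<close>)
  note tr = M.trace_basis_independent[OF B, unfolded based_space.trace_def[OF B] M.trace_def, symmetric]
  show "(of_nat (card I) :: 'k alg_closure) = of_nat (n * n)"
  proof -
    have "linear_endo ?M (carrier_mat n n) (\<lambda>x. x)" by (simp add: linear_endo_def)
    from M.trace_basis_independent[OF B this] show ?thesis
      by (simp add: based_space.trace_id[OF B] M.trace_id)
  qed
  show "of_nat n * mat_trace (h (AL.pt a 1)) = to_ac (trace (\<lambda>x. a \<otimes> x))" if a: "a \<in> carrier A"
  proof -
    let ?X = "h (AL.pt a 1)"
    have X: "?X \<in> carrier_mat n n" using a by (intro hc) auto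
    have "linear_endo ?M (carrier_mat n n) (\<lambda>x. ?X * x)"
      using X by (auto simp: linear_endo_def module_mat_def mult_add_distrib_mat[of _ n n _ n])
    note t = tr[OF this]
    have "(\<Sum>s\<in>{..<n} \<times> {..<n}. (?X * unit_mat n s) $$ s) = (\<Sum>s\<in>{..<n} \<times> {..<n}. ?X $$ (fst s, fst s))"
      using X by (intro sum.cong) (auto simp: scalar_prod_def unit_mat_def if_distrib cong: if_cong)
    also have "\<dots> = (\<Sum>p<n. \<Sum>q<n. ?X $$ (p, p))" by (subst sum.cartesian_product) (auto simp: case_prod_beta)
    also have "\<dots> = of_nat n * mat_trace ?X" using X by (simp add: mat_trace_def sum_distrib_left)
    finally have "of_nat n * mat_trace ?X = (\<Sum>i\<in>I. AL.tcoord i (g (?X * h (AL.pt (b i) 1))))" using t by simp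
    also have "\<dots> = (\<Sum>i\<in>I. to_ac (coord i (a \<otimes> b i)))"
    proof (intro sum.cong refl)
      fix i assume "i \<in> I"
      then have "?X * h (AL.pt (b i) 1) = h (AL.pt (a \<otimes> b i) 1)"
        using a AL.pt_mult[of a 1 "b i" 1] by (simp flip: h_mult)
      then show "AL.tcoord i (g (?X * h (AL.pt (b i) 1))) = to_ac (coord i (a \<otimes> b i))"
        using a \<open>i \<in> I\<close> by (simp add: gh AL.tcoord_pt)
    qed
    finally show ?thesis by (simp add: trace_def to_ac_sum)
  qed
  show "of_nat n * mat_trace (h (AL.pt a 1)) = to_ac (trace (\<lambda>x. x \<otimes> a))" if a: "a \<in> carrier A"
  proof -
    let ?X = "h (AL.pt a 1)"
    have X: "?X \<in> carrier_mat n n" using a by (intro hc) auto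
    have "linear_endo ?M (carrier_mat n n) (\<lambda>x. x * ?X)"
      using X by (auto simp: linear_endo_def module_mat_def add_mult_distrib_mat[of _ n n _ _ n])
    note t = tr[OF this]
    have "(\<Sum>s\<in>{..<n} \<times> {..<n}. (unit_mat n s * ?X) $$ s) = (\<Sum>s\<in>{..<n} \<times> {..<n}. ?X $$ (snd s, snd s))"
      using X by (intro sum.cong) (auto simp: scalar_prod_def unit_mat_def if_distrib if_distribR cong: if_cong)
    also have "\<dots> = (\<Sum>p<n. \<Sum>q<n. ?X $$ (q, q))" by (subst sum.cartesian_product) (auto simp: case_prod_beta)
    also have "\<dots> = of_nat n * mat_trace ?X" using X by (simp add: mat_trace_def)
    finally have "of_nat n * mat_trace ?X = (\<Sum>i\<in>I. AL.tcoord i (g (h (AL.pt (b i) 1) * ?X)))" using t by simp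
    also have "\<dots> = (\<Sum>i\<in>I. to_ac (coord i (b i \<otimes> a)))"
    proof (intro sum.cong refl)
      fix i assume "i \<in> I"
      then have "h (AL.pt (b i) 1) * ?X = h (AL.pt (b i \<otimes> a) 1)"
        using a AL.pt_mult[of "b i" 1 a 1] by (simp flip: h_mult)
      then show "AL.tcoord i (g (h (AL.pt (b i) 1) * ?X)) = to_ac (coord i (b i \<otimes> a))"
        using a \<open>i \<in> I\<close> by (simp add: gh AL.tcoord_pt)
    qed
    finally show ?thesis by (simp add: trace_def to_ac_sum)
  qed
qed

text \<open>The regular trace lies in \<open>K\<close>, so dividing it by \<open>d\<close> shows
  that the matrix trace comes from \<open>K\<close>, without any descent argument. In characteristic
  0 the dimension \<open>d * d\<close> determines \<open>d\<close>, hence every splitting has the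
  same size and yields the same value; this validates the definite description.\<close>

theorem reduced_trace_eq:
  assumes one: "\<one> \<noteq> \<zero>" and c: "center A = scalars A"
    and simple: "\<And>Q. ideal Q A \<Longrightarrow> Q = {\<zero>} \<or> Q = carrier A"
    and char0: "\<And>n. of_nat n = (0::'k) \<Longrightarrow> n = 0"
  obtains d where "d > 0" "card I = d * d"
    "\<And>a. a \<in> carrier A \<Longrightarrow> of_nat d * reduced_trace A a = trace (\<lambda>x. a \<otimes> x)"
    "\<And>a. a \<in> carrier A \<Longrightarrow> trace (\<lambda>x. a \<otimes> x) = trace (\<lambda>x. x \<otimes> a)"
proof -
  have inj: "m = n" if "(of_nat m :: 'k alg_closure) = of_nat n" for m n
  proof (rule ccontr)
    assume "m \<noteq> n"
    then obtain k where "k > 0" "m = n + k \<or> n = m + k" by (metis less_imp_add_positive nat_neq_iff)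
    then have "(of_nat k :: 'k alg_closure) = 0" using that by auto
    then have "(of_nat k :: 'k) = 0" using to_ac_eq_0_iff[of "of_nat k :: 'k"] by simp
    then show False using char0[of k] \<open>k > 0\<close> by simp
  qed
  obtain d h where dh: "splitting A d h" using ex_splitting[OF one c simple] by blast
  note st = splitting_trace[OF dh]
  have card: "card I = d * d" by (rule inj) (rule st(1))
  have "I \<noteq> {}" using expand[of \<one>] one by auto
  then have "d > 0" using card card_gt_0_iff[of I] by (cases d) auto
  then have d0: "(of_nat d :: 'k) \<noteq> 0" using char0[of d] by auto
  moreover have "of_nat d * reduced_trace A a = trace (\<lambda>x. a \<otimes> x)" if a: "a \<in> carrier A" for a
  proof -
    have 1: "to_ac (trace (\<lambda>x. a \<otimes> x) / of_nat d) = mat_trace (h (AL.pt a 1))"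
    proof -
      have "(of_nat d :: 'k alg_closure) \<noteq> 0" using d0 to_ac_eq_0_iff[of "of_nat d :: 'k"] by simp
      then show ?thesis by (simp add: st(2)[OF a, symmetric])
    qed
    have "reduced_trace A a = trace (\<lambda>x. a \<otimes> x) / of_nat d"
      unfolding reduced_trace_def
    proof (rule the_equality)
      show "\<exists>n h. splitting A n h \<and> to_ac (trace (\<lambda>x. a \<otimes> x) / of_nat d) = mat_trace (h (AL.pt a 1))"
        using dh 1 by blast
      fix t assume "\<exists>n h. splitting A n h \<and> to_ac t = mat_trace (h (AL.pt a 1))"
      then obtain n h' where nh: "splitting A n h'" "to_ac t = mat_trace (h' (AL.pt a 1))" by blast
      have "n * n = d * d" using inj splitting_trace(1)[OF nh(1)] card by metis
      then have "n = d" using power2_eq_iff_nonneg[of n d] by (simp add: power2_eq_square)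
      then have "to_ac (of_nat d * t) = to_ac (trace (\<lambda>x. a \<otimes> x))"
        using splitting_trace(2)[OF nh(1) a] nh(2) by simp
      then have "of_nat d * t = trace (\<lambda>x. a \<otimes> x)" by (simp only: to_ac_eq_iff)
      then show "t = trace (\<lambda>x. a \<otimes> x) / of_nat d" using d0 by (simp add: field_simps)
    qed
    then show ?thesis using d0 by simp
  qed
  moreover have "trace (\<lambda>x. a \<otimes> x) = trace (\<lambda>x. x \<otimes> a)" if "a \<in> carrier A" for a
    using st(2)[OF that] st(3)[OF that] by (simp only: to_ac_eq_iff)
  ultimately show thesis using that \<open>d > 0\<close> card by blast
qed

end

section \<open>Hermitian forms and sums of hermitian squares\<close>

locale involutive_csa = algebra_with_basis A I b coord
  for A :: "('k::field, 'a) module" (structure) and I :: "'i set" and b coord +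
  fixes \<sigma> :: "'a \<Rightarrow> 'a"
  assumes one_neq_zero: "\<one> \<noteq> \<zero>"
    and central: "center A = scalars A"
    and simple: "ideal Q A \<Longrightarrow> Q = {\<zero>} \<or> Q = carrier A"
    and inv: "involution A \<sigma>"
    and char0: "of_nat n = (0::'k) \<Longrightarrow> n = 0"
begin

lemma s_closed [simp]: "x \<in> carrier A \<Longrightarrow> \<sigma> x \<in> carrier A"
  and s_s [simp]: "x \<in> carrier A \<Longrightarrow> \<sigma> (\<sigma> x) = x"
  and s_add: "x \<in> carrier A \<Longrightarrow> y \<in> carrier A \<Longrightarrow> \<sigma> (x \<oplus> y) = \<sigma> x \<oplus> \<sigma> y"
  and s_mult: "x \<in> carrier A \<Longrightarrow> y \<in> carrier A \<Longrightarrow> \<sigma> (x \<otimes> y) = \<sigma> y \<otimes> \<sigma> x"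
  using inv by (auto simp: involution_def)

lemma s_one: "\<sigma> \<one> = \<one>"
  using s_mult[of "\<sigma> \<one>" \<one>] by simp

lemma s_zero: "\<sigma> \<zero> = \<zero>"
  using s_add[of \<zero> \<zero>] by (intro add_self_zero) auto

abbreviation "cj \<equiv> center_conj A \<sigma>"
abbreviation "F \<equiv> fixed_field A \<sigma>"

text \<open>An anti-automorphism preserves the centre, and the centre consists of the scalars; so
  the description in \<open>center_conj\<close> denotes.\<close>

lemma s_scalar: "\<sigma> (c \<odot> \<one>) = cj c \<odot> \<one>"
proof -
  have "\<sigma> (c \<odot> \<one>) \<in> center A"
    unfolding center_def
  proof (safe)
    fix x assume x: "x \<in> carrier A"
    have "\<sigma> (\<sigma> x \<otimes> (c \<odot> \<one>)) = \<sigma> ((c \<odot> \<one>) \<otimes> \<sigma> x)" using x by (simp add: smult_mult_l smult_mult_r)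
    then show "\<sigma> (c \<odot> \<one>) \<otimes> x = x \<otimes> \<sigma> (c \<odot> \<one>)" using x by (simp add: s_mult)
  qed simp
  then obtain d where d: "\<sigma> (c \<odot> \<one>) = d \<odot> \<one>" using central by (auto simp: scalars_def)
  have "cj c = d"
    unfolding center_conj_def by (rule the_equality) (use d smult_one_inj[OF one_neq_zero] in auto)
  then show ?thesis using d by simp
qed

lemma scalar_eq_iff [simp]: "c \<odot> \<one> = d \<odot> \<one> \<longleftrightarrow> c = d"
  using smult_one_inj[OF one_neq_zero] by blast

lemma s_smult: "x \<in> carrier A \<Longrightarrow> \<sigma> (c \<odot> x) = cj c \<odot> \<sigma> x"
  using s_mult[of "c \<odot> \<one>" x] by (simp add: s_scalar smult_mult_l smult_mult_r)

lemma cj_cj [simp]: "cj (cj c) = c"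
  using s_s[of "c \<odot> \<one>"] by (simp add: s_scalar)

lemma cj_add: "cj (c + d) = cj c + cj d"
proof -
  have "cj (c + d) \<odot> \<one> = (cj c + cj d) \<odot> \<one>"
    unfolding smult_l_distr[OF one_closed] by (simp add: s_add flip: s_scalar smult_l_distr)
      (simp add: smult_l_distr s_add)
  then show ?thesis by simp
qed

lemma cj_mult: "cj (c * d) = cj c * cj d"
proof -
  have "cj (c * d) \<odot> \<one> = (cj c * cj d) \<odot> \<one>"
    by (simp add: smult_assoc s_smult s_scalar flip: s_scalar)
  then show ?thesis by simp
qed

lemma cj_one [simp]: "cj 1 = 1" and cj_zero [simp]: "cj 0 = 0"
  using s_scalar[of 1] s_scalar[of 0] scalar_eq_iff[of "cj 1" 1] scalar_eq_iff[of "cj 0" 0]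
  by (simp_all add: s_one s_zero del: scalar_eq_iff)

lemma cj_minus: "cj (- c) = - cj c"
  using cj_add[of c "- c"] by (simp add: eq_neg_iff_add_eq_0 add.commute)

lemma cj_diff: "cj (c - d) = cj c - cj d"
  using cj_add[of c "- d"] by (simp add: cj_minus)

lemma cj_inverse: "cj (inverse c) = inverse (cj c)"
proof (cases "c = 0")
  case False
  then have "cj c * cj (inverse c) = 1" by (simp flip: cj_mult)
  then show ?thesis by (simp add: inverse_unique)
qed simp

lemma cj_divide: "cj (c / d) = cj c / cj d"
  by (simp add: divide_inverse cj_mult cj_inverse)

lemma cj_of_nat [simp]: "cj (of_nat n) = of_nat n"
  by (induction n) (simp_all add: cj_add)

lemma cj_sum: "cj (sum f J) = (\<Sum>j\<in>J. cj (f j))"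
  by (induction J rule: infinite_finite_induct) (simp_all add: cj_add)

lemma F_iff: "c \<in> F \<longleftrightarrow> cj c = c"
  by (simp add: fixed_field_def s_scalar)

lemma F_subfield: "is_subfield F"
  by (simp add: is_subfield_def F_iff cj_diff cj_mult cj_inverse)

section \<open>The regular trace and the involution\<close>

definition tr :: "'a \<Rightarrow> 'k"
  where "tr x = trace (\<lambda>y. x \<otimes> y)"

lemma tr_alt: "tr x = (\<Sum>i\<in>I. coord i (x \<otimes> b i))"
  by (simp add: tr_def trace_def)

lemma linear_functional_tr: "linear_functional A (carrier A) tr"
  unfolding linear_functional_def tr_alt
  by (auto simp: l_distr coord_add sum.distrib smult_mult_l coord_smult sum_distrib_left)

lemma tr_add: "x \<in> carrier A \<Longrightarrow> y \<in> carrier A \<Longrightarrow> tr (x \<oplus> y) = tr x + tr y"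
  and tr_smult: "x \<in> carrier A \<Longrightarrow> tr (c \<odot> x) = c * tr x"
  using linear_functional_tr by (auto simp: linear_functional_def)

lemma lmult_endo: "x \<in> carrier A \<Longrightarrow> linear_endo A (carrier A) (\<lambda>y. x \<otimes> y)"
  by (auto simp: linear_endo_def r_distr smult_mult_r)

lemma tr_commute: "x \<in> carrier A \<Longrightarrow> y \<in> carrier A \<Longrightarrow> tr (x \<otimes> y) = tr (y \<otimes> x)"
  using trace_comp_commute[OF lmult_endo lmult_endo, of x y]
  unfolding tr_def trace_def by (simp add: m_assoc cong: sum.cong)

lemma reduced_degree:
  obtains d where "d > 0" "\<And>a. a \<in> carrier A \<Longrightarrow> of_nat d * reduced_trace A a = tr a"
    "\<And>a. a \<in> carrier A \<Longrightarrow> tr a = trace (\<lambda>x. x \<otimes> a)"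
proof -
  obtain d where "d > 0" "card I = d * d"
    "\<And>a. a \<in> carrier A \<Longrightarrow> of_nat d * reduced_trace A a = trace (\<lambda>x. a \<otimes> x)"
    "\<And>a. a \<in> carrier A \<Longrightarrow> trace (\<lambda>x. a \<otimes> x) = trace (\<lambda>x. x \<otimes> a)"
    using reduced_trace_eq[OF one_neq_zero central simple char0] by blast
  with that show thesis unfolding tr_def by blast
qed

text \<open>In the basis transported by \<open>\<sigma>\<close>, left multiplication by
  \<open>\<sigma> x\<close> becomes right multiplication by \<open>x\<close>, with coordinates
  conjugated. Left and right multiplication by \<open>x\<close> have the same trace by comparison
  with matrices.\<close>

lemma tr_s: "x \<in> carrier A \<Longrightarrow> tr (\<sigma> x) = cj (tr x)"
proof -
  assume x: "x \<in> carrier A"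
  have B: "based_space A (carrier A) I (\<lambda>i. \<sigma> (b i)) (\<lambda>i x. cj (coord i (\<sigma> x)))"
    by (rule based_space_transport[OF based_space_axioms algebra_over_axioms, where s = cj and s' = cj])
      (auto simp: s_add s_smult cj_add cj_mult)
  have "tr (\<sigma> x) = (\<Sum>i\<in>I. cj (coord i (\<sigma> (\<sigma> x \<otimes> \<sigma> (b i)))))"
    unfolding tr_def using trace_basis_independent[OF B lmult_endo, of "\<sigma> x"] x
    by (simp add: based_space.trace_def[OF B])
  also have "\<dots> = cj (trace (\<lambda>y. y \<otimes> x))"
    using x unfolding trace_def cj_sum by (intro sum.cong) (auto simp: s_mult)
  also have "trace (\<lambda>y. y \<otimes> x) = tr x"
    by (rule reduced_degree) (use x in simp)
  finally show ?thesis .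
qed

text \<open>The radical of the trace form is a two-sided ideal, since the trace is symmetric. It
  omits the unit because \<open>tr \<one>\<close> is the dimension, nonzero in characteristic 0; so
  it vanishes by simplicity.\<close>

lemma tr_nondegenerate:
  assumes "x \<in> carrier A" "\<And>y. y \<in> carrier A \<Longrightarrow> tr (y \<otimes> x) = 0"
  shows "x = \<zero>"
proof -
  define Q where "Q = {x \<in> carrier A. \<forall>y\<in>carrier A. tr (y \<otimes> x) = 0}"
  have l: "z \<otimes> q \<in> Q" if "q \<in> Q" "z \<in> carrier A" for q z
    using that by (auto simp: Q_def simp flip: m_assoc)
  have "ideal Q A"
  proof (rule idealI[OF ring_axioms])
    show "subgroup Q (add_monoid A)"
    proof (rule add.subgroupI)
      show "\<ominus> q \<in> Q" if "q \<in> Q" for q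
        using l[OF that, of "\<ominus> \<one>"] that by (simp add: l_minus Q_def)
      have "tr \<zero> = 0" using tr_smult[of \<zero> 0] by simp
      then show "Q \<noteq> {}" by (auto simp: Q_def intro!: exI[of _ \<zero>])
    qed (auto simp: Q_def r_distr tr_add)
    show "q \<otimes> z \<in> Q" if "q \<in> Q" "z \<in> carrier A" for q z
    proof -
      have "tr (y \<otimes> (q \<otimes> z)) = 0" if y: "y \<in> carrier A" for y
        using tr_commute[of "y \<otimes> q" z] y \<open>q \<in> Q\<close> \<open>z \<in> carrier A\<close> by (simp add: Q_def m_assoc[symmetric])
      then show ?thesis using that by (simp add: Q_def)
    qed
  qed (use l in auto)
  moreover have "\<one> \<notin> Q"
  proof
    assume "\<one> \<in> Q"
    then have "tr \<one> = 0" by (auto simp: Q_def dest!: bspec[of _ _ \<one>])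
    moreover have "tr \<one> = of_nat (card I)" by (simp add: tr_alt coord_b)
    ultimately have "card I = 0" using char0 by metis
    then have "I = {}" by simp
    then show False using expand[of \<one>] one_neq_zero by simp
  qed
  ultimately have "Q = {\<zero>}" using simple[of Q] by auto
  then show ?thesis using assms by (auto simp: Q_def)
qed

section \<open>Hermitian forms and their diagonalisation\<close>

definition H :: "'a \<Rightarrow> 'a \<Rightarrow> 'k"
  where "H x y = tr (\<sigma> x \<otimes> y)"

definition hermitian :: "('a \<Rightarrow> 'a \<Rightarrow> 'k) \<Rightarrow> bool"
  where "hermitian q \<longleftrightarrow> (\<forall>x\<in>carrier A. linear_functional A (carrier A) (q x)) \<and>
    (\<forall>x\<in>carrier A. \<forall>y\<in>carrier A. q y x = cj (q x y))"

text \<open>Representability by \<open>H\<close> is carried through the diagonalisation in place of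
  a duality theorem for arbitrary functionals; for the form \<open>H x (a \<otimes> y)\<close> the
  representing element is simply \<open>a \<otimes> x\<close>.\<close>

definition represented :: "('a \<Rightarrow> 'a \<Rightarrow> 'k) \<Rightarrow> bool"
  where "represented q \<longleftrightarrow> (\<forall>x\<in>carrier A. \<exists>g\<in>carrier A. \<forall>y\<in>carrier A. q x y = H g y)"

lemma hermitianD:
  assumes "hermitian q"
  shows "x \<in> carrier A \<Longrightarrow> y \<in> carrier A \<Longrightarrow> z \<in> carrier A \<Longrightarrow> q x (y \<oplus> z) = q x y + q x z"
    and "x \<in> carrier A \<Longrightarrow> y \<in> carrier A \<Longrightarrow> q x (c \<odot> y) = c * q x y"
    and "x \<in> carrier A \<Longrightarrow> y \<in> carrier A \<Longrightarrow> q y x = cj (q x y)"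
  using assms unfolding hermitian_def linear_functional_def by blast+

lemma hermitian_left:
  assumes q: "hermitian q"
  shows "x \<in> carrier A \<Longrightarrow> y \<in> carrier A \<Longrightarrow> z \<in> carrier A \<Longrightarrow> q (y \<oplus> z) x = q y x + q z x"
    and "x \<in> carrier A \<Longrightarrow> y \<in> carrier A \<Longrightarrow> q (c \<odot> y) x = cj c * q y x"
  using hermitianD(3)[OF q, of x] by (simp_all add: hermitianD(1,2)[OF q] cj_add cj_mult)

lemma hermitian_H: "hermitian H"
  unfolding hermitian_def H_def linear_functional_def
proof (intro conjI ballI allI)
  fix x y assume "x \<in> carrier A" "y \<in> carrier A"
  then show "tr (\<sigma> y \<otimes> x) = cj (tr (\<sigma> x \<otimes> y))" using tr_s[of "\<sigma> x \<otimes> y"] by (simp add: s_mult)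
qed (auto simp: r_distr tr_add tr_smult smult_mult_r)

lemma H_nondegenerate:
  assumes "x \<in> carrier A" "y \<in> carrier A" "\<And>z. z \<in> carrier A \<Longrightarrow> H z x = H z y"
  shows "x = y"
proof -
  have "x \<oplus> \<ominus> y = \<zero>"
  proof (rule tr_nondegenerate)
    fix z assume z: "z \<in> carrier A"
    have "tr (z \<otimes> (\<ominus> y)) = - tr (z \<otimes> y)"
      using tr_smult[of "z \<otimes> y" "- 1"] z assms(2) by (simp add: smult_minus_l r_minus)
    then show "tr (z \<otimes> (x \<oplus> \<ominus> y)) = 0"
      using assms(3)[of "\<sigma> z"] z assms(1,2) by (simp add: r_distr tr_add H_def)
  qed (use assms in auto)
  then show ?thesis using assms by (metis a_inv_closed minus_equality minus_minus)
qed

text \<open>One step of the Gram-Schmidt process: \<open>q\<close> evaluated on the components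
  orthogonal to \<open>f\<close>. The result is again a form on the whole space, with
  \<open>f\<close> in its kernel.\<close>

definition peel :: "('a \<Rightarrow> 'a \<Rightarrow> 'k) \<Rightarrow> 'a \<Rightarrow> 'a \<Rightarrow> 'a \<Rightarrow> 'k"
  where "peel q f x y = q x y - q x f * q f y / q f f"

text \<open>The denominators have to be values of \<open>q\<close> itself, since it is values of
  forms that are known to lie in the preordering. Writing the rank one terms with \<open>H\<close>
  makes \<open>g\<close> an element of the algebra, from which a hermitian square can be
  formed.\<close>

definition diagonalised :: "('a \<Rightarrow> 'a \<Rightarrow> 'k) \<Rightarrow> bool"
  where "diagonalised q \<longleftrightarrow> (\<exists>ps. (\<forall>(d, g)\<in>set ps. g \<in> carrier A \<and> d \<noteq> 0 \<and> (\<exists>f\<in>carrier A. d = q f f)) \<and>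
    (\<forall>x\<in>carrier A. \<forall>y\<in>carrier A. q x y = (\<Sum>(d, g)\<leftarrow>ps. H x g * H g y / d)))"

context
  fixes q f assumes q: "hermitian q" and f: "f \<in> carrier A" and qf: "q f f \<noteq> 0"
begin

lemma hermitian_peel: "hermitian (peel q f)"
  unfolding hermitian_def linear_functional_def peel_def
proof (intro conjI ballI allI)
  fix x y assume xy: "x \<in> carrier A" "y \<in> carrier A"
  have "cj (q f f) = q f f" using hermitianD(3)[OF q f f] by simp
  then show "q y x - q y f * q f x / q f f = cj (q x y - q x f * q f y / q f f)"
    using hermitianD(3)[OF q xy] hermitianD(3)[OF q f xy(2)] hermitianD(3)[OF q xy(1) f]
    by (simp add: cj_diff cj_divide cj_mult mult.commute)
qed (use f in \<open>simp_all add: hermitianD(1,2)[OF q] field_simps diff_divide_distrib add_divide_distrib\<close>)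

lemma peel_self: "y \<in> carrier A \<Longrightarrow> peel q f f y = 0"
  using qf by (simp add: peel_def)

lemma peel_kernel:
  assumes "x \<in> carrier A" "\<And>y. y \<in> carrier A \<Longrightarrow> q x y = 0" "y \<in> carrier A"
  shows "peel q f x y = 0"
  using assms f by (simp add: peel_def)

lemma represented_peel:
  assumes r: "represented q" shows "represented (peel q f)"
  unfolding represented_def
proof
  fix x assume x: "x \<in> carrier A"
  obtain g g' where g: "g \<in> carrier A" "\<And>y. y \<in> carrier A \<Longrightarrow> q x y = H g y"
    "g' \<in> carrier A" "\<And>y. y \<in> carrier A \<Longrightarrow> q f y = H g' y"
    using r x f unfolding represented_def by metis
  \<comment> \<open>The coefficient is conjugated because \<open>H\<close> is conjugate linear in
    its first argument.\<close>
  let ?c = "cj (- (q x f / q f f))"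
  have "peel q f x y = H (g \<oplus> ?c \<odot> g') y" if "y \<in> carrier A" for y
    using that g by (simp add: hermitian_left[OF hermitian_H] peel_def del: cj_cj) (simp add: cj_minus cj_divide)
  then show "\<exists>g\<in>carrier A. \<forall>y\<in>carrier A. peel q f x y = H g y"
    using g by (intro bexI[of _ "g \<oplus> ?c \<odot> g'"]) auto
qed

text \<open>The witness is the component of \<open>x\<close> orthogonal to \<open>f\<close>. Thus
  denominators found for the peeled form are values of \<open>q\<close> as well.\<close>

lemma peel_value:
  assumes x: "x \<in> carrier A"
  shows "\<exists>x'\<in>carrier A. peel q f x x = q x' x'"
proof
  let ?c = "- (q f x / q f f)"
  let ?x = "x \<oplus> ?c \<odot> f"
  have cf: "cj (q f f) = q f f" using hermitianD(3)[OF q f f] by simp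
  have "q ?x ?x = q x x + ?c * q x f + cj ?c * (q f x + ?c * q f f)"
    using x f by (simp add: hermitianD(1,2)[OF q] hermitian_left[OF q] algebra_simps del: minus_divide_left)
  also have "q f x + ?c * q f f = 0" using qf by simp
  also have "q x x + ?c * q x f + cj ?c * 0 = peel q f x x"
    by (simp add: peel_def mult.commute)
  finally show "peel q f x x = q ?x ?x" by simp
qed (use x f in auto)

text \<open>The split-off term \<open>q x f * q f y / q f f\<close> equals
  \<open>H x g * H g y / q f f\<close>, where \<open>g\<close> represents \<open>q f\<close>; this
  adds one pair to the list.\<close>

lemma diagonalised_peel:
  assumes r: "represented q" and d: "diagonalised (peel q f)"
  shows "diagonalised q"
proof -
  obtain ps where ps: "\<And>d g. (d, g) \<in> set ps \<Longrightarrow> g \<in> carrier A \<and> d \<noteq> 0 \<and> (\<exists>f'\<in>carrier A. d = peel q f f' f')"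
    "\<And>x y. x \<in> carrier A \<Longrightarrow> y \<in> carrier A \<Longrightarrow> peel q f x y = (\<Sum>(d, g)\<leftarrow>ps. H x g * H g y / d)"
    using d unfolding diagonalised_def by blast
  obtain g where g: "g \<in> carrier A" "\<And>y. y \<in> carrier A \<Longrightarrow> q f y = H g y"
    using r f unfolding represented_def by blast
  have "q x y = (\<Sum>(d, g)\<leftarrow>(q f f, g) # ps. H x g * H g y / d)" if xy: "x \<in> carrier A" "y \<in> carrier A" for x y
  proof -
    have "q x f = H x g"
      using hermitianD(3)[OF q f xy(1)] hermitianD(3)[OF hermitian_H g(1) xy(1)] g(2)[OF xy(1)] by simp
    then show ?thesis using ps(2)[OF xy] g(2)[OF xy(2)] by (simp add: peel_def algebra_simps)
  qed
  moreover have "\<forall>(d, g)\<in>set ((q f f, g) # ps). g \<in> carrier A \<and> d \<noteq> 0 \<and> (\<exists>f\<in>carrier A. d = q f f)"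
  proof (clarify)
    fix d g' assume "(d, g') \<in> set ((q f f, g) # ps)"
    then have "(d = q f f \<and> g' = g) \<or> (d, g') \<in> set ps" by (simp only: list.set insert_iff prod.inject)
    then consider "d = q f f" "g' = g" | "(d, g') \<in> set ps" by blast
    then show "g' \<in> carrier A \<and> d \<noteq> 0 \<and> (\<exists>f\<in>carrier A. d = q f f)"
    proof cases
      case 1
      show ?thesis unfolding 1 using f g(1) qf by (intro conjI bexI[of _ f]) simp_all
    next
      case 2
      then obtain f' where "f' \<in> carrier A" "d = peel q f f' f'" using ps(1) by blast
      then show ?thesis using ps(1)[OF 2] peel_value by metis
    qed
  qed
  ultimately show ?thesis unfolding diagonalised_def by blast
qed

end

text \<open>\<open>S\<close> contains the indices of all basis vectors not known to lie in the
  kernel of \<open>q\<close>. Splitting off vectors moves indices out of \<open>S\<close> while the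
  space stays fixed, so no basis of an orthogonal complement has to be found. The case
  \<open>off\<close> treats a form that is nonzero although it vanishes on the remaining basis
  vectors it involves.\<close>

lemma diagonalised:
  assumes "hermitian q" "represented q" "S \<subseteq> I"
    and "\<And>j y. j \<in> I - S \<Longrightarrow> y \<in> carrier A \<Longrightarrow> q (b j) y = 0"
  shows "diagonalised q"
  using assms
proof (induction "card S" arbitrary: S q rule: less_induct)
  case less
  note q = less.prems(1)
  have finS: "finite S" using less.prems(3) finite_subset finite_I by blast
  have smaller: "card (S - S') < card S" if "i \<in> S'" "i \<in> S" for i S'
    using finS that by (intro psubset_card_mono) auto
  consider (zero) "\<And>i j. i \<in> S \<Longrightarrow> j \<in> S \<Longrightarrow> q (b i) (b j) = 0"
    | (diag) i where "i \<in> S" "q (b i) (b i) \<noteq> 0"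
    | (off) i j where "i \<in> S" "j \<in> S" "q (b i) (b j) \<noteq> 0" "q (b i) (b i) = 0" "q (b j) (b j) = 0"
    by metis
  then show ?case
  proof cases
    case zero
    have bb: "q (b i) (b j) = 0" if "i \<in> I" "j \<in> I" for i j
      using zero[of i j] less.prems(4)[of i "b j"] less.prems(4)[of j "b i"] hermitianD(3)[OF q, of "b j" "b i"] that
      by (cases "i \<in> S"; cases "j \<in> S") auto
    have "q x y = 0" if x: "x \<in> carrier A" and y: "y \<in> carrier A" for x y
    proof -
      have l: "linear_functional A (carrier A) (q z)" if "z \<in> carrier A" for z
        using q that by (simp add: hermitian_def)
      have "q (b j) x = 0" if "j \<in> I" for j
        using functional_expand[OF l x, of "b j"] bb that by simp
      then have "q x (b j) = 0" if "j \<in> I" for j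
        using hermitianD(3)[OF q, of "b j" x] x that by simp
      then show ?thesis using functional_expand[OF l y, of x] x by simp
    qed
    then show ?thesis unfolding diagonalised_def by (intro exI[of _ "[]"]) auto
  next
    case diag
    have i: "b i \<in> carrier A" using diag less.prems(3) by auto
    have "diagonalised (peel q (b i))"
    proof (rule less.hyps[of "S - {i}"])
      show "card (S - {i}) < card S" using smaller diag by blast
      show "peel q (b i) (b j) y = 0" if "j \<in> I - (S - {i})" "y \<in> carrier A" for j y
        using that peel_self[OF q i diag(2)] peel_kernel[OF q i diag(2), of "b j" y] less.prems(4)[of j]
        by (cases "j = i") auto
    qed (use hermitian_peel[OF q i diag(2)] represented_peel[OF q i diag(2)] less.prems in auto)
    then show ?thesis by (rule diagonalised_peel[OF q i diag(2) less.prems(2)])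
  next
    case off
    \<comment> \<open>Splitting off \<open>b i + k b j\<close>, on which \<open>q\<close> is \<open>2\<close>, makes \<open>b i\<close> nonisotropic; splitting off
      \<open>b i\<close> as well puts both \<open>b i\<close> and \<open>b j\<close> into the kernel.\<close>
    have i: "b i \<in> carrier A" and j: "b j \<in> carrier A" using off less.prems(3) by auto
    define k where "k = inverse (q (b i) (b j))"
    define f where "f = b i \<oplus> k \<odot> b j"
    have k: "k \<noteq> 0" "k * q (b i) (b j) = 1" using off by (simp_all add: k_def)
    have f: "f \<in> carrier A" using i j by (simp add: f_def)
    have two: "(2::'k) \<noteq> 0" using char0[of 2] by auto
    have qji: "cj k * q (b j) (b i) = 1"
      using arg_cong[OF k(2), of cj] hermitianD(3)[OF q i j] by (simp add: cj_mult)
    have qif: "q (b i) f = 1" "q f (b i) = 1"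
      using i j off k qji by (simp_all add: f_def hermitianD(1,2)[OF q] hermitian_left[OF q])
    have "q (b j) f = q (b j) (b i)" using i j off by (simp add: f_def hermitianD(1,2)[OF q])
    then have "q f f = 1 + 1"
      using i j f qif qji by (subst (1) f_def) (simp add: hermitian_left[OF q])
    then have qff: "q f f = 2" by simp
    then have qf: "q f f \<noteq> 0" using two by simp
    let ?q1 = "peel q f"
    note h1 = hermitian_peel[OF q f qf] and r1 = represented_peel[OF q f qf less.prems(2)]
    have "?q1 (b i) (b i) = - 1 / 2" using off qif qff by (simp add: peel_def)
    then have q1: "?q1 (b i) (b i) \<noteq> 0" using two by simp
    let ?q2 = "peel ?q1 (b i)"
    note h2 = hermitian_peel[OF h1 i q1] and r2 = represented_peel[OF h1 i q1 r1]
    have kf: "?q2 f y = 0" if "y \<in> carrier A" for y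
      using peel_kernel[OF h1 i q1 f _ that] peel_self[OF q f qf] by blast
    have ki: "?q2 (b i) y = 0" if "y \<in> carrier A" for y
      using peel_self[OF h1 i q1 that] .
    have kj: "?q2 (b j) y = 0" if y: "y \<in> carrier A" for y
    proof -
      have "?q2 (b i \<oplus> k \<odot> b j) y = ?q2 (b i) y + cj k * ?q2 (b j) y"
        using i j y by (simp add: hermitian_left[OF h2])
      then have "cj k * ?q2 (b j) y = 0" using kf[OF y] ki[OF y] by (simp flip: f_def)
      then show ?thesis using qji by auto
    qed
    have "diagonalised ?q2"
    proof (rule less.hyps[of "S - {i, j}"])
      show "card (S - {i, j}) < card S" using smaller off by blast
      show "?q2 (b l) y = 0" if "l \<in> I - (S - {i, j})" "y \<in> carrier A" for l y
      proof (cases "l = i \<or> l = j")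
        case True
        then show ?thesis using ki kj that by auto
      next
        case False
        then have l: "b l \<in> carrier A" "\<And>y. y \<in> carrier A \<Longrightarrow> q (b l) y = 0" using that less.prems(4) by auto
        show ?thesis
          by (rule peel_kernel[OF h1 i q1 l(1) _ that(2)]) (rule peel_kernel[OF q f qf l])
      qed
    qed (use h2 r2 less.prems in auto)
    then show ?thesis
      using diagonalised_peel[OF h1 i q1 r1] diagonalised_peel[OF q f qf less.prems(2)] by blast
  qed
qed

text \<open>The form \<open>(x, y) \<mapsto> H x (a y)\<close> decomposes into rank one forms; comparing the traces of the
  operators \<open>y \<mapsto> x a y\<close> for all \<open>x\<close> recovers \<open>a\<close> itself.\<close>

lemma symmetric_decomposition:
  assumes a: "a \<in> Sym A \<sigma>"
  obtains m d g where "\<And>k. k < (m::nat) \<Longrightarrow> g k \<in> carrier A"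
    "\<And>k. k < m \<Longrightarrow> d k \<noteq> 0 \<and> (\<exists>f\<in>carrier A. d k = H f (a \<otimes> f))"
    "a = (\<Oplus>k\<in>{..<m}. inverse (d k) \<odot> (g k \<otimes> \<sigma> (g k)))"
    "\<And>x y. x \<in> carrier A \<Longrightarrow> y \<in> carrier A \<Longrightarrow> H x (a \<otimes> y) = (\<Sum>k<m. H x (g k) * H (g k) y / d k)"
proof -
  have aA: "a \<in> carrier A" and sa: "\<sigma> a = a" using a by (auto simp: Sym_def)
  define q where "q x y = H x (a \<otimes> y)" for x y
  \<comment> \<open>Multiplication by the symmetric \<open>a\<close> is self-adjoint for
    \<open>H\<close>; hence \<open>q\<close> is hermitian, and \<open>a \<otimes> x\<close>
    represents \<open>q x\<close>.\<close>
  have Ha: "H x (a \<otimes> y) = H (a \<otimes> x) y" if "x \<in> carrier A" "y \<in> carrier A" for x y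
    using that aA sa by (simp add: H_def s_mult m_assoc)
  have "hermitian q"
    unfolding hermitian_def linear_functional_def q_def
  proof (intro conjI ballI allI)
    fix x y assume "x \<in> carrier A" "y \<in> carrier A"
    then show "H y (a \<otimes> x) = cj (H x (a \<otimes> y))"
      using hermitianD(3)[OF hermitian_H, of x "a \<otimes> y"] Ha[of y x] aA by simp
  qed (use aA in \<open>simp_all add: r_distr smult_mult_r hermitianD(1,2)[OF hermitian_H]\<close>)
  moreover have "represented q"
    unfolding represented_def q_def using aA Ha by (intro ballI bexI[of _ "a \<otimes> _"]) auto
  ultimately have "diagonalised q" by (rule diagonalised[of q I]) auto
  then obtain ps where ps: "\<And>e g. (e, g) \<in> set ps \<Longrightarrow> g \<in> carrier A \<and> e \<noteq> 0 \<and> (\<exists>f\<in>carrier A. e = q f f)"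
    "\<And>x y. x \<in> carrier A \<Longrightarrow> y \<in> carrier A \<Longrightarrow> q x y = (\<Sum>(e, g)\<leftarrow>ps. H x g * H g y / e)"
    unfolding diagonalised_def by blast
  define m where "m = length ps"
  define d g where "d k = fst (ps ! k)" and "g k = snd (ps ! k)" for k
  have mem: "(d k, g k) \<in> set ps" if "k < m" for k using that by (simp add: d_def g_def m_def)
  have g: "g k \<in> carrier A" and dk: "d k \<noteq> 0 \<and> (\<exists>f\<in>carrier A. d k = H f (a \<otimes> f))" if "k < m" for k
    using ps(1)[OF mem[OF that]] by (auto simp: q_def)
  have qs: "H x (a \<otimes> y) = (\<Sum>k<m. H x (g k) * H (g k) y / d k)" if "x \<in> carrier A" "y \<in> carrier A" for x y
    using ps(2)[OF that] by (simp add: q_def sum_list_sum_nth m_def d_def g_def case_prod_beta lessThan_atLeast0)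
  have lH: "linear_functional A (carrier A) (H z)" if "z \<in> carrier A" for z
    using hermitian_H that by (simp add: hermitian_def)
  \<comment> \<open>Nondegeneracy of \<open>H\<close> turns the decomposition of the form into one
    of the operator, with terms that send \<open>y\<close> to a multiple of the fixed vector
    \<open>x \<otimes> g k\<close>.\<close>
  have xay: "x \<otimes> (a \<otimes> y) = (\<Oplus>k\<in>{..<m}. (H (g k) y / d k) \<odot> (x \<otimes> g k))"
    if x: "x \<in> carrier A" and y: "y \<in> carrier A" for x y
  proof (rule H_nondegenerate)
    fix z assume z: "z \<in> carrier A"
    have Hx: "H z (x \<otimes> w) = H (\<sigma> x \<otimes> z) w" if "w \<in> carrier A" for w
      using that x z by (simp add: H_def s_mult m_assoc)
    have "H z (x \<otimes> (a \<otimes> y)) = (\<Sum>k<m. H (\<sigma> x \<otimes> z) (g k) * H (g k) y / d k)"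
      using x y z aA by (simp add: Hx qs)
    also have "\<dots> = (\<Sum>k<m. H z ((H (g k) y / d k) \<odot> (x \<otimes> g k)))"
      using x z g by (intro sum.cong) (auto simp: hermitianD(2)[OF hermitian_H] Hx)
    also have "\<dots> = H z (\<Oplus>k\<in>{..<m}. (H (g k) y / d k) \<odot> (x \<otimes> g k))"
      using x g by (intro functional_finsum[OF lH[OF z], symmetric]) auto
    finally show "H z (x \<otimes> (a \<otimes> y)) = H z (\<Oplus>k\<in>{..<m}. (H (g k) y / d k) \<odot> (x \<otimes> g k))" .
  qed (use x y aA g in \<open>auto intro!: finsum_closed\<close>)
  define a' where "a' = (\<Oplus>k\<in>{..<m}. inverse (d k) \<odot> (g k \<otimes> \<sigma> (g k)))"
  have a': "a' \<in> carrier A" unfolding a'_def using g by (intro finsum_closed) auto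
  have tra: "tr (x \<otimes> a) = tr (x \<otimes> a')" if x: "x \<in> carrier A" for x
  proof -
    have "tr (x \<otimes> a) = (\<Sum>i\<in>I. coord i (\<Oplus>k\<in>{..<m}. (H (g k) (b i) / d k) \<odot> (x \<otimes> g k)))"
      unfolding tr_alt using x aA by (intro sum.cong) (auto simp: xay m_assoc)
    also have "\<dots> = (\<Sum>i\<in>I. \<Sum>k<m. coord i ((H (g k) (b i) / d k) \<odot> (x \<otimes> g k)))"
      using x g by (intro sum.cong refl coord_finsum) auto
    also have "\<dots> = (\<Sum>k<m. \<Sum>i\<in>I. coord i ((H (g k) (b i) / d k) \<odot> (x \<otimes> g k)))" by (rule sum.swap)
    \<comment> \<open>The trace of a rank one operator is its functional evaluated at its vector,
      here \<open>H (g k) / d k\<close> at \<open>x \<otimes> g k\<close>.\<close>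
    also have "\<dots> = (\<Sum>k<m. inverse (d k) * H (g k) (x \<otimes> g k))"
    proof (intro sum.cong refl)
      fix k assume "k \<in> {..<m}"
      then have gk: "g k \<in> carrier A" using g by simp
      have "(\<Sum>i\<in>I. coord i ((H (g k) (b i) / d k) \<odot> (x \<otimes> g k)))
          = (\<Sum>i\<in>I. inverse (d k) * (coord i (x \<otimes> g k) * H (g k) (b i)))"
        using x gk by (intro sum.cong) (auto simp: coord_smult divide_inverse)
      also have "\<dots> = inverse (d k) * H (g k) (x \<otimes> g k)"
        using functional_expand[OF lH[OF gk], of "x \<otimes> g k"] x gk by (simp add: sum_distrib_left)
      finally show "(\<Sum>i\<in>I. coord i ((H (g k) (b i) / d k) \<odot> (x \<otimes> g k))) = inverse (d k) * H (g k) (x \<otimes> g k)" .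
    qed
    also have "\<dots> = (\<Sum>k<m. tr (inverse (d k) \<odot> (x \<otimes> (g k \<otimes> \<sigma> (g k)))))"
      using x g by (intro sum.cong) (auto simp: tr_smult H_def tr_commute[of "\<sigma> _" "x \<otimes> _"] m_assoc)
    also have "\<dots> = tr (\<Oplus>k\<in>{..<m}. inverse (d k) \<odot> (x \<otimes> (g k \<otimes> \<sigma> (g k))))"
      using x g by (intro functional_finsum[OF linear_functional_tr, symmetric]) auto
    also have "(\<Oplus>k\<in>{..<m}. inverse (d k) \<odot> (x \<otimes> (g k \<otimes> \<sigma> (g k)))) = (\<Oplus>k\<in>{..<m}. x \<otimes> (inverse (d k) \<odot> (g k \<otimes> \<sigma> (g k))))"
      using x g by (intro finsum_cong') (auto simp: smult_mult_r)
    also have "\<dots> = x \<otimes> a'" unfolding a'_def using x g by (intro finsum_rdistr[symmetric]) auto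
    finally show ?thesis .
  qed
  have "a = a'" using tra by (intro H_nondegenerate aA a') (simp add: H_def)
  with g dk qs that[of m g d] show thesis unfolding a'_def by blast
qed

section \<open>Sums of hermitian squares and the preordering of scalars\<close>

abbreviation "sohs \<equiv> sum_of_hermitian_squares A \<sigma>"

lemma sohs_zero: "sohs \<zero>"
  unfolding sum_of_hermitian_squares_def by (intro exI[of _ 0]) auto

lemma sohs_add_square:
  assumes "sohs x" "y \<in> carrier A" shows "sohs (x \<oplus> \<sigma> y \<otimes> y)"
proof -
  obtain m :: nat and z where z: "\<And>i. i < m \<Longrightarrow> z i \<in> carrier A" "x = (\<Oplus>i\<in>{..<m}. \<sigma> (z i) \<otimes> z i)"
    using assms(1) unfolding sum_of_hermitian_squares_def by blast
  have "(\<Oplus>i\<in>{..<m}. \<sigma> ((z(m := y)) i) \<otimes> (z(m := y)) i) = x"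
    unfolding z(2) using z(1) by (intro finsum_cong') auto
  moreover have "x \<in> carrier A" unfolding z(2) using z(1) by (intro finsum_closed) auto
  ultimately have "(\<Oplus>i\<in>{..<Suc m}. \<sigma> ((z(m := y)) i) \<otimes> (z(m := y)) i) = x \<oplus> \<sigma> y \<otimes> y"
    using z(1) assms(2) unfolding lessThan_Suc by (subst finsum_insert) (auto simp: a_comm)
  then show ?thesis
    unfolding sum_of_hermitian_squares_def using z(1) assms(2)
    by (intro exI[of _ "Suc m"] exI[of _ "z(m := y)"]) (auto simp: less_Suc_eq)
qed

lemma sohs_induct [consumes 1, case_names zero add]:
  assumes "sohs x" and zero: "P \<zero>"
    and add: "\<And>x y. sohs x \<Longrightarrow> x \<in> carrier A \<Longrightarrow> P x \<Longrightarrow> y \<in> carrier A \<Longrightarrow> P (x \<oplus> \<sigma> y \<otimes> y)"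
  shows "P x"
proof -
  obtain m :: nat and z where z: "\<And>i. i < m \<Longrightarrow> z i \<in> carrier A" "x = (\<Oplus>i\<in>{..<m}. \<sigma> (z i) \<otimes> z i)"
    using assms(1) unfolding sum_of_hermitian_squares_def by blast
  have "P (\<Oplus>i\<in>{..<n}. \<sigma> (z i) \<otimes> z i) \<and> sohs (\<Oplus>i\<in>{..<n}. \<sigma> (z i) \<otimes> z i)" if "n \<le> m" for n
    using that
  proof (induction n)
    case (Suc n)
    have zc: "z i \<in> carrier A" if "i < Suc n" for i using z(1) Suc.prems that by auto
    have c: "(\<Oplus>i\<in>{..<n}. \<sigma> (z i) \<otimes> z i) \<in> carrier A" using zc by (intro finsum_closed) auto
    have "(\<Oplus>i\<in>{..<Suc n}. \<sigma> (z i) \<otimes> z i) = (\<Oplus>i\<in>{..<n}. \<sigma> (z i) \<otimes> z i) \<oplus> \<sigma> (z n) \<otimes> z n"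
      unfolding lessThan_Suc using zc c by (subst finsum_insert) (auto simp: a_comm)
    then show ?case using Suc add[OF _ c _ zc[of n]] sohs_add_square zc[of n] by simp
  qed (use zero sohs_zero in simp)
  then show ?thesis unfolding z(2) by blast
qed

lemma sohs_carrier: "sohs x \<Longrightarrow> x \<in> carrier A"
  by (induction rule: sohs_induct) auto

lemma sohs_add:
  assumes x: "sohs x" and "sohs y" shows "sohs (x \<oplus> y)"
  using assms(2)
proof (induction y rule: sohs_induct)
  case (add y z)
  then have "sohs ((x \<oplus> y) \<oplus> \<sigma> z \<otimes> z)" by (intro sohs_add_square) auto
  then show ?case using add sohs_carrier[OF x] by (simp add: a_assoc)
qed (simp add: x sohs_carrier)

lemma sohs_square: "y \<in> carrier A \<Longrightarrow> sohs (\<sigma> y \<otimes> y)"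
  using sohs_add_square[OF sohs_zero, of y] by simp

lemma sohs_finsum: "(\<And>j. j \<in> J \<Longrightarrow> sohs (f j)) \<Longrightarrow> sohs (\<Oplus>j\<in>J. f j)"
proof (induction J rule: infinite_finite_induct)
  case (insert j J)
  then have "f \<in> J \<rightarrow> carrier A" "f j \<in> carrier A" using sohs_carrier by auto
  with insert show ?case by (simp add: sohs_add)
qed (simp_all add: sohs_zero finsum_infinite)

lemma sohs_conjugate: "sohs x \<Longrightarrow> q \<in> carrier A \<Longrightarrow> sohs (\<sigma> q \<otimes> x \<otimes> q)"
proof (induction rule: sohs_induct)
  case (add x y)
  have "\<sigma> q \<otimes> (x \<oplus> \<sigma> y \<otimes> y) \<otimes> q = \<sigma> q \<otimes> x \<otimes> q \<oplus> \<sigma> (y \<otimes> q) \<otimes> (y \<otimes> q)"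
    using add by (simp add: r_distr l_distr s_mult m_assoc)
  then show ?case using add sohs_add_square[of "\<sigma> q \<otimes> x \<otimes> q" "y \<otimes> q"] by simp
qed (simp add: sohs_zero)

definition hermitian_scalars :: "'k set"
  where "hermitian_scalars = {c \<in> F. sohs (c \<odot> \<one>)}"

text \<open>The product \<open>c \<odot> (\<sigma> y \<otimes> y)\<close> equals
  \<open>\<sigma> y \<otimes> (c \<odot> \<one>) \<otimes> y\<close>, a conjugate of the sum of
  hermitian squares \<open>c \<odot> \<one>\<close>.\<close>

lemma sohs_smult: "c \<in> hermitian_scalars \<Longrightarrow> sohs x \<Longrightarrow> sohs (c \<odot> x)"
proof -
  assume c: "c \<in> hermitian_scalars"
  assume "sohs x"
  then show ?thesis
  proof (induction rule: sohs_induct)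
    case (add x y)
    have "\<sigma> y \<otimes> (c \<odot> \<one>) \<otimes> y = c \<odot> (\<sigma> y \<otimes> y)"
      using add by (simp add: smult_mult_l smult_mult_r)
    moreover have "sohs (\<sigma> y \<otimes> (c \<odot> \<one>) \<otimes> y)"
      using c add by (intro sohs_conjugate) (auto simp: hermitian_scalars_def)
    ultimately show ?case using add by (simp add: smult_r_distr sohs_add)
  qed (simp add: sohs_zero)
qed

lemma preordering_hermitian_scalars: "preordering F hermitian_scalars"
  unfolding preordering_def
proof (intro conjI ballI)
  fix c d assume cd: "c \<in> hermitian_scalars" "d \<in> hermitian_scalars"
  then have "c \<in> F" "d \<in> F" "sohs (c \<odot> \<one>)" "sohs (d \<odot> \<one>)" by (auto simp: hermitian_scalars_def)
  then show "c + d \<in> hermitian_scalars" "c * d \<in> hermitian_scalars"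
    using cd by (auto simp: hermitian_scalars_def is_subfieldD[OF F_subfield] smult_l_distr sohs_add
      smult_assoc intro: sohs_smult)
next
  fix c assume c: "c \<in> F"
  have "\<sigma> (c \<odot> \<one>) \<otimes> (c \<odot> \<one>) = c\<^sup>2 \<odot> \<one>"
    using c by (simp add: s_scalar F_iff smult_mult_l smult_assoc power2_eq_square)
  then show "c\<^sup>2 \<in> hermitian_scalars"
    using sohs_square[of "c \<odot> \<one>"] c is_subfieldD[OF F_subfield]
    by (simp add: hermitian_scalars_def power2_eq_square)
qed (auto simp: hermitian_scalars_def)

text \<open>The reduced trace of a symmetric element is fixed by \<open>cj\<close>, so it lies in
  \<open>F\<close>, and \<open>Trd\<close> is either this trace or twice it, according to the kind
  of the involution. The regular trace is \<open>d\<close> times it; none of these factors affects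
  the sign.\<close>

lemma Trd_nonneg_iff:
  assumes P: "field_ordering F P" and y: "y \<in> Sym A \<sigma>"
  shows "(0, Trd A \<sigma> y) \<in> P \<longleftrightarrow> (0, tr y) \<in> P"
proof -
  obtain d where d: "d > 0" "\<And>a. a \<in> carrier A \<Longrightarrow> of_nat d * reduced_trace A a = tr a"
    "\<And>a. a \<in> carrier A \<Longrightarrow> tr a = trace (\<lambda>x. x \<otimes> a)"
    by (rule reduced_degree) (rule that; assumption)
  have yA: "y \<in> carrier A" "\<sigma> y = y" using y by (auto simp: Sym_def)
  have nz: "(of_nat n :: 'k) \<noteq> 0" if "n > 0" for n using that char0[of n] by auto
  have "cj (tr y) = tr y" using tr_s[OF yA(1)] yA(2) by simp
  then have "of_nat d * cj (reduced_trace A y) = of_nat d * reduced_trace A y"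
    using d(2)[OF yA(1)] by (metis cj_mult cj_of_nat)
  then have rF: "reduced_trace A y \<in> F" using nz[OF d(1)] by (simp add: F_iff)
  have "(0, tr y) \<in> P \<longleftrightarrow> (0, reduced_trace A y) \<in> P"
    using field_ordering_of_nat_mult_iff[OF F_subfield P nz[OF d(1)] rF] d(2)[OF yA(1)] by simp
  also have "\<dots> \<longleftrightarrow> (0, of_nat 2 * reduced_trace A y) \<in> P"
    using field_ordering_of_nat_mult_iff[OF F_subfield P nz[of 2] rF] by simp
  finally have "(0, tr y) \<in> P \<longleftrightarrow> (0, of_nat 2 * reduced_trace A y) \<in> P" .
  then show ?thesis
    using rF \<open>(0, tr y) \<in> P \<longleftrightarrow> (0, reduced_trace A y) \<in> P\<close> by (simp add: Trd_def F_iff)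
qed

lemma sigma_ordering_iff:
  "sigma_ordering A \<sigma> P \<longleftrightarrow> field_ordering F P \<and> (\<forall>x\<in>carrier A. (0, H x x) \<in> P)"
  using Trd_nonneg_iff[of P "\<sigma> _ \<otimes> _"]
  by (auto simp: sigma_ordering_def H_def Sym_def s_mult)

lemma sigma_positive_iff:
  assumes "field_ordering F P" "a \<in> Sym A \<sigma>"
  shows "sigma_positive A \<sigma> P a \<longleftrightarrow> (\<forall>x\<in>carrier A. (0, H x (a \<otimes> x)) \<in> P)"
proof -
  have "(0, Trd A \<sigma> (\<sigma> x \<otimes> a \<otimes> x)) \<in> P \<longleftrightarrow> (0, H x (a \<otimes> x)) \<in> P" if "x \<in> carrier A" for x
    using Trd_nonneg_iff[OF assms(1), of "\<sigma> x \<otimes> a \<otimes> x"] that assms(2)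
    by (auto simp: Sym_def H_def s_mult m_assoc)
  then show ?thesis by (simp add: sigma_positive_def)
qed

section \<open>The PS Conjecture as a condition on the form\<close>

lemma H_self_F: "x \<in> carrier A \<Longrightarrow> H x x \<in> F"
  using hermitianD(3)[OF hermitian_H, of x x] by (simp add: F_iff)

text \<open>The conjecture is applied to the scalar \<open>c \<odot> \<one>\<close> with
  \<open>c = H x x\<close>. It is totally positive, since
  \<open>H y (c \<odot> y) = c * H y y\<close> is a product of two elements that are nonnegative for
  each ordering concerned.\<close>

lemma PS_Conjecture_H:
  assumes "PS_Conjecture A \<sigma>" "x \<in> carrier A"
  shows "H x x \<in> hermitian_scalars"
proof -
  let ?c = "H x x"
  have c: "?c \<odot> \<one> \<in> Sym A \<sigma>" using H_self_F[OF assms(2)] by (simp add: Sym_def s_scalar F_iff)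
  have "sigma_positive A \<sigma> P (?c \<odot> \<one>)" if P: "sigma_ordering A \<sigma> P" for P
  proof -
    have "field_ordering F P" "\<And>x. x \<in> carrier A \<Longrightarrow> (0, H x x) \<in> P"
      using P by (auto simp: sigma_ordering_iff)
    then show ?thesis
      using field_ordering_mult_nonneg[OF F_subfield] assms(2) c
      by (simp add: sigma_positive_iff smult_mult_l hermitianD(2)[OF hermitian_H])
  qed
  then have "sohs (?c \<odot> \<one>)"
    using assms(1) c by (auto simp: PS_Conjecture_def totally_sigma_positive_def)
  then show ?thesis using H_self_F[OF assms(2)] by (simp add: hermitian_scalars_def)
qed

theorem PS_Conjecture_iff:
  "PS_Conjecture A \<sigma> \<longleftrightarrow> (\<forall>x\<in>carrier A. H x x \<in> hermitian_scalars)"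
proof
  assume hs: "\<forall>x\<in>carrier A. H x x \<in> hermitian_scalars"
  note M = preordering_hermitian_scalars
  have two: "(2::'k) \<noteq> 0" using char0[of 2] by auto
  show "PS_Conjecture A \<sigma>"
    unfolding PS_Conjecture_def totally_sigma_positive_def
  proof (safe)
    fix a assume a: "a \<in> Sym A \<sigma>" and pos: "\<forall>P. sigma_ordering A \<sigma> P \<longrightarrow> sigma_positive A \<sigma> P a"
    have aA: "a \<in> carrier A" "\<sigma> a = a" using a by (auto simp: Sym_def)
    have dM: "H f (a \<otimes> f) \<in> hermitian_scalars" if f: "f \<in> carrier A" for f
    proof (rule ccontr)
      assume n: "H f (a \<otimes> f) \<notin> hermitian_scalars"
      have "cj (H f (a \<otimes> f)) = H (a \<otimes> f) f" using hermitianD(3)[OF hermitian_H, of f "a \<otimes> f"] f aA by simp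
      also have "\<dots> = H f (a \<otimes> f)" using f aA by (simp add: H_def s_mult m_assoc)
      finally have "H f (a \<otimes> f) \<in> F" by (simp add: F_iff)
      \<comment> \<open>If the value were outside the preordering, some ordering that is nonnegative
        on the preordering would make it negative. By \<open>hs\<close> this is a sigma-ordering,
        which contradicts the positivity of \<open>a\<close>.\<close>
      from artin_schreier_preordering[OF F_subfield M two this n] obtain P where
        P: "field_ordering F P" "\<And>m. m \<in> hermitian_scalars \<Longrightarrow> (0, m) \<in> P" "(0, H f (a \<otimes> f)) \<notin> P" by blast
      then have "sigma_ordering A \<sigma> P" using hs by (auto simp: sigma_ordering_iff)
      then have "sigma_positive A \<sigma> P a" using pos by blast
      then show False using P f a by (simp add: sigma_positive_iff)
    qed
    obtain m d g where g: "\<And>k. k < (m::nat) \<Longrightarrow> g k \<in> carrier A"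
      and d: "\<And>k. k < m \<Longrightarrow> d k \<noteq> 0 \<and> (\<exists>f\<in>carrier A. d k = H f (a \<otimes> f))"
      and ad: "a = (\<Oplus>k\<in>{..<m}. inverse (d k) \<odot> (g k \<otimes> \<sigma> (g k)))"
      by (rule symmetric_decomposition[OF a]) (rule that; assumption)
    show "sohs a"
      unfolding ad
    proof (rule sohs_finsum)
      fix k assume "k \<in> {..<m}"
      then have k: "k < m" by simp
      have "d k \<in> hermitian_scalars" using d[OF k] dM by auto
      then have "inverse (d k) \<in> hermitian_scalars" by (rule preordering_inverse[OF F_subfield M])
      \<comment> \<open>The hermitian square here is that of \<open>\<sigma> (g k)\<close>.\<close>
      moreover have "sohs (g k \<otimes> \<sigma> (g k))" using sohs_square[of "\<sigma> (g k)"] g[OF k] by simp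
      ultimately show "sohs (inverse (d k) \<odot> (g k \<otimes> \<sigma> (g k)))" by (rule sohs_smult)
    qed
  qed
qed (blast intro: PS_Conjecture_H)

end

section \<open>The tensor product of algebras with involution\<close>

lemma (in tensor_product) cls_sum:
  assumes "finite S" "\<And>u. u \<in> S \<Longrightarrow> f u \<in> carrier Fr"
  shows "sum f S \<in> carrier Fr \<and> cls (sum f S) = (\<Oplus>\<^bsub>T\<^esub>u\<in>S. cls (f u))"
  using assms
proof (induction S)
  case (insert u S)
  then have "(\<lambda>u. cls (f u)) \<in> S \<rightarrow> carrier T" "cls (f u) \<in> carrier T" by auto
  with insert show ?case by (simp add: Fr_add_closed flip: T_add_cls)
qed (simp add: T_zero)

text \<open>Equality of the conjugations is what makes the tensor involution compatible with moving
  a scalar from one factor to the other; equality of the fixed fields follows from it.\<close>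

locale involutive_tensor =
  tensor_based A B I b coord + AA: involutive_csa A I b coord \<sigma> + BB: involutive_csa B J b' coord' \<tau>
  for A :: "('k::field, 'a) module" and B :: "('k, 'b) module" and I :: "'i set" and b coord
    and J :: "'j set" and b' coord' and \<sigma> \<tau> +
  assumes same_cj: "center_conj B \<tau> c = center_conj A \<sigma> c"
begin

abbreviation "\<rho> \<equiv> tensor_involution A B \<sigma> \<tau>"

lemma rho_hyps:
  "\<And>c a y. a \<in> carrier A \<Longrightarrow> y \<in> carrier B \<Longrightarrow> pt (\<sigma> (c \<odot>\<^bsub>A\<^esub> a)) (\<tau> y) \<in> carrier T"
  "\<And>c d a y. a \<in> carrier A \<Longrightarrow> y \<in> carrier B \<Longrightarrow>
    pt (\<sigma> ((c + d) \<odot>\<^bsub>A\<^esub> a)) (\<tau> y) = pt (\<sigma> (c \<odot>\<^bsub>A\<^esub> a)) (\<tau> y) \<oplus>\<^bsub>T\<^esub> pt (\<sigma> (d \<odot>\<^bsub>A\<^esub> a)) (\<tau> y)"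
  "\<And>c a a' y. a \<in> carrier A \<Longrightarrow> a' \<in> carrier A \<Longrightarrow> y \<in> carrier B \<Longrightarrow>
    pt (\<sigma> (c \<odot>\<^bsub>A\<^esub> (a \<oplus>\<^bsub>A\<^esub> a'))) (\<tau> y) = pt (\<sigma> (c \<odot>\<^bsub>A\<^esub> a)) (\<tau> y) \<oplus>\<^bsub>T\<^esub> pt (\<sigma> (c \<odot>\<^bsub>A\<^esub> a')) (\<tau> y)"
  "\<And>c a y y'. a \<in> carrier A \<Longrightarrow> y \<in> carrier B \<Longrightarrow> y' \<in> carrier B \<Longrightarrow>
    pt (\<sigma> (c \<odot>\<^bsub>A\<^esub> a)) (\<tau> (y \<oplus>\<^bsub>B\<^esub> y')) = pt (\<sigma> (c \<odot>\<^bsub>A\<^esub> a)) (\<tau> y) \<oplus>\<^bsub>T\<^esub> pt (\<sigma> (c \<odot>\<^bsub>A\<^esub> a)) (\<tau> y')"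
  "\<And>c d a y. a \<in> carrier A \<Longrightarrow> y \<in> carrier B \<Longrightarrow>
    pt (\<sigma> (c \<odot>\<^bsub>A\<^esub> (d \<odot>\<^bsub>A\<^esub> a))) (\<tau> y) = pt (\<sigma> ((c * d) \<odot>\<^bsub>A\<^esub> a)) (\<tau> y)"
  "\<And>c d a y. a \<in> carrier A \<Longrightarrow> y \<in> carrier B \<Longrightarrow>
    pt (\<sigma> (c \<odot>\<^bsub>A\<^esub> a)) (\<tau> (d \<odot>\<^bsub>B\<^esub> y)) = pt (\<sigma> ((c * d) \<odot>\<^bsub>A\<^esub> a)) (\<tau> y)"
  by (simp_all add: A.smult_l_distr A.smult_r_distr AA.s_add BB.s_add pt_add_l pt_add_r A.smult_assoc
      AA.s_smult BB.s_smult same_cj pt_smult_l pt_smult_r AA.cj_mult T.smult_assoc)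
    (simp add: mult.commute flip: T.smult_assoc)

text \<open>All representatives of \<open>x\<close> contribute the same class, so the union defining
  \<open>\<rho>\<close> is that class. In this form additivity and the value on pure tensors come
  from the general lifting.\<close>

lemma rho_eq_tlift:
  assumes "x \<in> carrier T"
  shows "\<rho> x = tlift T (\<lambda>c a y. pt (\<sigma> (c \<odot>\<^bsub>A\<^esub> a)) (\<tau> y)) x"
proof -
  obtain f0 where f0: "x = cls f0" "f0 \<in> carrier Fr" using assms by (auto simp: T_carrier)
  have "cls (\<Sum>u\<in>Poly_Mapping.keys f. Poly_Mapping.single (\<sigma> (Poly_Mapping.lookup f u \<odot>\<^bsub>A\<^esub> fst u), \<tau> (snd u)) 1)
      = tlift T (\<lambda>c a y. pt (\<sigma> (c \<odot>\<^bsub>A\<^esub> a)) (\<tau> y)) x" if f: "f \<in> x" for f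
  proof -
    have "f - f0 \<in> N" using f f0 by (simp add: mem_cls)
    then have "cls f = x" "f \<in> carrier Fr"
      using f0 N_sub_Fr[of "f - f0"] Fr_add_closed[of "f - f0" f0] by (auto simp: cls_eq_iff)
    have u: "fst u \<in> carrier A" "snd u \<in> carrier B" if "u \<in> Poly_Mapping.keys f" for u
      using that \<open>f \<in> carrier Fr\<close> by (auto simp: Fr_carrier)
    have "cls (\<Sum>u\<in>Poly_Mapping.keys f. Poly_Mapping.single (\<sigma> (Poly_Mapping.lookup f u \<odot>\<^bsub>A\<^esub> fst u), \<tau> (snd u)) 1)
      = (\<Oplus>\<^bsub>T\<^esub>u\<in>Poly_Mapping.keys f. cls (Poly_Mapping.single (\<sigma> (Poly_Mapping.lookup f u \<odot>\<^bsub>A\<^esub> fst u), \<tau> (snd u)) 1))"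
      using u by (intro cls_sum[THEN conjunct2]) auto
    also have "\<dots> = tlift T (\<lambda>c a y. pt (\<sigma> (c \<odot>\<^bsub>A\<^esub> a)) (\<tau> y)) (cls f)"
      by (subst tlift_cls[OF T.is_abelian_group rho_hyps \<open>f \<in> carrier Fr\<close>]) (simp_all add: pure_tensor_def)
    finally show ?thesis by (simp only: \<open>cls f = x\<close>)
  qed
  then have "\<rho> x = (\<Union>f\<in>x. tlift T (\<lambda>c a y. pt (\<sigma> (c \<odot>\<^bsub>A\<^esub> a)) (\<tau> y)) x)"
    unfolding tensor_involution_def by (intro SUP_cong refl)
  also have "\<dots> = tlift T (\<lambda>c a y. pt (\<sigma> (c \<odot>\<^bsub>A\<^esub> a)) (\<tau> y)) x"
    using cls_self[of f0] f0 by blast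
  finally show ?thesis .
qed

lemma rho_closed [simp]: "x \<in> carrier T \<Longrightarrow> \<rho> x \<in> carrier T"
  using tlift_closed[OF T.is_abelian_group rho_hyps] by (simp add: rho_eq_tlift)

lemma rho_add: "x \<in> carrier T \<Longrightarrow> y \<in> carrier T \<Longrightarrow> \<rho> (x \<oplus>\<^bsub>T\<^esub> y) = \<rho> x \<oplus>\<^bsub>T\<^esub> \<rho> y"
  using tlift_add[OF T.is_abelian_group rho_hyps] by (simp add: rho_eq_tlift)

lemma rho_pt: "a \<in> carrier A \<Longrightarrow> y \<in> carrier B \<Longrightarrow> \<rho> (pt a y) = pt (\<sigma> a) (\<tau> y)"
  using tlift_pt[OF T.is_abelian_group rho_hyps, of a y] by (simp add: rho_eq_tlift)

lemma involution_rho: "involution T \<rho>"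
  unfolding involution_def
proof (intro conjI ballI)
  show "\<rho> (\<rho> x) = x" if "x \<in> carrier T" for x
    using that by (induction x rule: T_induct) (simp_all add: rho_pt rho_add)
  show "\<rho> (x \<otimes>\<^bsub>T\<^esub> y) = \<rho> y \<otimes>\<^bsub>T\<^esub> \<rho> x" if "x \<in> carrier T" "y \<in> carrier T" for x y
    using that(1)
  proof (induction x rule: T_induct)
    case x: (pure a z)
    show ?case using that(2)
    proof (induction y rule: T_induct)
      case (pure a' z')
      then show ?case using x by (simp add: pt_mult rho_pt AA.s_mult BB.s_mult)
    qed (use x in \<open>simp_all add: T.r_distr T.l_distr rho_add\<close>)
  qed (use that(2) in \<open>simp_all add: T.r_distr T.l_distr rho_add\<close>)
qed (simp_all add: rho_add)

text \<open>The tensor product is again a central simple algebra with involution and a basis, so the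
  criterion \<open>PS_Conjecture_iff\<close> becomes available for it.\<close>

sublocale TT: involutive_csa T "I \<times> J" "\<lambda>(i, j). pt (b i) (b' j)" "\<lambda>(i, j) x. coord' j (tcoord i x)" \<rho>
proof (intro involutive_csa.intro algebra_with_basis.intro involutive_csa_axioms.intro)
  show "based_space T (carrier T) (I \<times> J) (\<lambda>(i, j). pt (b i) (b' j)) (\<lambda>(i, j) x. coord' j (tcoord i x))"
    by (rule based_space_tensor[OF BB.based_space_axioms])
  show "\<one>\<^bsub>T\<^esub> \<noteq> \<zero>\<^bsub>T\<^esub>" by (rule T_one_neq_zero[OF AA.one_neq_zero BB.one_neq_zero])
  show "center T = scalars T" by (rule T_central[OF BB.one_neq_zero AA.central BB.central])
  show "\<And>Q. ideal Q T \<Longrightarrow> Q = {\<zero>\<^bsub>T\<^esub>} \<or> Q = carrier T"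
    by (rule T_simple[OF AA.one_neq_zero AA.central AA.simple BB.simple])
  show "involution T \<rho>" by (rule involution_rho)
  show "\<And>n. of_nat n = (0::'k) \<Longrightarrow> n = 0" by (rule AA.char0)
qed

section \<open>The hermitian form on the tensor product\<close>

lemma cj_T: "center_conj T \<rho> c = center_conj A \<sigma> c"
proof -
  have "\<rho> (c \<odot>\<^bsub>T\<^esub> \<one>\<^bsub>T\<^esub>) = \<rho> (pt (c \<odot>\<^bsub>A\<^esub> \<one>\<^bsub>A\<^esub>) \<one>\<^bsub>B\<^esub>)" by (simp add: pt_one pt_smult_l)
  also have "\<dots> = pt (\<sigma> (c \<odot>\<^bsub>A\<^esub> \<one>\<^bsub>A\<^esub>)) (\<tau> \<one>\<^bsub>B\<^esub>)" by (rule rho_pt) auto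
  also have "\<dots> = center_conj A \<sigma> c \<odot>\<^bsub>T\<^esub> \<one>\<^bsub>T\<^esub>" by (simp add: AA.s_scalar BB.s_one pt_one pt_smult_l)
  finally show ?thesis using TT.s_scalar[of c] TT.scalar_eq_iff by metis
qed

lemma F_T: "c \<in> fixed_field T \<rho> \<longleftrightarrow> c \<in> fixed_field A \<sigma>" "c \<in> fixed_field T \<rho> \<longleftrightarrow> c \<in> fixed_field B \<tau>"
  by (simp_all add: TT.F_iff AA.F_iff BB.F_iff cj_T same_cj)

text \<open>In the product basis, each diagonal coefficient of multiplication by
  \<open>a \<otimes> y\<close> is the product of the diagonal coefficients for \<open>a\<close> and
  \<open>y\<close>, so the double sum factors.\<close>

lemma tr_pt: "a \<in> carrier A \<Longrightarrow> y \<in> carrier B \<Longrightarrow> TT.tr (pt a y) = AA.tr a * BB.tr y"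
  unfolding TT.tr_alt AA.tr_alt BB.tr_alt sum_product sum.cartesian_product
  by (intro sum.cong) (auto simp: pt_mult tcoord_pt BB.coord_smult)

lemma H_pt:
  assumes "a \<in> carrier A" "y \<in> carrier B" "a' \<in> carrier A" "y' \<in> carrier B"
  shows "TT.H (pt a y) (pt a' y') = AA.H a a' * BB.H y y'"
  using assms by (simp add: TT.H_def AA.H_def BB.H_def rho_pt pt_mult tr_pt)

text \<open>The map \<open>x \<mapsto> x \<otimes> 1\<close> is a ring homomorphism compatible with
  the involutions, so it carries hermitian squares to hermitian squares.\<close>

lemma hermitian_scalars_A: "c \<in> AA.hermitian_scalars \<Longrightarrow> c \<in> TT.hermitian_scalars"
proof -
  assume c: "c \<in> AA.hermitian_scalars"
  have "TT.sohs (pt x \<one>\<^bsub>B\<^esub>)" if "AA.sohs x" for x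
    using that
  proof (induction rule: AA.sohs_induct)
    case zero
    then show ?case by (simp add: pt_zero_l TT.sohs_zero)
  next
    case (add x y)
    then show ?case
      using TT.sohs_add_square[of "pt x \<one>\<^bsub>B\<^esub>" "pt y \<one>\<^bsub>B\<^esub>"] by (simp add: pt_add_l rho_pt pt_mult BB.s_one)
  qed
  from this[of "c \<odot>\<^bsub>A\<^esub> \<one>\<^bsub>A\<^esub>"] c show ?thesis
    by (simp add: AA.hermitian_scalars_def TT.hermitian_scalars_def F_T(1) pt_smult_l pt_one)
qed

lemma hermitian_scalars_B: "c \<in> BB.hermitian_scalars \<Longrightarrow> c \<in> TT.hermitian_scalars"
proof -
  assume c: "c \<in> BB.hermitian_scalars"
  have "TT.sohs (pt \<one>\<^bsub>A\<^esub> x)" if "BB.sohs x" for x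
    using that
  proof (induction rule: BB.sohs_induct)
    case zero
    then show ?case by (simp add: pt_zero_r TT.sohs_zero)
  next
    case (add x y)
    then show ?case
      using TT.sohs_add_square[of "pt \<one>\<^bsub>A\<^esub> x" "pt \<one>\<^bsub>A\<^esub> y"] by (simp add: pt_add_r rho_pt pt_mult AA.s_one)
  qed
  from this[of "c \<odot>\<^bsub>B\<^esub> \<one>\<^bsub>B\<^esub>"] c show ?thesis
    by (simp add: BB.hermitian_scalars_def TT.hermitian_scalars_def F_T(2) pt_smult_r pt_one)
qed

text \<open>The hermitian square of the scalar \<open>c\<close>. For an involution of the second
  kind this is a norm and need not be a square in the fixed field.\<close>

lemma norm_hermitian_scalar: "center_conj T \<rho> c * c \<in> TT.hermitian_scalars"
proof -
  have "\<rho> (c \<odot>\<^bsub>T\<^esub> \<one>\<^bsub>T\<^esub>) \<otimes>\<^bsub>T\<^esub> (c \<odot>\<^bsub>T\<^esub> \<one>\<^bsub>T\<^esub>) = (center_conj T \<rho> c * c) \<odot>\<^bsub>T\<^esub> \<one>\<^bsub>T\<^esub>"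
    unfolding TT.s_scalar by (simp add: T.smult_mult_l T.smult_assoc)
  then show ?thesis
    using TT.sohs_square[of "c \<odot>\<^bsub>T\<^esub> \<one>\<^bsub>T\<^esub>"]
    by (simp add: TT.hermitian_scalars_def TT.F_iff TT.cj_mult mult.commute)
qed

theorem PS_Conjecture_tensor:
  assumes A: "PS_Conjecture A \<sigma>" and B: "PS_Conjecture B \<tau>"
  shows "PS_Conjecture T \<rho>"
  unfolding TT.PS_Conjecture_iff
proof
  fix x assume x: "x \<in> carrier T"
  \<comment> \<open>The decomposition of the symmetric element \<open>1\<close> diagonalises the
    form \<open>H\<close> itself; the denominators are then values \<open>H f f\<close>, which lie
    in the preordering by hypothesis.\<close>
  have one: "\<one>\<^bsub>A\<^esub> \<in> Sym A \<sigma>" "\<one>\<^bsub>B\<^esub> \<in> Sym B \<tau>" by (simp_all add: Sym_def AA.s_one BB.s_one)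
  obtain m :: nat and d g where g: "\<And>k. k < m \<Longrightarrow> g k \<in> carrier A"
    and d: "\<And>k. k < m \<Longrightarrow> d k \<noteq> 0 \<and> (\<exists>f\<in>carrier A. d k = AA.H f (\<one>\<^bsub>A\<^esub> \<otimes>\<^bsub>A\<^esub> f))"
    and HA: "\<And>x y. x \<in> carrier A \<Longrightarrow> y \<in> carrier A \<Longrightarrow>
      AA.H x (\<one>\<^bsub>A\<^esub> \<otimes>\<^bsub>A\<^esub> y) = (\<Sum>k<m. AA.H x (g k) * AA.H (g k) y / d k)"
    by (rule AA.symmetric_decomposition[OF one(1)]) (rule that; assumption)
  obtain m' :: nat and d' g' where g': "\<And>l. l < m' \<Longrightarrow> g' l \<in> carrier B"
    and d': "\<And>l. l < m' \<Longrightarrow> d' l \<noteq> 0 \<and> (\<exists>f\<in>carrier B. d' l = BB.H f (\<one>\<^bsub>B\<^esub> \<otimes>\<^bsub>B\<^esub> f))"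
    and HB: "\<And>x y. x \<in> carrier B \<Longrightarrow> y \<in> carrier B \<Longrightarrow>
      BB.H x (\<one>\<^bsub>B\<^esub> \<otimes>\<^bsub>B\<^esub> y) = (\<Sum>l<m'. BB.H x (g' l) * BB.H (g' l) y / d' l)"
    by (rule BB.symmetric_decomposition[OF one(2)]) (rule that; assumption)
  define S where "S = {..<m} \<times> {..<m'}"
  define G where "G s = pt (g (fst s)) (g' (snd s))" for s
  define e where "e s = inverse (d (fst s)) * inverse (d' (snd s))" for s
  have G: "G s \<in> carrier T" if "s \<in> S" for s using that g g' by (auto simp: S_def G_def)
  note M = TT.preordering_hermitian_scalars
  have e: "e s \<in> TT.hermitian_scalars" if "s \<in> S" for s
  proof -
    have "d (fst s) \<in> AA.hermitian_scalars" using d[of "fst s"] that AA.PS_Conjecture_H[OF A] by (auto simp: S_def)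
    moreover have "d' (snd s) \<in> BB.hermitian_scalars" using d'[of "snd s"] that BB.PS_Conjecture_H[OF B] by (auto simp: S_def)
    ultimately show ?thesis
      unfolding e_def
      by (intro preorderingD(3)[OF M] preordering_inverse[OF TT.F_subfield M] hermitian_scalars_A hermitian_scalars_B)
  qed
  \<comment> \<open>Both sides are additive in each argument, so pure tensors suffice. There
    \<open>H\<close> is a product of two forms, and the two diagonalisations multiply out with
    \<open>e s\<close> collecting the denominators.\<close>
  have HT: "TT.H x y = (\<Sum>s\<in>S. e s * (TT.H x (G s) * TT.H (G s) y))"
    if "x \<in> carrier T" "y \<in> carrier T" for x y
    using that(1)
  proof (induction x rule: T_induct)
    case x: (pure a z)
    show ?case using that(2)
    proof (induction y rule: T_induct)
      case y: (pure a' z')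
      have "TT.H (pt a z) (pt a' z') = (\<Sum>k<m. AA.H a (g k) * AA.H (g k) a' / d k) * (\<Sum>l<m'. BB.H z (g' l) * BB.H (g' l) z' / d' l)"
        using HA[of a a'] HB[of z z'] x y by (simp add: H_pt)
      also have "\<dots> = (\<Sum>s\<in>S. e s * (TT.H (pt a z) (G s) * TT.H (G s) (pt a' z')))"
        unfolding sum_product sum.cartesian_product S_def[symmetric]
        using x y g g' by (intro sum.cong refl) (auto simp: S_def G_def e_def H_pt divide_inverse mult_ac)
      finally show ?case .
    next
      case (add y y')
      have "TT.H (pt a z) (y \<oplus>\<^bsub>T\<^esub> y') = TT.H (pt a z) y + TT.H (pt a z) y'"
        using x add by (simp add: TT.hermitianD(1)[OF TT.hermitian_H])
      also have "\<dots> = (\<Sum>s\<in>S. e s * (TT.H (pt a z) (G s) * TT.H (G s) (y \<oplus>\<^bsub>T\<^esub> y')))"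
        unfolding add(3,4) sum.distrib[symmetric]
        using add G by (intro sum.cong refl) (simp add: TT.hermitianD(1)[OF TT.hermitian_H] algebra_simps)
      finally show ?case .
    qed
  next
    case (add x x')
    have "TT.H (x \<oplus>\<^bsub>T\<^esub> x') y = TT.H x y + TT.H x' y"
      using that(2) add by (simp add: TT.hermitian_left(1)[OF TT.hermitian_H])
    also have "\<dots> = (\<Sum>s\<in>S. e s * (TT.H (x \<oplus>\<^bsub>T\<^esub> x') (G s) * TT.H (G s) y))"
      unfolding add(3,4) sum.distrib[symmetric]
      using add G by (intro sum.cong refl) (simp add: TT.hermitian_left(1)[OF TT.hermitian_H] algebra_simps)
    finally show ?case .
  qed
  have z: "0 \<in> TT.hermitian_scalars" using preorderingD(4)[OF M, of 0] is_subfieldD(2)[OF TT.F_subfield] by simp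
  have "(\<Sum>s\<in>S'. e s * (TT.H x (G s) * TT.H (G s) x)) \<in> TT.hermitian_scalars" if "finite S'" "S' \<subseteq> S" for S'
    using that
  proof (induction S')
    case (insert s S')
    \<comment> \<open>On the diagonal each term is \<open>e s\<close> times the product of
      \<open>TT.H (G s) x\<close> with its conjugate.\<close>
    have "TT.H x (G s) = center_conj T \<rho> (TT.H (G s) x)"
      using TT.hermitianD(3)[OF TT.hermitian_H G x] insert by auto
    then have "TT.H x (G s) * TT.H (G s) x \<in> TT.hermitian_scalars" using norm_hermitian_scalar by simp
    then show ?case using insert e preorderingD(2,3)[OF M] by simp
  qed (simp add: z)
  from this[of S] show "TT.H x x \<in> TT.hermitian_scalars" using HT[OF x x] by (simp add: S_def)
qed

end

text \<open>If \<open>n = Suc m\<close> vanished in the field, then \<open>- 1\<close> would be a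
  sum of \<open>m\<close> squares of \<open>1\<close>.\<close>

lemma formally_real_char0:
  assumes "formally_real (F :: 'k::field set)" "1 \<in> F" "of_nat n = (0::'k)"
  shows "n = 0"
proof (rule ccontr)
  assume "n \<noteq> 0"
  then obtain m where m: "n = Suc m" by (cases n) auto
  have "(\<Sum>x\<leftarrow>replicate m (1::'k). x\<^sup>2) = of_nat m" by (simp add: sum_list_replicate)
  also have "\<dots> = - 1" using assms(3) m by (simp add: eq_neg_iff_add_eq_0 add.commute)
  finally show False
    using assms(1,2) unfolding formally_real_def by (metis set_replicate_conv_if empty_subsetI insert_subset)
qed

lemma involutive_csa_exists_basis:
  fixes A :: "('k::field, 'a) module"
  assumes "central_simple_algebra A" "involution A \<sigma>" "formally_real (fixed_field A \<sigma>)"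
  obtains n :: nat and b coord where "involutive_csa A {..<n} b coord \<sigma>"
proof -
  interpret A: algebra_over A
    using central_simple_algebra.axioms(1)[OF assms(1)] by (simp add: assoc_algebra_iff)
  note csa = central_simple_algebra.one_neq_zero[OF assms(1)] central_simple_algebra.central[OF assms(1)]
    central_simple_algebra.simple[OF assms(1)]
  obtain n where "A.dimension n (scalars A) (carrier A)"
    using central_simple_algebra.finite_dim[OF assms(1)] by (auto simp: A.finite_dimension_def)
  then obtain b coord where b: "based_space A (carrier A) {..<n} b coord"
    using A.based_space_of_dimension[OF csa(1)] by blast
  have "\<sigma> \<one>\<^bsub>A\<^esub> = \<one>\<^bsub>A\<^esub>"
    using assms(2) A.l_one[of "\<sigma> \<one>\<^bsub>A\<^esub>"] A.r_one[of "\<sigma> \<one>\<^bsub>A\<^esub>"] A.one_closed unfolding involution_def by metis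
  then have "1 \<in> fixed_field A \<sigma>" by (simp add: fixed_field_def)
  from formally_real_char0[OF assms(3) this] have "involutive_csa A {..<n} b coord \<sigma>"
    by (intro involutive_csa.intro algebra_with_basis.intro b involutive_csa_axioms.intro csa assms(2))
  then show thesis by (rule that)
qed

text \<open>An element \<open>c\<close> outside the fixed field \<open>F\<close> is a root of a quadratic polynomial over \<open>F\<close> whose
  other root is the conjugate of \<open>c\<close>; hence both conjugations send \<open>c\<close> to the other root.\<close>

lemma center_conj_unique:
  assumes "involutive_csa A I b coord \<sigma>" "involutive_csa B J b' coord' \<tau>"
    and "fixed_field A \<sigma> = fixed_field B \<tau>"
  shows "center_conj B \<tau> c = center_conj A \<sigma> c"
proof -
  interpret A: involutive_csa A I b coord \<sigma> by fact
  interpret B: involutive_csa B J b' coord' \<tau> by fact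
  have same: "A.cj d = d \<longleftrightarrow> B.cj d = d" for d using assms(3) A.F_iff B.F_iff by blast
  show ?thesis
  proof (cases "A.cj c = c")
    case True
    then show ?thesis using same by metis
  next
    case False
    have "A.cj (c + A.cj c) = c + A.cj c" "A.cj (c * A.cj c) = c * A.cj c"
      by (simp_all add: A.cj_add A.cj_mult add.commute mult.commute)
    then have s: "B.cj c + B.cj (A.cj c) = c + A.cj c" and p: "B.cj c * B.cj (A.cj c) = c * A.cj c"
      using same by (metis B.cj_add, metis B.cj_mult)
    have "B.cj (A.cj c) = c + A.cj c - B.cj c" using s by (simp add: eq_diff_eq add.commute)
    with p have "B.cj c * (c + A.cj c - B.cj c) = c * A.cj c" by simp
    moreover have "(B.cj c - c) * (B.cj c - A.cj c) = c * A.cj c - B.cj c * (c + A.cj c - B.cj c)"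
      by (simp add: algebra_simps)
    ultimately have "(B.cj c - c) * (B.cj c - A.cj c) = 0" by simp
    moreover have "B.cj c \<noteq> c" using False same[of c] by blast
    ultimately show ?thesis by simp
  qed
qed

theorem theorem4p2:
  fixes A :: "('k::field, 'a) module" and B :: "('k, 'b) module"
    and \<sigma> :: "'a \<Rightarrow> 'a" and \<tau> :: "'b \<Rightarrow> 'b" and F :: "'k set"
  assumes "central_simple_algebra A" and "central_simple_algebra B"
    and "involution A \<sigma>" and "involution B \<tau>"
    and "fixed_field A \<sigma> = F" and "fixed_field B \<tau> = F"
    and "formally_real F"
    and "PS_Conjecture A \<sigma>" and "PS_Conjecture B \<tau>"
  shows "PS_Conjecture (tensor_algebra A B) (tensor_involution A B \<sigma> \<tau>)"
proof -
  obtain n b coord where A: "involutive_csa A {..<n::nat} b coord \<sigma>"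
    using involutive_csa_exists_basis[OF assms(1,3), unfolded assms(5), OF assms(7)] by blast
  obtain n' b' coord' where B: "involutive_csa B {..<n'::nat} b' coord' \<tau>"
    using involutive_csa_exists_basis[OF assms(2,4), unfolded assms(6), OF assms(7)] by blast
  interpret A: involutive_csa A "{..<n}" b coord \<sigma> by (rule A)
  interpret B: involutive_csa B "{..<n'}" b' coord' \<tau> by (rule B)
  have "involutive_tensor A B {..<n} b coord {..<n'} b' coord' \<sigma> \<tau>"
    by (intro involutive_tensor.intro involutive_tensor_axioms.intro tensor_based.intro tensor_product.intro
        A.algebra_over_axioms B.algebra_over_axioms A.based_space_axioms A B center_conj_unique[OF A B])
      (simp add: assms)
  then show ?thesis using involutive_tensor.PS_Conjecture_tensor assms(8,9) by blast
qed

end
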